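(* For each $n$ let $p=p(n)$, and let $X_1,\dots,X_n\in\mathbb{R}^p$ be i.i.d. copies of $X=\mu+\xi\Sigma^{1/2}U$, where $\mu\in\mathbb{R}^p$ is a constant vector, $\Sigma\in\mathbb{R}^{p\times p}$ is a positive definite matrix, $U$ is uniformly distributed on the unit sphere $\mathcal{S}^{p-1}\subset\mathbb{R}^p$, and $\xi\in[0,\infty)$ is a random variable independent of $U$ with $\mathbb{E}\xi^2=p$ (so $\mu$, $\Sigma$ and the law of $\xi$ may depend on $n$ through $p$). Let $\theta=\mathbb{E}\xi^4/(p(p+2))$ and let $\hat\theta_n$ be the U-statistic-based estimator of $\theta$ defined in the context. Assume that, as $n\to\infty$: (1) $p=p(n)\to\infty$, $\operatorname{tr}(\Sigma^4)\to\infty$ and $\operatorname{tr}(\Sigma^4)/(\operatorname{tr}(\Sigma^2))^2\to 0$; (2) $\mathbb{E}\xi^8=O(p^4)$. Then $\hat\theta_n-\theta\to 0$ in probability as $n\to\infty$.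
   Context: The estimator is $$\hat\theta_n=\frac{T_1+T_2-2T_3}{T_2+2T_3},$$ where, with sums over all ordered quadruples $(i,j,k,l)$ of mutually distinct indices in $\{1,\dots,n\}$ ($n\ge 4$) and $\|\cdot\|_2$ the Euclidean norm, $$T_1=\frac{1}{4n(n-1)(n-2)(n-3)}\sum_{i\neq j\neq k\neq l}\left(\|X_i-X_j\|_2^2-\|X_k-X_l\|_2^2\right)^2,$$ $$T_2=\frac{1}{4n(n-1)(n-2)(n-3)}\sum_{i\neq j\neq k\neq l}\|X_i-X_j\|_2^2\,\|X_k-X_l\|_2^2,$$ $$T_3=\frac{1}{4n(n-1)(n-2)(n-3)}\sum_{i\neq j\neq k\neq l}\left((X_i-X_j)^\top(X_k-X_l)\right)^2.$$ *)

theory Defs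
  imports "HOL-Probability.Probability" "Jordan_Normal_Form.Matrix"
begin

(* The dimension depends on n, so vectors and matrices are those of Jordan_Normal_Form, with the
   dimension in the carrier; the clashing finite Cartesian products of HOL-Analysis are hidden. *)

hide_type (open) Finite_Cartesian_Product.vec
hide_const (open) Finite_Cartesian_Product.vec Finite_Cartesian_Product.mat
  Finite_Cartesian_Product.row Finite_Cartesian_Product.rows
  Determinants.trace
unbundle no vec_syntax
unbundle no inner_syntax

definition eucl_norm :: "real vec \<Rightarrow> real" where
  "eucl_norm v = sqrt (v \<bullet> v)"

definition mat_trace :: "real mat \<Rightarrow> real" where
  "mat_trace A = (\<Sum>i<dim_row A. A $$ (i, i))"

definition pos_def :: "nat \<Rightarrow> real mat \<Rightarrow> bool" where
  "pos_def p A \<longleftrightarrow> A \<in> carrier_mat p p \<and> A\<^sup>T = A \<and>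
     (\<forall>v\<in>carrier_vec p. v \<noteq> 0\<^sub>v p \<longrightarrow> 0 < v \<bullet> (A *\<^sub>v v))"

(* is_sqrt_mat p S A reads S = A^(1/2), the unique positive definite square root of a
   positive definite A. *)
definition is_sqrt_mat :: "nat \<Rightarrow> real mat \<Rightarrow> real mat \<Rightarrow> bool" where
  "is_sqrt_mat p S A \<longleftrightarrow> pos_def p S \<and> S * S = A"


(* Borel and Lebesgue structure on R^p, transported from the product over {..<p}. *)

definition borel_vec :: "nat \<Rightarrow> real vec measure" where
  "borel_vec p = vimage_algebra (carrier_vec p) (\<lambda>v. \<lambda>i\<in>{..<p}. v $ i) (\<Pi>\<^sub>M i\<in>{..<p}. borel)"

definition lborel_vec :: "nat \<Rightarrow> real vec measure" where
  "lborel_vec p = distr (\<Pi>\<^sub>M i\<in>{..<p}. lborel) (borel_vec p) (vec p)"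

(* Normalised surface measure of the unit sphere of R^p (p > 0), given as usual by the volume of
   cones: sigma(B) = vol {x. 0 < |x| <= 1, x/|x| in B} / vol {x. |x| <= 1}. The origin, where
   x/|x| is 0 by convention, is a null set. *)
definition sphere_uniform :: "nat \<Rightarrow> real vec measure" where
  "sphere_uniform p =
     distr (uniform_measure (lborel_vec p) {x \<in> carrier_vec p. eucl_norm x \<le> 1})
       (borel_vec p) (\<lambda>x. (1 / eucl_norm x) \<cdot>\<^sub>v x)"

(* The library's indep_var requires both variables to have the same codomain type. *)
definition (in prob_space) indep_rv ::
    "'b measure \<Rightarrow> ('a \<Rightarrow> 'b) \<Rightarrow> 'c measure \<Rightarrow> ('a \<Rightarrow> 'c) \<Rightarrow> bool" where
  "indep_rv S X T Y \<longleftrightarrow> random_variable S X \<and> random_variable T Y \<and>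
     indep_set {X -` A \<inter> space M | A. A \<in> sets S} {Y -` B \<inter> space M | B. B \<in> sets T}"

(* Each Z n lives on its own probability space M n. *)
definition tendsto_in_prob :: "(nat \<Rightarrow> 'a measure) \<Rightarrow> (nat \<Rightarrow> 'a \<Rightarrow> real) \<Rightarrow> real \<Rightarrow> bool" where
  "tendsto_in_prob M Z c \<longleftrightarrow>
     (\<forall>\<epsilon>>0. (\<lambda>n. measure (M n) {\<omega> \<in> space (M n). \<epsilon> < \<bar>Z n \<omega> - c\<bar>}) \<longlonglongrightarrow> 0)"


definition quadruples :: "nat \<Rightarrow> (nat \<times> nat \<times> nat \<times> nat) set" where
  "quadruples n = {(i, j, k, l). {i, j, k, l} \<subseteq> {1..n} \<and> distinct [i, j, k, l]}"

definition T1 :: "nat \<Rightarrow> (nat \<Rightarrow> real vec) \<Rightarrow> real" where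
  "T1 n x = 1 / (4 * real n * (real n - 1) * (real n - 2) * (real n - 3)) *
     (\<Sum>(i, j, k, l)\<in>quadruples n. ((eucl_norm (x i - x j))\<^sup>2 - (eucl_norm (x k - x l))\<^sup>2)\<^sup>2)"

definition T2 :: "nat \<Rightarrow> (nat \<Rightarrow> real vec) \<Rightarrow> real" where
  "T2 n x = 1 / (4 * real n * (real n - 1) * (real n - 2) * (real n - 3)) *
     (\<Sum>(i, j, k, l)\<in>quadruples n. (eucl_norm (x i - x j))\<^sup>2 * (eucl_norm (x k - x l))\<^sup>2)"

definition T3 :: "nat \<Rightarrow> (nat \<Rightarrow> real vec) \<Rightarrow> real" where
  "T3 n x = 1 / (4 * real n * (real n - 1) * (real n - 2) * (real n - 3)) *
     (\<Sum>(i, j, k, l)\<in>quadruples n. ((x i - x j) \<bullet> (x k - x l))\<^sup>2)"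

definition theta_hat :: "nat \<Rightarrow> (nat \<Rightarrow> real vec) \<Rightarrow> real" where
  "theta_hat n x = (T1 n x + T2 n x - 2 * T3 n x) / (T2 n x + 2 * T3 n x)"

end

(* Write t = tr Sigma, s = tr Sigma^2 and b = t^2 + 2 s. The kernel of T1 + T2 - 2 T3 has mean theta b
   and that of T2 + 2 T3 has mean b, so theta_hat is a ratio of two U-statistics whose expectations
   have ratio theta. Both kernels have second moment O(t^4) = O(b^2), because E|X - mu|^8 is
   O(E xi^8 (t/p)^4). Kernels at disjoint quadruples are independent and a quadruple meets at most
   16 n^3 others, so the relative variance of each U-statistic is O(1/n), and Chebyshev's inequality
   applied to the denominator and to numerator - theta * denominator gives the claim.

   The moments of the uniform law on the sphere come from a standard Gaussian vector g: its radius and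
   direction are independent and g/|g| is uniform on the sphere, so a moment of (a, U) is the moment
   of (a, g) divided by that of |g|. *)

theory Submission
  imports Defs
begin

section \<open>Gaussian vectors\<close>

text \<open>The shape of the estimator comes from a few means. With tau = E|X - mu|^4, a squared
  distance of two observations has mean 2 t and second moment 2 tau + 2 t^2 + 4 s, and the squared
  inner product of two disjoint differences has mean 4 s. So T1 + T2 - 2 T3 isolates tau, T2 + 2 T3
  isolates t^2 + 2 s, and the elliptical model supplies tau = theta (t^2 + 2 s). Since theta moves
  with n, numerator and denominator have no common limits to divide; the mean-zero variable
  numerator - theta * denominator replaces them, and the eighth moment of xi keeps theta bounded. No
  exact variance is computed: both kernels are dominated by the square of a sum of squared norms, so
  one crude moment bound serves both. Its constant must be free of p, and for this reason the fourth
  power of the quadratic form in U is bounded with weights equal to the coordinate variances. Radius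
  and direction are separated without spherical coordinates, by the scaling of balls alone.\<close>

definition gauss :: "nat \<Rightarrow> (nat \<Rightarrow> real) measure" where
  "gauss p = (\<Pi>\<^sub>M i\<in>{..<p}. density lborel std_normal_density)"

lemma sets_gauss [measurable_cong]: "sets (gauss p) = sets (\<Pi>\<^sub>M i\<in>{..<p}. borel)"
  unfolding gauss_def by (intro sets_PiM_cong) auto

lemma prob_space_gauss: "prob_space (gauss p)"
  unfolding gauss_def by (intro prob_space_PiM prob_space_normal_density) simp

lemma gauss_component:
  assumes "i < p"
  shows "distributed (gauss p) lborel (\<lambda>x. x i) std_normal_density"
proof -
  have "distr (gauss p) (density lborel std_normal_density) (\<lambda>x. x i) = density lborel std_normal_density"
    unfolding gauss_def using assms
    by (intro distr_PiM_component prob_space_normal_density) auto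
  also have "distr (gauss p) (density lborel std_normal_density) (\<lambda>x. x i) = distr (gauss p) lborel (\<lambda>x. x i)"
    by (rule distr_cong) auto
  finally have "distr (gauss p) lborel (\<lambda>x. x i) = density lborel std_normal_density" .
  moreover have "(\<lambda>x. x i) \<in> measurable (gauss p) lborel"
    using assms unfolding measurable_lborel2
    by (subst measurable_cong_sets[OF sets_gauss refl]) (auto intro: measurable_component_singleton)
  ultimately show ?thesis
    by (simp add: distributed_def)
qed

lemma measurable_gauss_component [measurable]:
  "i < p \<Longrightarrow> (\<lambda>x. x i) \<in> borel_measurable (gauss p)"
  by (subst measurable_cong_sets[OF sets_gauss refl]) (auto intro: measurable_component_singleton)

text \<open>The joint law of the coordinates is by construction the product of their laws, which
  characterises independence over a nonempty index set; hence \<open>p \<ge> 1\<close>.\<close>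

lemma gauss_indep:
  assumes "p \<ge> 1"
  shows "prob_space.indep_vars (gauss p) (\<lambda>_. borel) (\<lambda>i x. x i) {..<p}"
proof -
  interpret prob_space "gauss p" by (rule prob_space_gauss)
  have comp: "distr (gauss p) borel (\<lambda>x. x i) = density lborel std_normal_density" if "i < p" for i
    using gauss_component[OF that] by (auto simp: distributed_def cong: distr_cong)
  have "distr (gauss p) (\<Pi>\<^sub>M i\<in>{..<p}. borel) (\<lambda>x. \<lambda>i\<in>{..<p}. x i) = distr (gauss p) (gauss p) (\<lambda>x. x)"
    by (rule distr_cong)
      (simp, simp add: sets_gauss, simp add: gauss_def space_PiM PiE_iff extensional_restrict)
  also have "\<dots> = gauss p" by simp
  also have "\<dots> = (\<Pi>\<^sub>M i\<in>{..<p}. distr (gauss p) borel (\<lambda>x. x i))"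
    unfolding gauss_def[of p] by (rule PiM_cong) (use comp in \<open>auto simp: gauss_def\<close>)
  finally show ?thesis
    using assms by (subst indep_vars_iff_distr_eq_PiM') (auto simp: lessThan_empty_iff)
qed

lemma gauss_linear_form:
  assumes "\<exists>i<p. a i \<noteq> 0"
  shows "distributed (gauss p) lborel (\<lambda>x. \<Sum>i<p. a i * x i)
           (normal_density 0 (sqrt (\<Sum>i<p. (a i)\<^sup>2)))"
proof -
  have p: "p \<ge> 1" using assms by auto
  interpret prob_space "gauss p" by (rule prob_space_gauss)
  \<comment> \<open>A zero coefficient would contribute a point mass, which has no normal density,
    so the sum is restricted to the nonzero ones.\<close>
  define I where "I = {i. i < p \<and> a i \<noteq> 0}"
  have I: "finite I" "I \<noteq> {}" "I \<subseteq> {..<p}" using assms by (auto simp: I_def)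
  have ind: "indep_vars (\<lambda>_. borel) (\<lambda>i x. a i * x i) I"
    using indep_vars_compose2[OF indep_vars_subset[OF gauss_indep[OF p] I(3)],
      of "\<lambda>i x. a i * x" "\<lambda>_. borel"] by simp
  have "distributed (gauss p) lborel (\<lambda>x. a i * x i) (normal_density 0 \<bar>a i\<bar>)" if "i \<in> I" for i
    using normal_density_affine[OF gauss_component[of i], of "a i" 0] that by (auto simp: I_def)
  then have "distributed (gauss p) lborel (\<lambda>x. \<Sum>i\<in>I. a i * x i)
      (normal_density (\<Sum>i\<in>I. 0) (sqrt (\<Sum>i\<in>I. \<bar>a i\<bar>\<^sup>2)))"
    by (intro sum_indep_normal[OF I(1,2) ind]) (auto simp: I_def)
  moreover have "(\<Sum>i\<in>I. \<bar>a i\<bar>\<^sup>2) = (\<Sum>i<p. (a i)\<^sup>2)"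
    by (rule sum.mono_neutral_cong_left) (use I in \<open>auto simp: I_def\<close>)
  moreover have "(\<Sum>i\<in>I. a i * x i) = (\<Sum>i<p. a i * x i)" for x
    by (rule sum.mono_neutral_left) (use I in \<open>auto simp: I_def\<close>)
  ultimately show ?thesis by simp
qed

text \<open>The factor is the double factorial (2k - 1)!!, that is 1, 3 and 105 for k = 1, 2, 4. The
  zero form has no density and is treated apart; there both sides vanish because
  \<open>k \<ge> 1\<close>.\<close>

lemma
  assumes "k \<ge> 1"
  shows gauss_linear_form_even_integrable: "integrable (gauss p) (\<lambda>x. (\<Sum>i<p. a i * x i) ^ (2 * k))"
    and gauss_linear_form_even:
      "(\<integral>x. (\<Sum>i<p. a i * x i) ^ (2 * k) \<partial>gauss p) = fact (2 * k) / (2 ^ k * fact k) * (\<Sum>i<p. (a i)\<^sup>2) ^ k"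
proof -
  define s where "s = sqrt (\<Sum>i<p. (a i)\<^sup>2)"
  have "integrable (gauss p) (\<lambda>x. (\<Sum>i<p. a i * x i) ^ (2 * k)) \<and>
    (\<integral>x. (\<Sum>i<p. a i * x i) ^ (2 * k) \<partial>gauss p) = fact (2 * k) / (2 ^ k * fact k) * (\<Sum>i<p. (a i)\<^sup>2) ^ k"
  proof (cases "\<exists>i<p. a i \<noteq> 0")
    case True
    then obtain j where j: "j < p" "a j \<noteq> 0" by auto
    have "(\<Sum>i<p. (a i)\<^sup>2) > 0"
      by (rule sum_pos2[of _ j]) (use j in auto)
    then have s: "s > 0" "s\<^sup>2 = (\<Sum>i<p. (a i)\<^sup>2)" by (auto simp: s_def)
    note D = gauss_linear_form[OF True, folded s_def]
    have hb: "has_bochner_integral lborel (\<lambda>x. normal_density 0 s x * x ^ (2 * k)) (fact (2 * k) / ((2 / s\<^sup>2)^k * fact k))"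
      using normal_moment_even[OF s(1), of 0 k] by simp
    have "integrable (gauss p) (\<lambda>x. (\<Sum>i<p. a i * x i) ^ (2 * k))"
      using distributed_integrable[OF D, of "\<lambda>x. x ^ (2 * k)"] hb s
      by (auto simp: has_bochner_integral_iff)
    moreover have "(\<integral>x. (\<Sum>i<p. a i * x i) ^ (2 * k) \<partial>gauss p) = fact (2 * k) / ((2 / s\<^sup>2)^k * fact k)"
      using distributed_integral[OF D, of "\<lambda>x. x ^ (2 * k)"] hb s
      by (auto simp: has_bochner_integral_iff)
    ultimately show ?thesis using s by (simp add: power_divide field_simps)
  next
    case False
    then show ?thesis using assms by (simp add: power_0_left)
  qed
  then show "integrable (gauss p) (\<lambda>x. (\<Sum>i<p. a i * x i) ^ (2 * k))"
    and "(\<integral>x. (\<Sum>i<p. a i * x i) ^ (2 * k) \<partial>gauss p) = fact (2 * k) / (2 ^ k * fact k) * (\<Sum>i<p. (a i)\<^sup>2) ^ k"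
    by auto
qed

lemma
  shows gauss_linear_form_integrable: "integrable (gauss p) (\<lambda>x. \<Sum>i<p. a i * x i)"
    and gauss_linear_form_mean: "(\<integral>x. (\<Sum>i<p. a i * x i) \<partial>gauss p) = 0"
proof -
  have "integrable (gauss p) (\<lambda>x. x i) \<and> (\<integral>x. x i \<partial>gauss p) = 0" if "i < p" for i
  proof -
    have "has_bochner_integral lborel (\<lambda>x. std_normal_density x * x) 0"
      using normal_moment_odd[of 1 0 0] by simp
    then show ?thesis
      using distributed_integrable[OF gauss_component[OF that], of "\<lambda>x. x"]
        distributed_integral[OF gauss_component[OF that], of "\<lambda>x. x"]
      by (auto simp: has_bochner_integral_iff)
  qed
  then have i: "integrable (gauss p) (\<lambda>x. x i)" "(\<integral>x. x i \<partial>gauss p) = 0" if "i < p" for i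
    using that by auto
  show "integrable (gauss p) (\<lambda>x. \<Sum>i<p. a i * x i)"
    using i by (intro Bochner_Integration.integrable_sum integrable_mult_right) auto
  show "(\<integral>x. (\<Sum>i<p. a i * x i) \<partial>gauss p) = 0"
    using i by (subst Bochner_Integration.integral_sum) auto
qed

section \<open>Polar decomposition\<close>

definition leb :: "nat \<Rightarrow> (nat \<Rightarrow> real) measure" where
  "leb p = (\<Pi>\<^sub>M i\<in>{..<p}. lborel)"

lemma sets_leb [measurable_cong]: "sets (leb p) = sets (\<Pi>\<^sub>M i\<in>{..<p}. borel)"
  unfolding leb_def by (intro sets_PiM_cong) auto

lemma space_leb: "space (leb p) = {..<p} \<rightarrow>\<^sub>E UNIV"
  by (simp add: leb_def space_PiM)

lemma space_gauss: "space (gauss p) = {..<p} \<rightarrow>\<^sub>E UNIV"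
  by (simp add: gauss_def space_PiM)

section \<open>Box volumes and dilations of Lebesgue measure\<close>

interpretation lborel_product: product_sigma_finite "\<lambda>_::nat. lborel :: real measure" ..

lemma emeasure_leb_box:
  "(\<And>i. i < p \<Longrightarrow> A i \<in> sets borel) \<Longrightarrow> emeasure (leb p) (Pi\<^sub>E {..<p} A) = (\<Prod>i<p. emeasure lborel (A i))"
  unfolding leb_def by (subst lborel_product.emeasure_PiM) auto

lemma measurable_leb_component [measurable]:
  "i < p \<Longrightarrow> (\<lambda>x. x i) \<in> borel_measurable (leb p)"
  by (subst measurable_cong_sets[OF sets_leb refl]) (auto intro: measurable_component_singleton)

lemma measurable_leb_L2_set [measurable]: "(\<lambda>x. L2_set x {..<p}) \<in> borel_measurable (leb p)"
  unfolding L2_set_def by measurable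

text \<open>The restriction to \<open>{..<p}\<close> keeps the result extensional, hence a point of
  the product space.\<close>

definition dilate :: "nat \<Rightarrow> real \<Rightarrow> (nat \<Rightarrow> real) \<Rightarrow> nat \<Rightarrow> real" where
  "dilate p c x = (\<lambda>i\<in>{..<p}. c * x i)"

lemma measurable_dilate [measurable]: "dilate p c \<in> measurable (leb p) (leb p)"
proof -
  have "(\<lambda>x. \<lambda>i\<in>{..<p}. c * x i) \<in> measurable (leb p) (\<Pi>\<^sub>M i\<in>{..<p}. borel)"
    by (rule measurable_restrict) measurable
  then show ?thesis
    using measurable_cong_sets[OF refl sets_leb] unfolding dilate_def[abs_def] by blast
qed

lemma L2_set_dilate: "c \<ge> 0 \<Longrightarrow> L2_set (dilate p c x) {..<p} = c * L2_set x {..<p}"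
  by (subst L2_set_right_distrib) (auto simp: dilate_def intro!: L2_set_cong)

text \<open>Product measures are determined on boxes, and there each of the \<open>p\<close>
  coordinates contributes one factor \<open>c\<close> by the scaling of one-dimensional Lebesgue
  measure.\<close>

lemma leb_dilate:
  assumes "c > 0"
  shows "leb p = density (distr (leb p) (leb p) (dilate p c)) (\<lambda>_. ennreal (c ^ p))"
proof -
  have "density (distr (leb p) (leb p) (dilate p c)) (\<lambda>_. ennreal (c ^ p)) = (\<Pi>\<^sub>M i\<in>{..<p}. lborel)"
  proof (rule lborel_product.PiM_eqI)
    show "sets (density (distr (leb p) (leb p) (dilate p c)) (\<lambda>_. ennreal (c ^ p))) = sets (\<Pi>\<^sub>M i\<in>{..<p}. lborel)"
      by (simp add: leb_def)
    fix A :: "nat \<Rightarrow> real set" assume A: "\<And>i. i \<in> {..<p} \<Longrightarrow> A i \<in> sets lborel"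
    have [measurable]: "Pi\<^sub>E {..<p} A \<in> sets (leb p)"
      unfolding sets_leb using A by (intro sets_PiM_I_finite) auto
    have vim: "(*) c -` A i \<in> sets borel" if "i < p" for i
      using A[of i] that measurable_sets[of "(*) c" borel borel "A i"] by auto
    have "dilate p c -` Pi\<^sub>E {..<p} A \<inter> space (leb p) = (\<Pi>\<^sub>E i\<in>{..<p}. (*) c -` A i)"
      by (auto simp: dilate_def space_leb PiE_iff)
    then have "emeasure (density (distr (leb p) (leb p) (dilate p c)) (\<lambda>_. ennreal (c ^ p))) (Pi\<^sub>E {..<p} A)
       = ennreal (c ^ p) * emeasure (leb p) (\<Pi>\<^sub>E i\<in>{..<p}. (*) c -` A i)"
      by (simp add: emeasure_density_const emeasure_distr)
    also have "\<dots> = ennreal (c ^ p) * (\<Prod>i<p. emeasure lborel ((*) c -` A i))"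
      using vim by (subst emeasure_leb_box) auto
    also have "\<dots> = (\<Prod>i<p. ennreal c * emeasure lborel ((*) c -` A i))"
      using assms by (simp add: prod.distrib ennreal_power)
    also have "\<dots> = (\<Prod>i<p. emeasure lborel (A i))"
    proof (rule prod.cong[OF refl])
      fix i assume i: "i \<in> {..<p}"
      have "emeasure lborel (A i) = emeasure (density (distr lborel borel ((*) c)) (\<lambda>_. \<bar>c\<bar>)) (A i)"
        using assms by (subst lborel_distr_mult'[of c]) auto
      also have "\<dots> = ennreal c * emeasure lborel ((*) c -` A i)"
        using A[OF i] assms by (subst emeasure_density_const) (auto simp: emeasure_distr)
      finally show "ennreal c * emeasure lborel ((*) c -` A i) = emeasure lborel (A i)" ..
    qed
    finally show "emeasure (density (distr (leb p) (leb p) (dilate p c)) (\<lambda>_. ennreal (c ^ p))) (Pi\<^sub>E {..<p} A)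
      = (\<Prod>i\<in>{..<p}. emeasure lborel (A i))" .
  qed simp
  then show ?thesis by (simp add: leb_def)
qed

lemma nn_integral_leb_dilate:
  assumes "c > 0" and [measurable]: "f \<in> borel_measurable (leb p)"
  shows "(\<integral>\<^sup>+x. f x \<partial>leb p) = ennreal (c ^ p) * (\<integral>\<^sup>+x. f (dilate p c x) \<partial>leb p)"
proof -
  have "(\<integral>\<^sup>+x. f x \<partial>leb p) = (\<integral>\<^sup>+x. f x \<partial>density (distr (leb p) (leb p) (dilate p c)) (\<lambda>_. ennreal (c ^ p)))"
    using leb_dilate[OF assms(1), of p] by simp
  also have "\<dots> = ennreal (c ^ p) * (\<integral>\<^sup>+x. f (dilate p c x) \<partial>leb p)"
    by (simp add: nn_integral_density nn_integral_cmult nn_integral_distr)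
  finally show ?thesis .
qed

section \<open>Weights constant along rays\<close>

text \<open>For the indicator of a set of directions this is the cone volume by which
  \<open>sphere_uniform\<close> is defined; for \<open>h = 1\<close> it is the volume of the unit
  ball.\<close>

definition unit_cone :: "nat \<Rightarrow> ((nat \<Rightarrow> real) \<Rightarrow> ennreal) \<Rightarrow> ennreal" where
  "unit_cone p h = (\<integral>\<^sup>+x. h x * indicator {x. L2_set x {..<p} \<le> 1} x \<partial>leb p)"

text \<open>Dilation by \<open>r\<close> carries the unit ball onto the ball of radius
  \<open>r\<close> and leaves \<open>h\<close> unchanged. For \<open>r \<le> 0\<close> the ball lies
  in the origin, a null set since \<open>p \<ge> 1\<close>; the value at \<open>r = 0\<close> then
  agrees with \<open>0 ^ p = 0\<close>.\<close>

lemma unit_cone_scale: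
  assumes p: "p \<ge> 1" and [measurable]: "h \<in> borel_measurable (leb p)"
    and hom: "\<And>c x. c > 0 \<Longrightarrow> x \<in> space (leb p) \<Longrightarrow> h (dilate p c x) = h x"
  shows "(\<integral>\<^sup>+x. h x * indicator {x. L2_set x {..<p} \<le> r} x \<partial>leb p) =
    (if r < 0 then 0 else ennreal (r ^ p) * unit_cone p h)"
proof (cases "r > 0")
  case True
  have "(\<integral>\<^sup>+x. h x * indicator {x. L2_set x {..<p} \<le> r} x \<partial>leb p)
    = ennreal (r ^ p) * (\<integral>\<^sup>+x. h (dilate p r x) * indicator {x. L2_set x {..<p} \<le> r} (dilate p r x) \<partial>leb p)"
    by (rule nn_integral_leb_dilate[OF True]) measurable
  also have "(\<integral>\<^sup>+x. h (dilate p r x) * indicator {x. L2_set x {..<p} \<le> r} (dilate p r x) \<partial>leb p) = unit_cone p h"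
    unfolding unit_cone_def using True
    by (intro nn_integral_cong) (auto simp: hom L2_set_dilate indicator_def)
  finally show ?thesis using True by simp
next
  case False
  have "emeasure (leb p) (\<Pi>\<^sub>E i\<in>{..<p}. {0}) = 0"
    by (subst emeasure_leb_box) (use p in auto)
  then have null: "(\<Pi>\<^sub>E i\<in>{..<p}. {0::real}) \<in> null_sets (leb p)"
    unfolding null_sets_def sets_leb using sets_PiM_I_finite[of "{..<p}" "\<lambda>_. {0::real}" "\<lambda>_. borel"] by simp
  have "(\<integral>\<^sup>+x. h x * indicator {x. L2_set x {..<p} \<le> r} x \<partial>leb p) = (\<integral>\<^sup>+x. 0 \<partial>leb p)"
  proof (rule nn_integral_cong_AE)
    show "AE x in leb p. h x * indicator {x. L2_set x {..<p} \<le> r} x = 0"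
    proof (rule AE_I'[OF null], rule subsetI)
      fix x assume "x \<in> {x \<in> space (leb p). h x * indicator {x. L2_set x {..<p} \<le> r} x \<noteq> 0}"
      then have x: "x \<in> space (leb p)" "h x * indicator {x. L2_set x {..<p} \<le> r} x \<noteq> 0" by auto
      then have "L2_set x {..<p} \<le> r" by (auto simp: indicator_def split: if_splits)
      then have "L2_set x {..<p} = 0" using False L2_set_nonneg[of x "{..<p}"] by linarith
      then show "x \<in> (\<Pi>\<^sub>E i\<in>{..<p}. {0})" using x by (auto simp: L2_set_eq_0_iff space_leb PiE_iff extensional_def fun_eq_iff)
    qed
  qed
  then show ?thesis using False p by (auto simp: power_0_left not_less)
qed

lemma ball_volume_finite: "unit_cone p (\<lambda>_. 1) < \<infinity>"
proof -
  have "unit_cone p (\<lambda>_. 1) \<le> (\<integral>\<^sup>+x. indicator (\<Pi>\<^sub>E i\<in>{..<p}. {-1..1}) x \<partial>leb p)"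
    unfolding unit_cone_def
  proof (rule nn_integral_mono)
    fix x assume x: "x \<in> space (leb p)"
    have "\<bar>x i\<bar> \<le> 1" if "L2_set x {..<p} \<le> 1" "i < p" for i
    proof -
      have "\<bar>x i\<bar> \<le> L2_set (\<lambda>i. \<bar>x i\<bar>) {..<p}"
        using that by (intro member_le_L2_set) auto
      also have "\<dots> = L2_set x {..<p}" by (simp add: L2_set_def)
      finally show ?thesis using that(1) by simp
    qed
    then show "1 * indicator {x. L2_set x {..<p} \<le> 1} x \<le> (indicator (\<Pi>\<^sub>E i\<in>{..<p}. {-1..1}) x :: ennreal)"
      using x by (auto simp: indicator_def space_leb PiE_iff abs_le_iff minus_le_iff)
  qed
  also have "\<dots> = emeasure (leb p) (\<Pi>\<^sub>E i\<in>{..<p}. {-1..1})"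
    by (rule nn_integral_indicator, unfold sets_leb) (auto intro!: sets_PiM_I_finite)
  also have "\<dots> = (\<Prod>i<p. ennreal 2)"
    by (subst emeasure_leb_box) auto
  also have "\<dots> < \<infinity>"
    by (simp add: ennreal_power power_less_top_ennreal)
  finally show ?thesis .
qed

text \<open>The cube \<open>{0..1}\<close> in every coordinate has volume 1 and lies in the ball of
  radius \<open>p\<close>, whose volume is a multiple of that of the unit ball.\<close>

lemma ball_volume_pos:
  assumes "p \<ge> 1"
  shows "unit_cone p (\<lambda>_. 1) > 0"
proof (rule ccontr)
  assume "\<not> unit_cone p (\<lambda>_. 1) > 0"
  then have v: "unit_cone p (\<lambda>_. 1) = 0" by simp
  have "1 = (\<Prod>i<p. ennreal 1)" by simp
  also have "\<dots> = emeasure (leb p) (\<Pi>\<^sub>E i\<in>{..<p}. {0..1})"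
    by (subst emeasure_leb_box) auto
  also have "\<dots> = (\<integral>\<^sup>+x. indicator (\<Pi>\<^sub>E i\<in>{..<p}. {0..1}) x \<partial>leb p)"
    by (rule nn_integral_indicator[symmetric], unfold sets_leb) (auto intro!: sets_PiM_I_finite)
  also have "\<dots> \<le> (\<integral>\<^sup>+x. 1 * indicator {x. L2_set x {..<p} \<le> real p} x \<partial>leb p)"
  proof (rule nn_integral_mono)
    fix x assume x: "x \<in> space (leb p)"
    have "L2_set x {..<p} \<le> real p" if "x \<in> (\<Pi>\<^sub>E i\<in>{..<p}. {0..1})"
    proof -
      have "L2_set x {..<p} \<le> (\<Sum>i<p. x i)"
        using that by (intro L2_set_le_sum) (auto simp: PiE_iff)
      also have "\<dots> \<le> (\<Sum>i<p. 1)"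
        using that by (intro sum_mono) (auto simp: PiE_iff)
      finally show ?thesis by simp
    qed
    then show "indicator (\<Pi>\<^sub>E i\<in>{..<p}. {0..1}) x \<le> (1 * indicator {x. L2_set x {..<p} \<le> real p} x :: ennreal)"
      by (auto simp: indicator_def)
  qed
  also have "\<dots> = 0"
    by (subst unit_cone_scale) (use assms v in auto)
  finally show False by simp
qed

text \<open>A weight that is constant along rays rescales to multiply Lebesgue measure on all balls by
  the same factor, so the radius is distributed alike with and without the weight.\<close>

lemma polar_decomposition:
  assumes p: "p \<ge> 1" and [measurable]: "h \<in> borel_measurable (leb p)"
    and hom: "\<And>c x. c > 0 \<Longrightarrow> x \<in> space (leb p) \<Longrightarrow> h (dilate p c x) = h x"
    and fin: "unit_cone p h < \<infinity>"
    and [measurable]: "F \<in> borel_measurable (borel :: real measure)"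
  shows "(\<integral>\<^sup>+x. h x * F (L2_set x {..<p}) \<partial>leb p) * unit_cone p (\<lambda>_. 1) =
    unit_cone p h * (\<integral>\<^sup>+x. F (L2_set x {..<p}) \<partial>leb p)"
proof -
  define v where "v = unit_cone p (\<lambda>_. 1)"
  define w where "w = unit_cone p h"
  \<comment> \<open>Each radial law is weighted with the unit mass of the other, so that the two
    measures agree without a division in \<open>ennreal\<close>.\<close>
  define m1 where "m1 = density (distr (density (leb p) h) borel (\<lambda>x. L2_set x {..<p})) (\<lambda>_. v)"
  define m2 where "m2 = density (distr (leb p) borel (\<lambda>x. L2_set x {..<p})) (\<lambda>_. w)"
  have ball: "(\<lambda>x. L2_set x {..<p}) -` {..r} \<inter> space (leb p) \<in> sets (leb p)" for r
    by measurable
  have e1: "emeasure m1 {..r} = (if r < 0 then 0 else ennreal (r ^ p) * w) * v" for r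
  proof -
    have "emeasure m1 {..r} = v * (\<integral>\<^sup>+x. h x * indicator ((\<lambda>x. L2_set x {..<p}) -` {..r} \<inter> space (leb p)) x \<partial>leb p)"
      unfolding m1_def using ball
      by (subst emeasure_density_const) (auto simp: emeasure_distr emeasure_density)
    also have "(\<integral>\<^sup>+x. h x * indicator ((\<lambda>x. L2_set x {..<p}) -` {..r} \<inter> space (leb p)) x \<partial>leb p)
      = (\<integral>\<^sup>+x. h x * indicator {x. L2_set x {..<p} \<le> r} x \<partial>leb p)"
      by (intro nn_integral_cong) (auto simp: indicator_def)
    also have "\<dots> = (if r < 0 then 0 else ennreal (r ^ p) * w)"
      unfolding w_def by (rule unit_cone_scale) (use p hom in auto)
    finally show ?thesis by (simp only: mult.commute)
  qed
  have e2: "emeasure m2 {..r} = (if r < 0 then 0 else ennreal (r ^ p) * v) * w" for r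
  proof -
    have "emeasure m2 {..r} = w * (\<integral>\<^sup>+x. indicator ((\<lambda>x. L2_set x {..<p}) -` {..r} \<inter> space (leb p)) x \<partial>leb p)"
      unfolding m2_def using ball
      by (subst emeasure_density_const) (auto simp: emeasure_distr)
    also have "(\<integral>\<^sup>+x. indicator ((\<lambda>x. L2_set x {..<p}) -` {..r} \<inter> space (leb p)) x \<partial>leb p)
      = (\<integral>\<^sup>+x. 1 * indicator {x. L2_set x {..<p} \<le> r} x \<partial>leb p)"
      by (intro nn_integral_cong) (auto simp: indicator_def)
    also have "\<dots> = (if r < 0 then 0 else ennreal (r ^ p) * v)"
      unfolding v_def by (rule unit_cone_scale) (use p in auto)
    finally show ?thesis by (simp only: mult.commute)
  qed
  have borel: "sets (borel :: real measure) = sigma_sets UNIV (range (\<lambda>a. {..a}))"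
    by (subst borel_eq_atMost) auto
  have "m1 = m2"
  \<comment> \<open>Half-lines are closed under intersection and generate the Borel sets; both unit
    masses being finite gives the exhaustion by sets of finite measure.\<close>
  proof (rule measure_eqI_generator_eq[where \<Omega>=UNIV and E="range (\<lambda>a::real. {..a})" and A="\<lambda>n. {..real n}"])
    show "Int_stable (range (\<lambda>a::real. {..a}))"
      by (auto simp: Int_stable_def)
    show "emeasure m1 X = emeasure m2 X" if "X \<in> range (\<lambda>a::real. {..a})" for X
      using that by (auto simp: e1 e2 mult_ac)
    show "sets m1 = sigma_sets UNIV (range (\<lambda>a. {..a}))" "sets m2 = sigma_sets UNIV (range (\<lambda>a. {..a}))"
      by (simp_all add: m1_def m2_def borel)
    show "(\<Union>i::nat. {..real i}) = UNIV"
      by (auto simp: real_arch_simple)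
    show "emeasure m1 {..real i} \<noteq> \<infinity>" for i
      using fin ball_volume_finite[of p] unfolding e1
      by (auto simp: ennreal_mult_eq_top_iff v_def w_def)
  qed auto
  then have "(\<integral>\<^sup>+r. F r \<partial>m1) = (\<integral>\<^sup>+r. F r \<partial>m2)" by simp
  moreover have "(\<integral>\<^sup>+r. F r \<partial>m1) = v * (\<integral>\<^sup>+x. h x * F (L2_set x {..<p}) \<partial>leb p)"
    unfolding m1_def by (simp add: nn_integral_density nn_integral_distr nn_integral_cmult)
  moreover have "(\<integral>\<^sup>+r. F r \<partial>m2) = w * (\<integral>\<^sup>+x. F (L2_set x {..<p}) \<partial>leb p)"
    unfolding m2_def by (simp add: nn_integral_density nn_integral_distr nn_integral_cmult)
  ultimately show ?thesis by (simp add: v_def w_def mult.commute)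
qed

section \<open>Independence of the Gaussian radius and direction\<close>

text \<open>The product density depends on the norm alone, so whatever holds for Lebesgue measure
  and an arbitrary radial factor carries over to the Gaussian law.\<close>

lemma gauss_density:
  "gauss p = density (leb p) (\<lambda>x. ennreal ((1 / sqrt (2 * pi)) ^ p * exp (- (L2_set x {..<p})\<^sup>2 / 2)))"
proof -
  interpret g: product_sigma_finite "\<lambda>_::nat. density lborel std_normal_density"
    by (intro product_sigma_finite.intro prob_space_imp_sigma_finite prob_space_normal_density) simp
  have dens: "(\<Prod>i<p. ennreal (std_normal_density (x i))) = ennreal ((1 / sqrt (2 * pi)) ^ p * exp (- (L2_set x {..<p})\<^sup>2 / 2))" for x
  proof -
    have "(\<Prod>i<p. ennreal (std_normal_density (x i))) = ennreal (\<Prod>i<p. std_normal_density (x i))"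
      by (rule prod_ennreal) simp
    also have "(\<Prod>i<p. std_normal_density (x i)) = (1 / sqrt (2 * pi)) ^ p * exp (\<Sum>i<p. - (x i)\<^sup>2 / 2)"
      unfolding std_normal_density_def prod.distrib by (simp add: exp_sum)
    also have "(\<Sum>i<p. - (x i)\<^sup>2 / 2) = - (L2_set x {..<p})\<^sup>2 / 2"
      by (simp add: L2_set_def sum_nonneg sum_divide_distrib sum_negf)
    finally show ?thesis .
  qed
  have "density (leb p) (\<lambda>x. \<Prod>i<p. ennreal (std_normal_density (x i))) = (\<Pi>\<^sub>M i\<in>{..<p}. density lborel std_normal_density)"
  proof (rule g.PiM_eqI)
    show "sets (density (leb p) (\<lambda>x. \<Prod>i<p. ennreal (std_normal_density (x i)))) = sets (\<Pi>\<^sub>M i\<in>{..<p}. density lborel std_normal_density)"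
      using sets_leb sets_gauss by (simp add: gauss_def)
    fix A :: "nat \<Rightarrow> real set" assume A: "\<And>i. i \<in> {..<p} \<Longrightarrow> A i \<in> sets (density lborel std_normal_density)"
    have [measurable]: "Pi\<^sub>E {..<p} A \<in> sets (leb p)"
      unfolding sets_leb using A by (intro sets_PiM_I_finite) auto
    have "emeasure (density (leb p) (\<lambda>x. \<Prod>i<p. ennreal (std_normal_density (x i)))) (Pi\<^sub>E {..<p} A)
      = (\<integral>\<^sup>+x. (\<Prod>i<p. ennreal (std_normal_density (x i))) * indicator (Pi\<^sub>E {..<p} A) x \<partial>leb p)"
      by (rule emeasure_density) measurable
    also have "\<dots> = (\<integral>\<^sup>+x. (\<Prod>i<p. ennreal (std_normal_density (x i)) * indicator (A i) (x i)) \<partial>leb p)"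
    proof (rule nn_integral_cong)
      fix x assume "x \<in> space (leb p)"
      then have "indicator (Pi\<^sub>E {..<p} A) x = (\<Prod>i<p. indicator (A i) (x i) :: ennreal)"
        by (auto simp: space_leb indicator_def PiE_iff)
      then show "(\<Prod>i<p. ennreal (std_normal_density (x i))) * indicator (Pi\<^sub>E {..<p} A) x
        = (\<Prod>i<p. ennreal (std_normal_density (x i)) * indicator (A i) (x i))"
        by (simp add: prod.distrib)
    qed
    also have "\<dots> = (\<Prod>i<p. \<integral>\<^sup>+y. ennreal (std_normal_density y) * indicator (A i) y \<partial>lborel)"
      unfolding leb_def using A by (subst lborel_product.product_nn_integral_prod) auto
    also have "\<dots> = (\<Prod>i<p. emeasure (density lborel std_normal_density) (A i))"
      using A by (intro prod.cong) (auto simp: emeasure_density)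
    finally show "emeasure (density (leb p) (\<lambda>x. \<Prod>i<p. ennreal (std_normal_density (x i)))) (Pi\<^sub>E {..<p} A)
      = (\<Prod>i\<in>{..<p}. emeasure (density lborel std_normal_density) (A i))" .
  qed simp
  then show ?thesis by (simp add: gauss_def dens)
qed

lemma measurable_gauss_iff: "f \<in> measurable (gauss p) N \<longleftrightarrow> f \<in> measurable (leb p) N"
  by (simp add: measurable_def sets_gauss sets_leb space_gauss space_leb)

lemma gauss_unit_cone:
  assumes p: "p \<ge> 1" and [measurable]: "h \<in> borel_measurable (leb p)"
    and hom: "\<And>c x. c > 0 \<Longrightarrow> x \<in> space (leb p) \<Longrightarrow> h (dilate p c x) = h x"
    and fin: "unit_cone p h < \<infinity>"
    and [measurable]: "F \<in> borel_measurable (borel :: real measure)"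
  shows "(\<integral>\<^sup>+x. h x * F (L2_set x {..<p}) \<partial>gauss p) * unit_cone p (\<lambda>_. 1) =
    unit_cone p h * (\<integral>\<^sup>+x. F (L2_set x {..<p}) \<partial>gauss p)"
proof -
  define G where "G r = ennreal ((1 / sqrt (2 * pi)) ^ p * exp (- r\<^sup>2 / 2))" for r :: real
  have [measurable]: "G \<in> borel_measurable borel" unfolding G_def[abs_def] by measurable
  have g: "gauss p = density (leb p) (\<lambda>x. G (L2_set x {..<p}))"
    unfolding gauss_density G_def ..
  show ?thesis
    \<comment> \<open>The Gaussian density is absorbed into the radial factor.\<close>
    using polar_decomposition[OF p _ hom fin, of "\<lambda>r. G r * F r"]
    by (simp add: g nn_integral_density mult_ac)
qed

text \<open>The case of constant radial factor 1, with Gaussian total mass 1: a ray-constant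
  function has the same mean under the Gaussian law as over the unit ball.\<close>

lemma gauss_integral_cone:
  assumes p: "p \<ge> 1" and "h \<in> borel_measurable (leb p)"
    and "\<And>c x. c > 0 \<Longrightarrow> x \<in> space (leb p) \<Longrightarrow> h (dilate p c x) = h x"
    and "unit_cone p h < \<infinity>"
  shows "(\<integral>\<^sup>+x. h x \<partial>gauss p) = unit_cone p h / unit_cone p (\<lambda>_. 1)"
proof -
  interpret prob_space "gauss p" by (rule prob_space_gauss)
  have "(\<integral>\<^sup>+x. h x \<partial>gauss p) * unit_cone p (\<lambda>_. 1) = unit_cone p h"
    using gauss_unit_cone[OF assms, of "\<lambda>_. 1"] by (simp add: emeasure_space_1)
  then show ?thesis
    using ball_volume_pos[OF p] ball_volume_finite[of p]
    by (metis ennreal_mult_divide_eq infinity_ennreal_def less_irrefl)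
qed

lemma gauss_radius_direction_indep:
  assumes p: "p \<ge> 1" and [measurable]: "h \<in> borel_measurable (leb p)"
    and hom: "\<And>c x. c > 0 \<Longrightarrow> x \<in> space (leb p) \<Longrightarrow> h (dilate p c x) = h x"
    and fin: "unit_cone p h < \<infinity>"
    and [measurable]: "F \<in> borel_measurable (borel :: real measure)"
  shows "(\<integral>\<^sup>+x. h x * F (L2_set x {..<p}) \<partial>gauss p) =
    (\<integral>\<^sup>+x. h x \<partial>gauss p) * (\<integral>\<^sup>+x. F (L2_set x {..<p}) \<partial>gauss p)"
proof -
  have "(\<integral>\<^sup>+x. h x * F (L2_set x {..<p}) \<partial>gauss p) =
    unit_cone p h * (\<integral>\<^sup>+x. F (L2_set x {..<p}) \<partial>gauss p) / unit_cone p (\<lambda>_. 1)"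
    using gauss_unit_cone[OF assms] ball_volume_pos[OF p] ball_volume_finite[of p]
    by (metis ennreal_mult_divide_eq infinity_ennreal_def less_irrefl)
  then show ?thesis
    using gauss_integral_cone[OF p _ hom fin] by (simp add: ennreal_divide_times ennreal_times_divide)
qed

section \<open>The uniform distribution on the sphere\<close>

text \<open>The bound \<open>C\<close> makes \<open>unit_cone p h\<close> finite. A divergent radial
  integral is harmless: \<open>enn2real\<close> sends infinity to 0, the value of the Bochner
  integral in that case.\<close>

lemma gauss_radius_direction_expectation:
  fixes h :: "(nat \<Rightarrow> real) \<Rightarrow> real" and F :: "real \<Rightarrow> real"
  assumes p: "p \<ge> 1" and meas [measurable]: "h \<in> borel_measurable (leb p)"
    and hom: "\<And>c x. c > 0 \<Longrightarrow> x \<in> space (leb p) \<Longrightarrow> h (dilate p c x) = h x"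
    and bound: "\<And>x. 0 \<le> h x" "\<And>x. h x \<le> C"
    and F [measurable]: "F \<in> borel_measurable borel" and F_nonneg: "\<And>r. 0 \<le> F r"
  shows "(\<integral>x. h x * F (L2_set x {..<p}) \<partial>gauss p) = (\<integral>x. h x \<partial>gauss p) * (\<integral>x. F (L2_set x {..<p}) \<partial>gauss p)"
proof -
  have [measurable]: "h \<in> borel_measurable (gauss p)" "(\<lambda>x. L2_set x {..<p}) \<in> borel_measurable (gauss p)"
    by (simp_all add: measurable_gauss_iff)
  have "unit_cone p h \<le> (\<integral>\<^sup>+x. ennreal C * (1 * indicator {x. L2_set x {..<p} \<le> 1} x) \<partial>leb p)"
    unfolding unit_cone_def using bound
    by (intro nn_integral_mono) (auto simp: indicator_def intro: ennreal_leI)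
  also have "\<dots> = ennreal C * unit_cone p (\<lambda>_. 1)"
    unfolding unit_cone_def by (rule nn_integral_cmult) measurable
  also have "\<dots> < \<infinity>"
    using ball_volume_finite[of p] by (simp add: ennreal_mult_less_top)
  finally have fin: "unit_cone p h < \<infinity>" .
  have "(\<integral>\<^sup>+x. ennreal (h x * F (L2_set x {..<p})) \<partial>gauss p) =
    (\<integral>\<^sup>+x. ennreal (h x) \<partial>gauss p) * (\<integral>\<^sup>+x. ennreal (F (L2_set x {..<p})) \<partial>gauss p)"
    using gauss_radius_direction_indep[OF p _ _ fin, of "\<lambda>r. ennreal (F r)"] hom bound F_nonneg
    by (simp add: ennreal_mult)
  then show ?thesis
    using bound F_nonneg by (simp add: integral_eq_nn_integral enn2real_mult)
qed

text \<open>At the origin, division by zero gives the zero function, in agreement with the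
  convention of \<open>sphere_uniform\<close>; \<open>direction_L2\<close> therefore holds there
  too.\<close>

definition direction :: "nat \<Rightarrow> (nat \<Rightarrow> real) \<Rightarrow> nat \<Rightarrow> real" where
  "direction p x i = x i / L2_set x {..<p}"

lemma direction_dilate: "c > 0 \<Longrightarrow> i < p \<Longrightarrow> direction p (dilate p c x) i = direction p x i"
  unfolding direction_def by (subst L2_set_dilate) (auto simp: dilate_def)

lemma direction_L2: "i < p \<Longrightarrow> direction p x i * L2_set x {..<p} = x i"
  unfolding direction_def by (auto simp: L2_set_eq_0_iff)

lemma abs_direction_le: "i < p \<Longrightarrow> \<bar>direction p x i\<bar> \<le> 1"
proof -
  assume i: "i < p"
  have "\<bar>x i\<bar> \<le> L2_set (\<lambda>i. \<bar>x i\<bar>) {..<p}"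
    using i by (intro member_le_L2_set) auto
  also have "\<dots> = L2_set x {..<p}" by (simp add: L2_set_def)
  finally show ?thesis by (auto simp: direction_def divide_le_eq_1)
qed

lemma measurable_direction [measurable]:
  "i < p \<Longrightarrow> (\<lambda>x. direction p x i) \<in> borel_measurable (leb p)"
  "i < p \<Longrightarrow> (\<lambda>x. direction p x i) \<in> borel_measurable (gauss p)"
  unfolding measurable_gauss_iff direction_def by measurable

lemma sum_direction_L2:
  "(\<Sum>i<p. a i * direction p x i) * L2_set x {..<p} = (\<Sum>i<p. a i * x i)"
proof -
  have "(\<Sum>i<p. a i * direction p x i) * L2_set x {..<p} = (\<Sum>i<p. a i * (direction p x i * L2_set x {..<p}))"
    by (simp add: sum_distrib_right mult.assoc)
  then show ?thesis by (simp add: direction_L2)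
qed

lemma abs_sum_direction_le: "\<bar>\<Sum>i<p. a i * direction p x i\<bar> \<le> (\<Sum>i<p. \<bar>a i\<bar>)"
proof -
  have "\<bar>\<Sum>i<p. a i * direction p x i\<bar> \<le> (\<Sum>i<p. \<bar>a i * direction p x i\<bar>)" by (rule sum_abs)
  also have "\<dots> \<le> (\<Sum>i<p. \<bar>a i\<bar>)"
    by (intro sum_mono) (use abs_direction_le in \<open>auto simp: abs_mult mult_left_le\<close>)
  finally show ?thesis .
qed

section \<open>Measurability on vectors and the sphere law as a Gaussian direction\<close>

lemma space_borel_vec: "space (borel_vec p) = carrier_vec p"
  by (simp add: borel_vec_def)

lemma measurable_borel_vecI:
  assumes "\<And>x. x \<in> space M \<Longrightarrow> f x \<in> carrier_vec p"
    and "\<And>i. i < p \<Longrightarrow> (\<lambda>x. f x $ i) \<in> borel_measurable M"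
  shows "f \<in> measurable M (borel_vec p)"
  unfolding borel_vec_def
  by (rule measurable_vimage_algebra2) (use assms in \<open>auto intro: measurable_restrict\<close>)

lemma measurable_vec_index [measurable]:
  "i < p \<Longrightarrow> (\<lambda>v. v $ i) \<in> borel_measurable (borel_vec p)"
proof -
  assume i: "i < p"
  have "(\<lambda>v. \<lambda>i\<in>{..<p}. v $ i) \<in> measurable (borel_vec p) (\<Pi>\<^sub>M i\<in>{..<p}. borel)"
    unfolding borel_vec_def by (rule measurable_vimage_algebra1) (auto simp: space_PiM)
  from measurable_compose[OF this measurable_component_singleton, of i]
  show ?thesis using i by simp
qed

lemma eucl_norm_L2_set: "v \<in> carrier_vec p \<Longrightarrow> eucl_norm v = L2_set (\<lambda>i. v $ i) {..<p}"
  by (auto simp: eucl_norm_def L2_set_def scalar_prod_def power2_eq_square atLeast0LessThan)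

lemma eucl_norm_vec: "eucl_norm (vec p x) = L2_set x {..<p}"
  by (subst eucl_norm_L2_set[of _ p]) (auto intro!: L2_set_cong)

lemma measurable_eucl_norm [measurable]: "eucl_norm \<in> borel_measurable (borel_vec p)"
proof -
  have "(\<lambda>v. L2_set (\<lambda>i. v $ i) {..<p}) \<in> borel_measurable (borel_vec p)"
    unfolding L2_set_def by measurable
  then show ?thesis
    by (rule measurable_cong[THEN iffD1, rotated]) (simp add: space_borel_vec eucl_norm_L2_set)
qed

lemma measurable_vec_leb [measurable]: "vec p \<in> measurable (leb p) (borel_vec p)"
  by (rule measurable_borel_vecI) auto

text \<open>The indicator of "the direction lies in \<open>A\<close>" is constant along rays, so its
  Gaussian mean is the ratio of the cone volume to the ball volume, and that ratio is the definition
  of the surface measure.\<close>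

lemma sphere_uniform_eq_gauss_direction:
  assumes p: "p \<ge> 1"
  shows "sphere_uniform p = distr (gauss p) (borel_vec p) (\<lambda>x. vec p (direction p x))"
proof (rule measure_eqI)
  have lv: "lborel_vec p = distr (leb p) (borel_vec p) (vec p)"
    by (simp add: lborel_vec_def leb_def)
  have m1 [measurable]: "(\<lambda>x. (1 / eucl_norm x) \<cdot>\<^sub>v x) \<in> measurable (borel_vec p) (borel_vec p)"
  proof (rule measurable_borel_vecI)
    fix i assume i: "i < p"
    then have "(\<lambda>x. 1 / eucl_norm x * x $ i) \<in> borel_measurable (borel_vec p)" by measurable
    then show "(\<lambda>x. ((1 / eucl_norm x) \<cdot>\<^sub>v x) $ i) \<in> borel_measurable (borel_vec p)"
      by (rule measurable_cong[THEN iffD1, rotated]) (use i in \<open>auto simp: space_borel_vec\<close>)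
  qed (simp add: space_borel_vec)
  have m2 [measurable]: "(\<lambda>x. vec p (direction p x)) \<in> measurable (leb p) (borel_vec p)"
    by (rule measurable_borel_vecI) auto
  have m3 [measurable]: "(\<lambda>x. vec p (direction p x)) \<in> measurable (gauss p) (borel_vec p)"
    by (simp add: measurable_gauss_iff)
  define B where "B = {x \<in> carrier_vec p. eucl_norm x \<le> 1}"
  have B [measurable]: "B \<in> sets (borel_vec p)"
  proof -
    have "B = {x \<in> space (borel_vec p). eucl_norm x \<le> 1}"
      by (simp add: B_def space_borel_vec)
    then show ?thesis by simp
  qed
  show "sets (sphere_uniform p) = sets (distr (gauss p) (borel_vec p) (\<lambda>x. vec p (direction p x)))"
    by (simp add: sphere_uniform_def)
  fix A assume "A \<in> sets (sphere_uniform p)"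
  then have A [measurable]: "A \<in> sets (borel_vec p)" by (simp add: sphere_uniform_def)
  have ind: "indicator B (vec p x) = (indicator {x. L2_set x {..<p} \<le> 1} x :: ennreal)" for x
    by (simp add: B_def indicator_def eucl_norm_vec)
  have dir: "(1 / eucl_norm (vec p x)) \<cdot>\<^sub>v vec p x = vec p (direction p x)" for x
    by (auto simp: eucl_norm_vec direction_def)
  have "emeasure (sphere_uniform p) A = (\<integral>\<^sup>+v. indicator A v \<partial>sphere_uniform p)"
    by (subst nn_integral_indicator) (auto simp: sphere_uniform_def)
  also have "\<dots> = (\<integral>\<^sup>+x. indicator A ((1 / eucl_norm x) \<cdot>\<^sub>v x) \<partial>uniform_measure (lborel_vec p) B)"
    unfolding sphere_uniform_def B_def[symmetric]
    by (rule nn_integral_distr) (auto simp: lv)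
  also have "\<dots> = (\<integral>\<^sup>+x. indicator A ((1 / eucl_norm x) \<cdot>\<^sub>v x) * indicator B x \<partial>lborel_vec p) / emeasure (lborel_vec p) B"
    by (rule nn_integral_uniform_measure) (auto simp: lv)
  also have "emeasure (lborel_vec p) B = (\<integral>\<^sup>+x. indicator B x \<partial>lborel_vec p)"
    by (subst nn_integral_indicator) (auto simp: lv)
  also have "(\<integral>\<^sup>+x. indicator B x \<partial>lborel_vec p) = unit_cone p (\<lambda>_. 1)"
    unfolding lv unit_cone_def by (subst nn_integral_distr) (auto simp: ind)
  also have "(\<integral>\<^sup>+x. indicator A ((1 / eucl_norm x) \<cdot>\<^sub>v x) * indicator B x \<partial>lborel_vec p) = unit_cone p (\<lambda>x. indicator A (vec p (direction p x)))"
    unfolding lv unit_cone_def by (subst nn_integral_distr) (auto simp: ind dir)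
  also have "unit_cone p (\<lambda>x. indicator A (vec p (direction p x))) / unit_cone p (\<lambda>_. 1) = (\<integral>\<^sup>+x. indicator A (vec p (direction p x)) \<partial>gauss p)"
  proof (rule gauss_integral_cone[OF p, symmetric])
    show "unit_cone p (\<lambda>x. indicator A (vec p (direction p x))) < \<infinity>"
    proof (rule le_less_trans[OF _ ball_volume_finite])
      show "unit_cone p (\<lambda>x. indicator A (vec p (direction p x))) \<le> unit_cone p (\<lambda>_. 1)"
        unfolding unit_cone_def by (intro nn_integral_mono) (auto simp: indicator_def)
    qed
    fix c :: real and x assume "c > 0"
    then have "vec p (direction p (dilate p c x)) = vec p (direction p x)"
      by (auto simp: direction_dilate)
    then show "indicator A (vec p (direction p (dilate p c x))) = (indicator A (vec p (direction p x)) :: ennreal)"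
      by simp
  qed measurable
  also have "\<dots> = emeasure (distr (gauss p) (borel_vec p) (\<lambda>x. vec p (direction p x))) A"
    by (subst nn_integral_distr[symmetric, of "\<lambda>x. vec p (direction p x)" "gauss p" "borel_vec p"]) auto
  finally show "emeasure (sphere_uniform p) A = emeasure (distr (gauss p) (borel_vec p) (\<lambda>x. vec p (direction p x))) A" .
qed

section \<open>Moments of the Gaussian radius\<close>

lemma gauss_radius_square: "(L2_set x {..<p})\<^sup>2 = (\<Sum>i<p. (x i)\<^sup>2)"
  by (simp add: L2_set_def sum_nonneg)

lemma
  assumes "i < p"
  shows gauss_component_even_integrable: "k \<ge> 1 \<Longrightarrow> integrable (gauss p) (\<lambda>x. x i ^ (2 * k))"
    and gauss_component_even: "k \<ge> 1 \<Longrightarrow> (\<integral>x. x i ^ (2 * k) \<partial>gauss p) = fact (2 * k) / (2 ^ k * fact k)"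
proof -
  have *: "(\<Sum>j<p. (if j = i then 1 else 0) * x j) = x i" "(\<Sum>j<p. (if j = i then 1 else 0 :: real)\<^sup>2) = 1" for x :: "nat \<Rightarrow> real"
    using assms by (simp_all add: if_distrib[of "\<lambda>y. y * _"] if_distrib[of "\<lambda>y. y\<^sup>2"] cong: if_cong)
  show "k \<ge> 1 \<Longrightarrow> integrable (gauss p) (\<lambda>x. x i ^ (2 * k))"
    using gauss_linear_form_even_integrable[of k p "\<lambda>j. if j = i then 1 else 0"] unfolding * .
  show "k \<ge> 1 \<Longrightarrow> (\<integral>x. x i ^ (2 * k) \<partial>gauss p) = fact (2 * k) / (2 ^ k * fact k)"
    using gauss_linear_form_even[of k p "\<lambda>j. if j = i then 1 else 0"] unfolding * by simp
qed

lemma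
  shows gauss_radius2_integrable: "integrable (gauss p) (\<lambda>x. L2_set x {..<p} ^ 2)"
    and gauss_radius2: "(\<integral>x. L2_set x {..<p} ^ 2 \<partial>gauss p) = real p"
proof -
  have "integrable (gauss p) (\<lambda>x. (x i)\<^sup>2)" "(\<integral>x. (x i)\<^sup>2 \<partial>gauss p) = 1" if "i < p" for i
    using gauss_component_even_integrable[OF that, of 1] gauss_component_even[OF that, of 1] by simp_all
  then show "integrable (gauss p) (\<lambda>x. L2_set x {..<p} ^ 2)" "(\<integral>x. L2_set x {..<p} ^ 2 \<partial>gauss p) = real p"
    unfolding gauss_radius_square by (auto simp: Bochner_Integration.integral_sum)
qed

lemma sum_shift_square:
  fixes a b :: "nat \<Rightarrow> real"
  shows "(\<Sum>i<p. (a i + b i)\<^sup>2) = (\<Sum>i<p. (a i)\<^sup>2) + 2 * (\<Sum>i<p. a i * b i) + (\<Sum>i<p. (b i)\<^sup>2)"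
    and "(\<Sum>i<p. (a i - b i)\<^sup>2) = (\<Sum>i<p. (a i)\<^sup>2) - 2 * (\<Sum>i<p. a i * b i) + (\<Sum>i<p. (b i)\<^sup>2)"
  by (simp_all add: power2_sum power2_diff sum.distrib sum_subtractf sum_distrib_left algebra_simps)

text \<open>Isserlis' formula for a mixed fourth moment, by polarisation: sums and differences of
  linear forms are linear forms, whose fourth moments \<open>q\<close> gives, and (x + y)^4 + (x -
  y)^4 = 2 x^4 + 12 x^2 y^2 + 2 y^4.\<close>

lemma
  fixes a b :: "nat \<Rightarrow> real"
  shows gauss_square_square_integrable:
      "integrable (gauss p) (\<lambda>x. (\<Sum>i<p. a i * x i)\<^sup>2 * (\<Sum>i<p. b i * x i)\<^sup>2)"
    and gauss_square_square:
      "(\<integral>x. (\<Sum>i<p. a i * x i)\<^sup>2 * (\<Sum>i<p. b i * x i)\<^sup>2 \<partial>gauss p) =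
        (\<Sum>i<p. (a i)\<^sup>2) * (\<Sum>i<p. (b i)\<^sup>2) + 2 * (\<Sum>i<p. a i * b i)\<^sup>2"
proof -
  have q: "integrable (gauss p) (\<lambda>x. (\<Sum>i<p. c i * x i) ^ 4)"
    "(\<integral>x. (\<Sum>i<p. c i * x i) ^ 4 \<partial>gauss p) = 3 * (\<Sum>i<p. (c i)\<^sup>2)\<^sup>2" for c
    using gauss_linear_form_even_integrable[of 2 p c] gauss_linear_form_even[of 2 p c]
    by (simp_all add: fact_numeral)
  define L where "L c x = (\<Sum>i<p. c i * x i)" for c x :: "nat \<Rightarrow> real"
  have add: "L (\<lambda>i. a i + b i) x = L a x + L b x" and diff: "L (\<lambda>i. a i - b i) x = L a x - L b x" for x
    by (simp_all add: L_def algebra_simps sum.distrib sum_subtractf)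
  note q = q[folded L_def]
  have pol: "(L a x)\<^sup>2 * (L b x)\<^sup>2 =
    (L (\<lambda>i. a i + b i) x ^ 4 + L (\<lambda>i. a i - b i) x ^ 4 - 2 * L a x ^ 4 - 2 * L b x ^ 4) / 12" for x
    unfolding add diff by (simp add: power4_eq_xxxx power2_eq_square algebra_simps)
  show "integrable (gauss p) (\<lambda>x. (\<Sum>i<p. a i * x i)\<^sup>2 * (\<Sum>i<p. b i * x i)\<^sup>2)"
    unfolding L_def[symmetric] pol using q(1) by simp
  have "(\<integral>x. (L a x)\<^sup>2 * (L b x)\<^sup>2 \<partial>gauss p) =
    (3 * (\<Sum>i<p. (a i + b i)\<^sup>2)\<^sup>2 + 3 * (\<Sum>i<p. (a i - b i)\<^sup>2)\<^sup>2 - 6 * (\<Sum>i<p. (a i)\<^sup>2)\<^sup>2 - 6 * (\<Sum>i<p. (b i)\<^sup>2)\<^sup>2) / 12"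
    unfolding pol using q by simp
  also have "\<dots> = (\<Sum>i<p. (a i)\<^sup>2) * (\<Sum>i<p. (b i)\<^sup>2) + 2 * (\<Sum>i<p. a i * b i)\<^sup>2"
    unfolding sum_shift_square by (simp add: power2_eq_square algebra_simps)
  finally show "(\<integral>x. (\<Sum>i<p. a i * x i)\<^sup>2 * (\<Sum>i<p. b i * x i)\<^sup>2 \<partial>gauss p) =
        (\<Sum>i<p. (a i)\<^sup>2) * (\<Sum>i<p. (b i)\<^sup>2) + 2 * (\<Sum>i<p. a i * b i)\<^sup>2"
    unfolding L_def .
qed

lemma gauss_radius4: "(\<integral>x. L2_set x {..<p} ^ 4 \<partial>gauss p) = real p * (real p + 2)"
proof -
  have unit: "(\<Sum>k<p. (if k = i then 1 else 0) * x k) = x i" if "i < p" for i and x :: "nat \<Rightarrow> real"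
    using that by (simp add: if_distrib[of "\<lambda>y. y * _"] cong: if_cong)
  \<comment> \<open>The mixed moment of two coordinates is 1 off the diagonal and 3 on it.\<close>
  have I: "integrable (gauss p) (\<lambda>x. (x i)\<^sup>2 * (x j)\<^sup>2)"
    "(\<integral>x. (x i)\<^sup>2 * (x j)\<^sup>2 \<partial>gauss p) = 1 + (if j = i then 2 else 0)" if "i < p" "j < p" for i j
    using gauss_square_square_integrable[of p "\<lambda>k. if k = i then 1 else 0" "\<lambda>k. if k = j then 1 else 0"]
      gauss_square_square[of p "\<lambda>k. if k = i then 1 else 0" "\<lambda>k. if k = j then 1 else 0"] that
    by (auto simp: unit if_distrib[of "\<lambda>y. y\<^sup>2"] cong: if_cong)
  have r: "L2_set x {..<p} ^ 4 = (\<Sum>i<p. \<Sum>j<p. (x i)\<^sup>2 * (x j)\<^sup>2)" for x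
  proof -
    have "L2_set x {..<p} ^ 4 = ((L2_set x {..<p})\<^sup>2)\<^sup>2" by simp
    then show ?thesis unfolding gauss_radius_square by (simp add: power2_eq_square sum_product)
  qed
  have "(\<integral>x. L2_set x {..<p} ^ 4 \<partial>gauss p) = (\<Sum>i<p. \<Sum>j<p. 1 + (if j = i then 2 else 0))"
  proof -
    have "(\<integral>x. L2_set x {..<p} ^ 4 \<partial>gauss p) = (\<Sum>i<p. \<integral>x. (\<Sum>j<p. (x i)\<^sup>2 * (x j)\<^sup>2) \<partial>gauss p)"
      unfolding r using I by (intro Bochner_Integration.integral_sum Bochner_Integration.integrable_sum) auto
    also have "\<dots> = (\<Sum>i<p. \<Sum>j<p. 1 + (if j = i then 2 else 0))"
      using I by (intro sum.cong refl) (subst Bochner_Integration.integral_sum, auto)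
    finally show ?thesis .
  qed
  also have "\<dots> = real p * (real p + 2)"
    by (simp add: sum.distrib algebra_simps)
  finally show "(\<integral>x. L2_set x {..<p} ^ 4 \<partial>gauss p) = real p * (real p + 2)" .
qed

text \<open>A lower bound is the useful direction, because the eighth moment of the radius is the
  divisor in the eighth moment of the direction.\<close>

lemma gauss_radius8_ge:
  assumes "integrable (gauss p) (\<lambda>x. L2_set x {..<p} ^ 8)"
  shows "real p ^ 4 \<le> (\<integral>x. L2_set x {..<p} ^ 8 \<partial>gauss p)"
proof -
  interpret prob_space "gauss p" by (rule prob_space_gauss)
  \<comment> \<open>The tangent of \<open>y ^ 4\<close> at \<open>c\<close>, used for \<open>y = |g|\<^sup>2\<close> and \<open>c = p\<close> in place of Jensen's inequality.\<close>
  have tangent: "4 * c ^ 3 * y - 3 * c ^ 4 \<le> y ^ 4" if "y \<ge> 0" "c \<ge> 0" for c y :: real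
  proof -
    have "y ^ 4 - (4 * c ^ 3 * y - 3 * c ^ 4) = (y - c)\<^sup>2 * ((y + c)\<^sup>2 + 2 * c\<^sup>2)"
      by (simp add: power4_eq_xxxx power3_eq_cube power2_eq_square algebra_simps)
    also have "\<dots> \<ge> 0" by (intro mult_nonneg_nonneg add_nonneg_nonneg) auto
    finally show ?thesis by simp
  qed
  have "real p ^ 4 = (\<integral>x. 4 * real p ^ 3 * L2_set x {..<p} ^ 2 - 3 * real p ^ 4 \<partial>gauss p)"
    using gauss_radius2_integrable[of p]
    by (subst Bochner_Integration.integral_diff)
       (simp_all add: gauss_radius2 prob_space power4_eq_xxxx power3_eq_cube)
  also have "\<dots> \<le> (\<integral>x. L2_set x {..<p} ^ 8 \<partial>gauss p)"
  proof (rule integral_mono)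
    show "4 * real p ^ 3 * (L2_set x {..<p})\<^sup>2 - 3 * real p ^ 4 \<le> L2_set x {..<p} ^ 8" for x
      using tangent[of "(L2_set x {..<p})\<^sup>2" "real p"] by simp
  qed (use gauss_radius2_integrable assms in auto)
  finally show ?thesis .
qed

text \<open>Two applications of Cauchy-Schwarz bound the eighth power of the norm by
  \<open>p ^ 3\<close> times the sum of the eighth powers of the coordinates, each of which is
  integrable.\<close>

lemma gauss_radius8_integrable: "integrable (gauss p) (\<lambda>x. L2_set x {..<p} ^ 8)"
proof -
  have I: "integrable (gauss p) (\<lambda>x. x i ^ 8)" if "i < p" for i
    using gauss_component_even_integrable[OF that, of 4] by simp
  have "L2_set x {..<p} ^ 8 \<le> real p ^ 3 * (\<Sum>i<p. x i ^ 8)" for x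
  proof -
    have sq: "(\<Sum>i<p. y i)\<^sup>2 \<le> real p * (\<Sum>i<p. (y i)\<^sup>2)" for y :: "nat \<Rightarrow> real"
      using sum_squared_le_sum_of_squares[of y "{..<p}"] by (simp add: mult.commute)
    have "L2_set x {..<p} ^ 8 = ((\<Sum>i<p. (x i)\<^sup>2)\<^sup>2)\<^sup>2"
      unfolding gauss_radius_square[symmetric] by simp
    also have "\<dots> \<le> (real p * (\<Sum>i<p. (x i) ^ 4))\<^sup>2"
      using sq[of "\<lambda>i. (x i)\<^sup>2"] by (intro power_mono) (auto simp: sum_nonneg)
    also have "\<dots> = (real p)\<^sup>2 * (\<Sum>i<p. (x i) ^ 4)\<^sup>2" by (simp add: power_mult_distrib)
    also have "\<dots> \<le> (real p)\<^sup>2 * (real p * (\<Sum>i<p. x i ^ 8))"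
      using sq[of "\<lambda>i. (x i) ^ 4"] by (intro mult_left_mono) auto
    finally show ?thesis by (simp add: power3_eq_cube power2_eq_square mult.assoc)
  qed
  then have "norm (L2_set x {..<p} ^ 8) \<le> norm (real p ^ 3 * (\<Sum>i<p. x i ^ 8))" for x
    by (metis abs_ge_self abs_of_nonneg L2_set_nonneg order_trans real_norm_def zero_le_power)
  moreover have "(\<lambda>x. L2_set x {..<p} ^ 8) \<in> borel_measurable (gauss p)"
    unfolding measurable_gauss_iff by measurable
  moreover have "integrable (gauss p) (\<lambda>x. real p ^ 3 * (\<Sum>i<p. x i ^ 8))"
    using I by (intro integrable_mult_right Bochner_Integration.integrable_sum) auto
  ultimately show ?thesis
    using Bochner_Integration.integrable_bound by blast
qed

section \<open>Moments of the Gaussian direction\<close>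

lemma measurable_sum_direction [measurable]:
  "(\<lambda>x. \<Sum>i<p. a i * direction p x i) \<in> borel_measurable (leb p)"
  "(\<lambda>x. \<Sum>i<p. a i * direction p x i) \<in> borel_measurable (gauss p)"
  unfolding measurable_gauss_iff by measurable

lemma sum_direction_dilate:
  "c > 0 \<Longrightarrow> (\<Sum>i<p. a i * direction p (dilate p c x) i) = (\<Sum>i<p. a i * direction p x i)"
  by (intro sum.cong) (auto simp: direction_dilate)

text \<open>Homogeneity turns the form in the direction, times a power of the radius, into the form
  in the Gaussian vector. The even exponent provides the nonnegativity that the factorisation asks
  for.\<close>

lemma direction_even_moment:
  assumes p: "p \<ge> 1"
  shows "(\<integral>x. (\<Sum>i<p. a i * x i) ^ (2 * k) \<partial>gauss p) =
    (\<integral>x. (\<Sum>i<p. a i * direction p x i) ^ (2 * k) \<partial>gauss p) * (\<integral>x. L2_set x {..<p} ^ (2 * k) \<partial>gauss p)"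
proof -
  have b: "(\<Sum>i<p. a i * direction p x i) ^ (2 * k) \<le> (\<Sum>i<p. \<bar>a i\<bar>) ^ (2 * k)" for x
    using power_mono[OF abs_sum_direction_le[of a p x], of "2 * k"] by (simp add: power_even_abs)
  have "(\<integral>x. (\<Sum>i<p. a i * direction p x i) ^ (2 * k) * L2_set x {..<p} ^ (2 * k) \<partial>gauss p) =
    (\<integral>x. (\<Sum>i<p. a i * direction p x i) ^ (2 * k) \<partial>gauss p) * (\<integral>x. L2_set x {..<p} ^ (2 * k) \<partial>gauss p)"
  proof (rule gauss_radius_direction_expectation[OF p _ _ _ b, where F="\<lambda>r. r ^ (2 * k)"])
  qed (auto simp: sum_direction_dilate zero_le_even_power)
  then show ?thesis
    by (simp add: power_mult_distrib[symmetric] sum_direction_L2)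
qed

lemma direction_second_moment:
  assumes p: "p \<ge> 1"
  shows "(\<integral>x. (\<Sum>i<p. a i * direction p x i)\<^sup>2 \<partial>gauss p) = (\<Sum>i<p. (a i)\<^sup>2) / real p"
proof -
  have "(\<Sum>i<p. (a i)\<^sup>2) = (\<integral>x. (\<Sum>i<p. a i * direction p x i) ^ (2 * 1) \<partial>gauss p) * real p"
    using direction_even_moment[OF p, of a 1] gauss_linear_form_even[of 1 p a]
    by (simp only: mult_1_right gauss_radius2) simp
  then show ?thesis using p by simp
qed

text \<open>Both forms together have degree 4, so the Gaussian moment is divided by the fourth
  moment of the radius; this is where the normalisation \<open>p * (p + 2)\<close> of theta
  originates.\<close>

lemma direction_square_square:
  assumes p: "p \<ge> 1"
  shows "(\<integral>x. (\<Sum>i<p. a i * direction p x i)\<^sup>2 * (\<Sum>i<p. b i * direction p x i)\<^sup>2 \<partial>gauss p) =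
    ((\<Sum>i<p. (a i)\<^sup>2) * (\<Sum>i<p. (b i)\<^sup>2) + 2 * (\<Sum>i<p. a i * b i)\<^sup>2) / (real p * (real p + 2))"
proof -
  have sq: "(\<Sum>i<p. c i * direction p x i)\<^sup>2 \<le> (\<Sum>i<p. \<bar>c i\<bar>)\<^sup>2" for x and c :: "nat \<Rightarrow> real"
    using power_mono[OF abs_sum_direction_le[of c p x], of 2] by simp
  have b: "(\<Sum>i<p. a i * direction p x i)\<^sup>2 * (\<Sum>i<p. b i * direction p x i)\<^sup>2 \<le> (\<Sum>i<p. \<bar>a i\<bar>)\<^sup>2 * (\<Sum>i<p. \<bar>b i\<bar>)\<^sup>2" for x
    by (intro mult_mono sq) auto
  have "(\<integral>x. ((\<Sum>i<p. a i * direction p x i)\<^sup>2 * (\<Sum>i<p. b i * direction p x i)\<^sup>2) * L2_set x {..<p} ^ 4 \<partial>gauss p) =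
    (\<integral>x. (\<Sum>i<p. a i * direction p x i)\<^sup>2 * (\<Sum>i<p. b i * direction p x i)\<^sup>2 \<partial>gauss p) * (\<integral>x. L2_set x {..<p} ^ 4 \<partial>gauss p)"
  proof (rule gauss_radius_direction_expectation[OF p _ _ _ b, where F="\<lambda>r. r ^ 4"])
  qed (auto simp: sum_direction_dilate)
  moreover have "((\<Sum>i<p. a i * direction p x i)\<^sup>2 * (\<Sum>i<p. b i * direction p x i)\<^sup>2) * L2_set x {..<p} ^ 4 =
    (\<Sum>i<p. a i * x i)\<^sup>2 * (\<Sum>i<p. b i * x i)\<^sup>2" for x
  proof -
    have "((\<Sum>i<p. a i * direction p x i)\<^sup>2 * (\<Sum>i<p. b i * direction p x i)\<^sup>2) * L2_set x {..<p} ^ 4 =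
      ((\<Sum>i<p. a i * direction p x i) * L2_set x {..<p})\<^sup>2 * ((\<Sum>i<p. b i * direction p x i) * L2_set x {..<p})\<^sup>2"
      unfolding power_mult_distrib by (simp add: power4_eq_xxxx power2_eq_square)
    then show ?thesis by (simp add: sum_direction_L2)
  qed
  ultimately have "(\<integral>x. (\<Sum>i<p. a i * direction p x i)\<^sup>2 * (\<Sum>i<p. b i * direction p x i)\<^sup>2 \<partial>gauss p) * (real p * (real p + 2)) =
      (\<Sum>i<p. (a i)\<^sup>2) * (\<Sum>i<p. (b i)\<^sup>2) + 2 * (\<Sum>i<p. a i * b i)\<^sup>2"
    by (simp only: gauss_square_square gauss_radius4)
  moreover have "real p * (real p + 2) \<noteq> 0" using p by simp
  ultimately show ?thesis by (intro eq_divide_imp)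
qed

text \<open>105 = 7!! is the eighth moment of a standard normal variable, and \<open>p ^ 4\<close>
  bounds the eighth moment of the radius from below.\<close>

lemma direction_eighth_moment:
  assumes p: "p \<ge> 1"
  shows "(\<integral>x. (\<Sum>i<p. a i * direction p x i) ^ 8 \<partial>gauss p) \<le> 105 * (\<Sum>i<p. (a i)\<^sup>2) ^ 4 / real p ^ 4"
proof -
  have "(\<integral>x. (\<Sum>i<p. a i * direction p x i) ^ 8 \<partial>gauss p) * real p ^ 4
    \<le> (\<integral>x. (\<Sum>i<p. a i * direction p x i) ^ 8 \<partial>gauss p) * (\<integral>x. L2_set x {..<p} ^ 8 \<partial>gauss p)"
    by (intro mult_left_mono gauss_radius8_ge gauss_radius8_integrable integral_nonneg) auto
  also have "\<dots> = 105 * (\<Sum>i<p. (a i)\<^sup>2) ^ 4"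
    using direction_even_moment[OF p, of a 4] gauss_linear_form_even[of 4 p a]
    by (simp add: fact_numeral)
  finally show ?thesis using p by (simp add: pos_le_divide_eq)
qed

lemma integrable_sum_direction: "integrable (gauss p) (\<lambda>x. \<Sum>i<p. a i * direction p x i)"
proof -
  interpret prob_space "gauss p" by (rule prob_space_gauss)
  show ?thesis
    by (rule integrable_const_bound[where B="\<Sum>i<p. \<bar>a i\<bar>"]) (auto simp: abs_sum_direction_le)
qed

text \<open>A linear form in the Gaussian vector has mean 0 and equals the form in the direction
  times the radius; the mean radius can be divided out once it is known to be finite and
  nonzero.\<close>

lemma direction_mean:
  assumes p: "p \<ge> 1"
  shows "(\<integral>x. (\<Sum>i<p. a i * direction p x i) \<partial>gauss p) = 0"
proof -
  interpret prob_space "gauss p" by (rule prob_space_gauss)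
  have r1: "integrable (gauss p) (\<lambda>x. L2_set x {..<p})"
  proof (rule Bochner_Integration.integrable_bound)
    show "integrable (gauss p) (\<lambda>x. 1 + L2_set x {..<p} ^ 2)"
      using gauss_radius2_integrable by simp
    show "(\<lambda>x. L2_set x {..<p}) \<in> borel_measurable (gauss p)"
      unfolding measurable_gauss_iff by measurable
    have "r \<le> 1 + r\<^sup>2" for r :: real
      using zero_le_power2[of "r - 1/2"] by (simp add: power2_eq_square algebra_simps)
    then show "AE x in gauss p. norm (L2_set x {..<p}) \<le> norm (1 + (L2_set x {..<p})\<^sup>2)"
      by (simp add: abs_of_nonneg add_nonneg_nonneg)
  qed
  \<comment> \<open>A zero mean would force the radius to vanish almost surely, against its second
    moment \<open>p \<ge> 1\<close>.\<close>
  have "(\<integral>x. L2_set x {..<p} \<partial>gauss p) \<noteq> 0"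
  proof
    assume "(\<integral>x. L2_set x {..<p} \<partial>gauss p) = 0"
    then have "AE x in gauss p. L2_set x {..<p} = 0"
      using integral_nonneg_eq_0_iff_AE[OF r1] by simp
    then have "(\<integral>x. (L2_set x {..<p})\<^sup>2 \<partial>gauss p) = (\<integral>x. 0 \<partial>gauss p)"
      by (intro integral_cong_AE) (auto simp: measurable_gauss_iff)
    then show False using p by (simp add: gauss_radius2)
  qed
  note r1_nz = this
  \<comment> \<open>Radius and direction factor only for nonnegative functions of the direction, so the positive and
    negative parts are treated separately.\<close>
  have pos: "(\<integral>x. max 0 (\<Sum>i<p. c i * x i) \<partial>gauss p) =
    (\<integral>x. max 0 (\<Sum>i<p. c i * direction p x i) \<partial>gauss p) * (\<integral>x. L2_set x {..<p} \<partial>gauss p)" for c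
  proof -
    have b: "max 0 (\<Sum>i<p. c i * direction p x i) \<le> (\<Sum>i<p. \<bar>c i\<bar>)" for x
      using abs_sum_direction_le[of c p x] by (auto simp: sum_nonneg)
    have "(\<integral>x. max 0 (\<Sum>i<p. c i * direction p x i) * (max 0 (L2_set x {..<p})) \<partial>gauss p) =
      (\<integral>x. max 0 (\<Sum>i<p. c i * direction p x i) \<partial>gauss p) * (\<integral>x. max 0 (L2_set x {..<p}) \<partial>gauss p)"
    proof (rule gauss_radius_direction_expectation[OF p _ _ _ b, where F="max 0"])
    qed (auto simp: sum_direction_dilate)
    moreover have "max 0 (\<Sum>i<p. c i * direction p x i) * L2_set x {..<p} = max 0 (\<Sum>i<p. c i * x i)" for x
      by (subst max_mult_distrib_right) (simp add: sum_direction_L2)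
    ultimately show ?thesis by (simp add: max_absorb2)
  qed
  have split: "y = max 0 y - max 0 (- y)" for y :: real by auto
  define S where "S = (\<lambda>x. \<Sum>i<p. a i * x i)"
  define D where "D = (\<lambda>x. \<Sum>i<p. a i * direction p x i)"
  have S: "integrable (gauss p) S" "integral\<^sup>L (gauss p) S = 0"
    unfolding S_def using gauss_linear_form_integrable gauss_linear_form_mean by auto
  have D: "integrable (gauss p) D" unfolding D_def by (rule integrable_sum_direction)
  have pm: "(\<integral>x. f x \<partial>gauss p) = (\<integral>x. max 0 (f x) \<partial>gauss p) - (\<integral>x. max 0 (- f x) \<partial>gauss p)"
    if "integrable (gauss p) f" for f :: "_ \<Rightarrow> real"
  proof -
    have "integrable (gauss p) (\<lambda>x. max 0 (f x))" "integrable (gauss p) (\<lambda>x. max 0 (- f x))"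
      using that by simp_all
    then show ?thesis
      using split by (subst Bochner_Integration.integral_diff[symmetric]) (auto intro!: Bochner_Integration.integral_cong)
  qed
  have "0 = (\<integral>x. max 0 (S x) \<partial>gauss p) - (\<integral>x. max 0 (- S x) \<partial>gauss p)"
    using pm[OF S(1)] S(2) by simp
  also have "\<dots> = ((\<integral>x. max 0 (D x) \<partial>gauss p) - (\<integral>x. max 0 (- D x) \<partial>gauss p)) * (\<integral>x. L2_set x {..<p} \<partial>gauss p)"
    using pos[of a] pos[of "\<lambda>i. - a i"] by (simp add: S_def D_def sum_negf left_diff_distrib)
  also have "\<dots> = (\<integral>x. D x \<partial>gauss p) * (\<integral>x. L2_set x {..<p} \<partial>gauss p)"
    using pm[OF D] by simp
  finally show ?thesis using r1_nz by (simp add: D_def)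
qed

lemma direction_cross_moment:
  assumes p: "p \<ge> 1"
  shows "(\<integral>x. (\<Sum>i<p. a i * direction p x i) * (\<Sum>i<p. b i * direction p x i) \<partial>gauss p) = (\<Sum>i<p. a i * b i) / real p"
proof -
  interpret prob_space "gauss p" by (rule prob_space_gauss)
  define L where "L c x = (\<Sum>i<p. c i * direction p x i)" for c x
  have sq: "integrable (gauss p) (\<lambda>x. (L c x)\<^sup>2)" for c
    unfolding L_def
    by (rule integrable_const_bound[where B="(\<Sum>i<p. \<bar>c i\<bar>)\<^sup>2"])
       (use power_mono[OF abs_sum_direction_le[of c p], of _ 2] in auto)
  \<comment> \<open>Polarisation reduces the mixed moment to second moments of single forms.\<close>
  have pol: "L a x * L b x = ((L (\<lambda>i. a i + b i) x)\<^sup>2 - (L (\<lambda>i. a i - b i) x)\<^sup>2) / 4" for x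
  proof -
    have "L (\<lambda>i. a i + b i) x = L a x + L b x" "L (\<lambda>i. a i - b i) x = L a x - L b x"
      by (simp_all add: L_def algebra_simps sum.distrib sum_subtractf)
    note this[THEN arg_cong[where f="\<lambda>y. y\<^sup>2"]]
    then show ?thesis by (simp only:) (simp add: power2_eq_square algebra_simps)
  qed
  have "(\<integral>x. L a x * L b x \<partial>gauss p) = ((\<Sum>i<p. (a i + b i)\<^sup>2) / real p - (\<Sum>i<p. (a i - b i)\<^sup>2) / real p) / 4"
    unfolding pol using sq direction_second_moment[OF p] by (simp add: L_def)
  also have "\<dots> = (\<Sum>i<p. a i * b i) / real p"
    unfolding sum_shift_square by (simp add: diff_divide_distrib add_divide_distrib)
  finally show ?thesis unfolding L_def .
qed

section \<open>Elliptical distributions\<close>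

lemma sum_square_le_weighted:
  fixes w y :: "'i \<Rightarrow> real"
  assumes "\<And>i. i \<in> I \<Longrightarrow> 0 \<le> w i"
  shows "(\<Sum>i\<in>I. w i * y i)\<^sup>2 \<le> (\<Sum>i\<in>I. w i) * (\<Sum>i\<in>I. w i * (y i)\<^sup>2)"
proof -
  have "(\<Sum>i\<in>I. w i * y i) = (\<Sum>i\<in>I. sqrt (w i) * (sqrt (w i) * y i))"
    using assms by (intro sum.cong) (auto simp: mult.assoc[symmetric])
  also have "(\<dots>)\<^sup>2 \<le> (\<Sum>i\<in>I. (sqrt (w i))\<^sup>2) * (\<Sum>i\<in>I. (sqrt (w i) * y i)\<^sup>2)"
    by (rule Cauchy_Schwarz_ineq_sum)
  also have "\<dots> = (\<Sum>i\<in>I. w i) * (\<Sum>i\<in>I. w i * (y i)\<^sup>2)"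
    using assms by (simp add: power_mult_distrib cong: sum.cong)
  finally show ?thesis .
qed

text \<open>Jensen's inequality for the fourth power with unnormalised weights, from two
  applications of the weighted Cauchy-Schwarz inequality.\<close>

lemma sum_power4_le_weighted:
  fixes w y :: "'i \<Rightarrow> real"
  assumes w: "\<And>i. i \<in> I \<Longrightarrow> 0 \<le> w i"
  shows "(\<Sum>i\<in>I. w i * y i) ^ 4 \<le> (\<Sum>i\<in>I. w i) ^ 3 * (\<Sum>i\<in>I. w i * y i ^ 4)"
proof -
  have "(\<Sum>i\<in>I. w i * y i) ^ 4 = ((\<Sum>i\<in>I. w i * y i)\<^sup>2)\<^sup>2" by simp
  also have "\<dots> \<le> ((\<Sum>i\<in>I. w i) * (\<Sum>i\<in>I. w i * (y i)\<^sup>2))\<^sup>2"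
    by (intro power_mono sum_square_le_weighted w) auto
  also have "\<dots> = (\<Sum>i\<in>I. w i)\<^sup>2 * (\<Sum>i\<in>I. w i * (y i)\<^sup>2)\<^sup>2" by (simp add: power_mult_distrib)
  also have "\<dots> \<le> (\<Sum>i\<in>I. w i)\<^sup>2 * ((\<Sum>i\<in>I. w i) * (\<Sum>i\<in>I. w i * ((y i)\<^sup>2)\<^sup>2))"
    by (intro mult_left_mono sum_square_le_weighted w) auto
  also have "\<dots> = (\<Sum>i\<in>I. w i) ^ 3 * (\<Sum>i\<in>I. w i * y i ^ 4)"
    by (simp add: power3_eq_cube power2_eq_square power4_eq_xxxx mult_ac)
  finally show ?thesis .
qed

section \<open>The product rule for independent set families\<close>

text \<open>Independence is given through families of events, both for the pair of xi and U and for
  blocks of observations. Smaller families stay independent, so the preimages under \<open>f\<close>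
  and \<open>g\<close> give \<open>indep_var\<close> and its product rule.\<close>

lemma (in prob_space) indep_set_expectation:
  fixes f g :: "'a \<Rightarrow> real"
  assumes ind: "indep_set P Q"
    and f: "\<And>A. A \<in> sets borel \<Longrightarrow> f -` A \<inter> space M \<in> P"
    and g: "\<And>A. A \<in> sets borel \<Longrightarrow> g -` A \<inter> space M \<in> Q"
    and int: "integrable M f" "integrable M g"
  shows "integrable M (\<lambda>\<omega>. f \<omega> * g \<omega>)"
    and "expectation (\<lambda>\<omega>. f \<omega> * g \<omega>) = expectation f * expectation g"
proof -
  have meas: "f \<in> borel_measurable M" "g \<in> borel_measurable M" using int by auto
  have "indep_set {f -` A \<inter> space M | A. A \<in> sets borel} {g -` A \<inter> space M | A. A \<in> sets borel}"
    using ind unfolding indep_set_def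
    by (elim indep_sets_mono_sets) (use f g in \<open>auto split: bool.split\<close>)
  moreover have "Int_stable {h -` A \<inter> space M | A. A \<in> sets borel}" for h :: "'a \<Rightarrow> real"
  proof (rule Int_stableI, clarify)
    fix A B :: "real set" assume "A \<in> sets borel" "B \<in> sets borel"
    then show "\<exists>C. (h -` A \<inter> space M) \<inter> (h -` B \<inter> space M) = h -` C \<inter> space M \<and> C \<in> sets borel"
      by (intro exI[of _ "A \<inter> B"]) auto
  qed
  ultimately have "indep_var borel f borel g"
    unfolding indep_var_eq using meas by (intro conjI indep_set_sigma_sets)
  then show "integrable M (\<lambda>\<omega>. f \<omega> * g \<omega>)" "expectation (\<lambda>\<omega>. f \<omega> * g \<omega>) = expectation f * expectation g"
    using int by (auto intro: indep_var_integrable indep_var_lebesgue_integral)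
qed

lemma vimage_compose_mem:
  assumes Z: "Z \<in> measurable M R" and h: "h \<in> borel_measurable R" and A: "A \<in> sets borel"
  shows "(\<lambda>\<omega>. h (Z \<omega>)) -` A \<inter> space M \<in> {Z -` B \<inter> space M | B. B \<in> sets R}"
proof -
  have "(\<lambda>\<omega>. h (Z \<omega>)) -` A \<inter> space M = Z -` (h -` A \<inter> space R) \<inter> space M"
    using measurable_space[OF Z] by blast
  then show ?thesis using measurable_sets[OF h A] by blast
qed

lemma (in prob_space) indep_rv_expectation:
  fixes f :: "'b \<Rightarrow> real" and g :: "'c \<Rightarrow> real"
  assumes ind: "indep_rv S X T Y"
    and f: "f \<in> borel_measurable S" and g: "g \<in> borel_measurable T"
    and int: "integrable M (\<lambda>\<omega>. f (X \<omega>))" "integrable M (\<lambda>\<omega>. g (Y \<omega>))"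
  shows "integrable M (\<lambda>\<omega>. f (X \<omega>) * g (Y \<omega>))"
    and "expectation (\<lambda>\<omega>. f (X \<omega>) * g (Y \<omega>)) = expectation (\<lambda>\<omega>. f (X \<omega>)) * expectation (\<lambda>\<omega>. g (Y \<omega>))"
proof -
  have X: "random_variable S X" and Y: "random_variable T Y"
    and pre: "indep_set {X -` A \<inter> space M | A. A \<in> sets S} {Y -` B \<inter> space M | B. B \<in> sets T}"
    using ind by (auto simp: indep_rv_def)
  note E = indep_set_expectation[where f="\<lambda>\<omega>. f (X \<omega>)" and g="\<lambda>\<omega>. g (Y \<omega>)",
      OF pre vimage_compose_mem[OF X f] vimage_compose_mem[OF Y g] int]
  show "integrable M (\<lambda>\<omega>. f (X \<omega>) * g (Y \<omega>))" by (rule E(1))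
  show "expectation (\<lambda>\<omega>. f (X \<omega>) * g (Y \<omega>)) = expectation (\<lambda>\<omega>. f (X \<omega>)) * expectation (\<lambda>\<omega>. g (Y \<omega>))"
    by (rule E(2))
qed

section \<open>Quadratic forms in the direction\<close>

text \<open>For \<open>a\<close> the entries of the symmetric square root of Sigma this is Sigma
  itself; \<open>gram_trace\<close> and \<open>gram_trace2\<close> are then the traces of Sigma and
  of its square.\<close>

definition gram :: "nat \<Rightarrow> (nat \<Rightarrow> nat \<Rightarrow> real) \<Rightarrow> nat \<Rightarrow> nat \<Rightarrow> real" where
  "gram p a c d = (\<Sum>j<p. a c j * a d j)"

definition gram_trace :: "nat \<Rightarrow> (nat \<Rightarrow> nat \<Rightarrow> real) \<Rightarrow> real" where
  "gram_trace p a = (\<Sum>c<p. gram p a c c)"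

definition gram_trace2 :: "nat \<Rightarrow> (nat \<Rightarrow> nat \<Rightarrow> real) \<Rightarrow> real" where
  "gram_trace2 p a = (\<Sum>c<p. \<Sum>d<p. (gram p a c d)\<^sup>2)"

lemma gram_diag: "gram p a c c = (\<Sum>j<p. (a c j)\<^sup>2)"
  by (simp add: gram_def power2_eq_square)

lemma integrable_direction_bounded:
  assumes "f \<in> borel_measurable (gauss p)" "\<And>x. \<bar>f x\<bar> \<le> C"
  shows "integrable (gauss p) (f :: _ \<Rightarrow> real)"
proof -
  interpret prob_space "gauss p" by (rule prob_space_gauss)
  show ?thesis using assms by (intro integrable_const_bound[of _ C]) auto
qed

lemma integrable_direction_power:
  "integrable (gauss p) (\<lambda>x. (\<Sum>j<p. b j * direction p x j) ^ k)"
proof (rule integrable_direction_bounded)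
  show "\<bar>(\<Sum>j<p. b j * direction p x j) ^ k\<bar> \<le> (\<Sum>j<p. \<bar>b j\<bar>) ^ k" for x
    using power_mono[OF abs_sum_direction_le[of b p x], of k] by (simp add: power_abs)
qed measurable

lemma integrable_direction_square_square:
  "integrable (gauss p) (\<lambda>x. (\<Sum>j<p. b j * direction p x j)\<^sup>2 * (\<Sum>j<p. c j * direction p x j)\<^sup>2)"
proof (rule integrable_direction_bounded)
  show "\<bar>(\<Sum>j<p. b j * direction p x j)\<^sup>2 * (\<Sum>j<p. c j * direction p x j)\<^sup>2\<bar> \<le> (\<Sum>j<p. \<bar>b j\<bar>)\<^sup>2 * (\<Sum>j<p. \<bar>c j\<bar>)\<^sup>2" for x
    using mult_mono[OF power_mono[OF abs_sum_direction_le[of b p x], of 2] power_mono[OF abs_sum_direction_le[of c p x], of 2]]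
    by (simp add: abs_mult)
qed measurable

text \<open>The factor t^2 + 2 s arises here: over all pairs of coordinates, the products of
  diagonal Gram entries add up to t^2 and the doubled squares of the mixed entries to 2 s.\<close>

lemma direction_quadratic_square:
  assumes p: "p \<ge> 1"
  shows "(\<integral>x. (\<Sum>c<p. (\<Sum>j<p. a c j * direction p x j)\<^sup>2)\<^sup>2 \<partial>gauss p) =
    ((gram_trace p a)\<^sup>2 + 2 * gram_trace2 p a) / (real p * (real p + 2))"
proof -
  have "(\<integral>x. (\<Sum>c<p. (\<Sum>j<p. a c j * direction p x j)\<^sup>2)\<^sup>2 \<partial>gauss p) =
    (\<integral>x. (\<Sum>c<p. \<Sum>d<p. (\<Sum>j<p. a c j * direction p x j)\<^sup>2 * (\<Sum>j<p. a d j * direction p x j)\<^sup>2) \<partial>gauss p)"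
    by (simp add: power2_eq_square[of "sum _ _"] sum_product del: power2_eq_square)
  also have "\<dots> = (\<Sum>c<p. \<integral>x. (\<Sum>d<p. (\<Sum>j<p. a c j * direction p x j)\<^sup>2 * (\<Sum>j<p. a d j * direction p x j)\<^sup>2) \<partial>gauss p)"
    by (intro Bochner_Integration.integral_sum Bochner_Integration.integrable_sum integrable_direction_square_square)
  also have "\<dots> = (\<Sum>c<p. \<Sum>d<p. \<integral>x. (\<Sum>j<p. a c j * direction p x j)\<^sup>2 * (\<Sum>j<p. a d j * direction p x j)\<^sup>2 \<partial>gauss p)"
    by (intro sum.cong refl Bochner_Integration.integral_sum integrable_direction_square_square)
  also have "\<dots> = (\<Sum>c<p. \<Sum>d<p. (gram p a c c * gram p a d d + 2 * (gram p a c d)\<^sup>2) / (real p * (real p + 2)))"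
    by (simp add: direction_square_square[OF p] gram_diag) (simp add: gram_def)
  also have "\<dots> = ((gram_trace p a)\<^sup>2 + 2 * gram_trace2 p a) / (real p * (real p + 2))"
    unfolding gram_trace_def gram_trace2_def power2_eq_square[of "sum _ _"] sum_product
    by (simp add: sum_divide_distrib sum.distrib sum_distrib_left add_divide_distrib)
  finally show ?thesis .
qed

text \<open>The weights \<open>w c\<close> match the size of the c-th form: the mean of its eighth
  power over \<open>w c ^ 3\<close> is at most \<open>105 * w c / p ^ 4\<close>. Summing over
  \<open>c\<close> restores one more factor of the trace, with a constant that does not grow with
  \<open>p\<close>.\<close>

lemma
  assumes p: "p \<ge> 1" and pos: "\<And>c. c < p \<Longrightarrow> gram p a c c > 0"
  shows integrable_direction_quadratic_power4:
      "integrable (gauss p) (\<lambda>x. (\<Sum>c<p. (\<Sum>j<p. a c j * direction p x j)\<^sup>2) ^ 4)"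
    and direction_quadratic_power4:
      "(\<integral>x. (\<Sum>c<p. (\<Sum>j<p. a c j * direction p x j)\<^sup>2) ^ 4 \<partial>gauss p) \<le> 105 * gram_trace p a ^ 4 / real p ^ 4"
proof -
  define L where "L c x = (\<Sum>j<p. a c j * direction p x j)" for c x
  define w where "w c = gram p a c c" for c
  have w: "w c > 0" if "c < p" for c using pos that by (simp add: w_def)
  have int: "integrable (gauss p) (\<lambda>x. L c x ^ 8)" for c
    unfolding L_def by (rule integrable_direction_power)
  have le: "(\<Sum>c<p. (L c x)\<^sup>2) ^ 4 \<le> gram_trace p a ^ 3 * (\<Sum>c<p. L c x ^ 8 / w c ^ 3)" for x
  proof -
    have "(\<Sum>c<p. (L c x)\<^sup>2) = (\<Sum>c<p. w c * ((L c x)\<^sup>2 / w c))"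
      using w by (intro sum.cong) (auto simp: less_imp_neq[symmetric])
    also have "(\<dots>) ^ 4 \<le> (\<Sum>c<p. w c) ^ 3 * (\<Sum>c<p. w c * ((L c x)\<^sup>2 / w c) ^ 4)"
      using w by (intro sum_power4_le_weighted) (auto simp: less_imp_le)
    also have "(\<Sum>c<p. w c * ((L c x)\<^sup>2 / w c) ^ 4) = (\<Sum>c<p. L c x ^ 8 / w c ^ 3)"
    proof (rule sum.cong[OF refl])
      fix c assume "c \<in> {..<p}"
      then have "w c * (L c x ^ 8 / w c ^ 4) = L c x ^ 8 / w c ^ 3"
        using w[of c] by (simp add: power4_eq_xxxx power3_eq_cube)
      then show "w c * ((L c x)\<^sup>2 / w c) ^ 4 = L c x ^ 8 / w c ^ 3"
        by (simp add: power_divide)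
    qed
    finally show ?thesis by (simp add: gram_trace_def w_def)
  qed
  have bound_int: "integrable (gauss p) (\<lambda>x. gram_trace p a ^ 3 * (\<Sum>c<p. L c x ^ 8 / w c ^ 3))"
    using int by (intro integrable_mult_right Bochner_Integration.integrable_sum) auto
  have "integrable (gauss p) (\<lambda>x. (\<Sum>c<p. (L c x)\<^sup>2) ^ 4)"
  proof (rule Bochner_Integration.integrable_bound[OF bound_int])
    show "(\<lambda>x. (\<Sum>c<p. (L c x)\<^sup>2) ^ 4) \<in> borel_measurable (gauss p)"
      unfolding L_def by measurable
    have "norm ((\<Sum>c<p. (L c x)\<^sup>2) ^ 4) \<le> norm (gram_trace p a ^ 3 * (\<Sum>c<p. L c x ^ 8 / w c ^ 3))" for x
      using le[of x] by simp
    then show "AE x in gauss p. norm ((\<Sum>c<p. (L c x)\<^sup>2) ^ 4) \<le> norm (gram_trace p a ^ 3 * (\<Sum>c<p. L c x ^ 8 / w c ^ 3))"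
      by simp
  qed
  then show goal1: "integrable (gauss p) (\<lambda>x. (\<Sum>c<p. (\<Sum>j<p. a c j * direction p x j)\<^sup>2) ^ 4)"
    by (simp add: L_def)
  have "(\<integral>x. (\<Sum>c<p. (L c x)\<^sup>2) ^ 4 \<partial>gauss p) \<le> (\<integral>x. gram_trace p a ^ 3 * (\<Sum>c<p. L c x ^ 8 / w c ^ 3) \<partial>gauss p)"
    using goal1 bound_int le by (intro integral_mono) (auto simp: L_def)
  also have "\<dots> = gram_trace p a ^ 3 * (\<Sum>c<p. (\<integral>x. L c x ^ 8 \<partial>gauss p) / w c ^ 3)"
    using int by (simp add: Bochner_Integration.integral_sum)
  also have "\<dots> \<le> gram_trace p a ^ 3 * (\<Sum>c<p. 105 * w c / real p ^ 4)"
  proof (intro mult_left_mono sum_mono)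
    show "0 \<le> gram_trace p a ^ 3"
      unfolding gram_trace_def using pos by (intro zero_le_power sum_nonneg) (auto simp: less_imp_le)
    fix c assume "c \<in> {..<p}"
    then have "w c > 0" using w by simp
    moreover have "(\<integral>x. L c x ^ 8 \<partial>gauss p) \<le> 105 * w c ^ 4 / real p ^ 4"
      using direction_eighth_moment[OF p, of "a c"] by (simp add: L_def w_def gram_diag)
    ultimately have "(\<integral>x. L c x ^ 8 \<partial>gauss p) / w c ^ 3 \<le> 105 * w c ^ 4 / real p ^ 4 / w c ^ 3"
      by (intro divide_right_mono) auto
    also have "\<dots> = 105 * w c / real p ^ 4"
      using \<open>w c > 0\<close> by (simp add: power4_eq_xxxx power3_eq_cube)
    finally show "(\<integral>x. L c x ^ 8 \<partial>gauss p) / w c ^ 3 \<le> 105 * w c / real p ^ 4" .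
  qed
  also have "\<dots> = 105 * gram_trace p a ^ 4 / real p ^ 4"
    by (simp add: sum_divide_distrib[symmetric] sum_distrib_left[symmetric] w_def gram_trace_def[symmetric] power4_eq_xxxx power3_eq_cube)
  finally show "(\<integral>x. (\<Sum>c<p. (\<Sum>j<p. a c j * direction p x j)\<^sup>2) ^ 4 \<partial>gauss p) \<le> 105 * gram_trace p a ^ 4 / real p ^ 4"
    by (simp add: L_def)
qed

section \<open>Moments of the generic centred copy\<close>

text \<open>The generic copy lives on its own space \<open>N\<close>, and the sample inherits its
  moments by equality of laws. \<open>row_pos\<close> makes the weights of the power mean
  positive.\<close>

locale elliptical = prob_space N for N :: "'b measure" +
  fixes p :: nat and \<xi> :: "'b \<Rightarrow> real" and U :: "'b \<Rightarrow> real vec" and a :: "nat \<Rightarrow> nat \<Rightarrow> real"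
  assumes p: "p \<ge> 1"
    and indep_xi_U: "indep_rv borel \<xi> (borel_vec p) U"
    and U_law: "distr N (borel_vec p) U = sphere_uniform p"
    and xi_second: "expectation (\<lambda>\<omega>. \<xi> \<omega> ^ 2) = real p"
    and xi_eighth: "integrable N (\<lambda>\<omega>. \<xi> \<omega> ^ 8)"
    and row_pos: "\<And>c. c < p \<Longrightarrow> gram p a c c > 0"
begin

definition Y :: "nat \<Rightarrow> 'b \<Rightarrow> real" where
  "Y c \<omega> = \<xi> \<omega> * (\<Sum>j<p. a c j * U \<omega> $ j)"

lemma measurable_xi [measurable]: "\<xi> \<in> borel_measurable N"
  and measurable_U [measurable]: "U \<in> measurable N (borel_vec p)"
  using indep_xi_U by (auto simp: indep_rv_def)

lemma xi_power_integrable: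
  assumes "k \<le> 8"
  shows "integrable N (\<lambda>\<omega>. \<xi> \<omega> ^ k)"
proof (rule Bochner_Integration.integrable_bound)
  show "integrable N (\<lambda>\<omega>. 1 + \<xi> \<omega> ^ 8)" using xi_eighth by simp
  have "\<bar>y\<bar> ^ k \<le> 1 + y ^ 8" for y :: real
  proof (cases "\<bar>y\<bar> \<le> 1")
    case True
    then have "\<bar>y\<bar> ^ k \<le> 1" by (simp add: power_le_one)
    moreover have "0 \<le> y ^ 8" by simp
    ultimately show ?thesis by linarith
  next
    case False
    then have "\<bar>y\<bar> ^ k \<le> \<bar>y\<bar> ^ 8" using assms by (intro power_increasing) auto
    then show ?thesis by simp
  qed
  then show "AE \<omega> in N. norm (\<xi> \<omega> ^ k) \<le> norm (1 + \<xi> \<omega> ^ 8)"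
    by (simp add: power_abs add_nonneg_nonneg)
qed measurable

lemma U_transfer:
  fixes g :: "real vec \<Rightarrow> real"
  assumes g [measurable]: "g \<in> borel_measurable (borel_vec p)"
  shows "integrable N (\<lambda>\<omega>. g (U \<omega>)) \<longleftrightarrow> integrable (gauss p) (\<lambda>x. g (vec p (direction p x)))"
    and "expectation (\<lambda>\<omega>. g (U \<omega>)) = (\<integral>x. g (vec p (direction p x)) \<partial>gauss p)"
proof -
  have m [measurable]: "(\<lambda>x. vec p (direction p x)) \<in> measurable (gauss p) (borel_vec p)"
    by (rule measurable_borel_vecI) auto
  have law: "distr N (borel_vec p) U = distr (gauss p) (borel_vec p) (\<lambda>x. vec p (direction p x))"
    using U_law sphere_uniform_eq_gauss_direction[OF p] by simp
  show "integrable N (\<lambda>\<omega>. g (U \<omega>)) \<longleftrightarrow> integrable (gauss p) (\<lambda>x. g (vec p (direction p x)))"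
    using arg_cong[OF law, of "\<lambda>M. integrable M g"] by (simp add: integrable_distr_eq)
  show "expectation (\<lambda>\<omega>. g (U \<omega>)) = (\<integral>x. g (vec p (direction p x)) \<partial>gauss p)"
    using arg_cong[OF law, of "\<lambda>M. integral\<^sup>L M g"] by (simp add: integral_distr)
qed

lemma xi_U_expectation:
  fixes g :: "real vec \<Rightarrow> real"
  assumes k: "k \<le> 8" and g [measurable]: "g \<in> borel_measurable (borel_vec p)"
    and int: "integrable (gauss p) (\<lambda>x. g (vec p (direction p x)))"
  shows "integrable N (\<lambda>\<omega>. \<xi> \<omega> ^ k * g (U \<omega>))"
    and "expectation (\<lambda>\<omega>. \<xi> \<omega> ^ k * g (U \<omega>)) =
      expectation (\<lambda>\<omega>. \<xi> \<omega> ^ k) * (\<integral>x. g (vec p (direction p x)) \<partial>gauss p)"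
  using indep_rv_expectation[OF indep_xi_U, of "\<lambda>y. y ^ k" g] xi_power_integrable[OF k] int
  by (simp_all add: U_transfer)

lemma Y_mean: "integrable N (Y c)" "expectation (Y c) = 0"
  using xi_U_expectation[of 1 "\<lambda>v. \<Sum>j<p. a c j * v $ j"] direction_mean[OF p, of "a c"]
    integrable_sum_direction[of p "a c"]
  by (simp_all add: Y_def[abs_def])

lemma Y_cross: "integrable N (\<lambda>\<omega>. Y c \<omega> * Y d \<omega>)" "expectation (\<lambda>\<omega>. Y c \<omega> * Y d \<omega>) = gram p a c d"
proof -
  have int: "integrable (gauss p) (\<lambda>x. (\<Sum>j<p. a c j * direction p x j) * (\<Sum>j<p. a d j * direction p x j))"
  proof (rule integrable_direction_bounded)
    show "\<bar>(\<Sum>j<p. a c j * direction p x j) * (\<Sum>j<p. a d j * direction p x j)\<bar> \<le> (\<Sum>j<p. \<bar>a c j\<bar>) * (\<Sum>j<p. \<bar>a d j\<bar>)" for x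
      unfolding abs_mult by (intro mult_mono abs_sum_direction_le) (auto simp: sum_nonneg)
  qed measurable
  have eq: "Y c \<omega> * Y d \<omega> = \<xi> \<omega> ^ 2 * ((\<Sum>j<p. a c j * U \<omega> $ j) * (\<Sum>j<p. a d j * U \<omega> $ j))" for \<omega>
    by (simp add: Y_def power2_eq_square)
  define g where "g v = (\<Sum>j<p. a c j * v $ j) * (\<Sum>j<p. a d j * v $ j)" for v :: "real vec"
  have g: "g \<in> borel_measurable (borel_vec p)" unfolding g_def[abs_def] by measurable
  have gdir: "g (vec p (direction p x)) = (\<Sum>j<p. a c j * direction p x j) * (\<Sum>j<p. a d j * direction p x j)" for x
    by (simp add: g_def)
  note X = xi_U_expectation[OF _ g, of 2, unfolded gdir, OF _ int]
  show "integrable N (\<lambda>\<omega>. Y c \<omega> * Y d \<omega>)"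
    unfolding eq g_def[symmetric] by (rule X(1)) simp
  \<comment> \<open>The normalisation of the second moment of xi cancels the \<open>1 / p\<close> of
    the direction, so the covariance is exactly the Gram matrix.\<close>
  have "expectation (\<lambda>\<omega>. Y c \<omega> * Y d \<omega>) = real p * (gram p a c d / real p)"
    unfolding eq g_def[symmetric] gram_def
    by (subst X(2)) (simp_all only: xi_second direction_cross_moment[OF p])
  then show "expectation (\<lambda>\<omega>. Y c \<omega> * Y d \<omega>) = gram p a c d"
    using p by simp
qed

lemma Y_norm_square: "(\<Sum>c<p. (Y c \<omega>)\<^sup>2) = \<xi> \<omega> ^ 2 * (\<Sum>c<p. (\<Sum>j<p. a c j * U \<omega> $ j)\<^sup>2)"
  unfolding Y_def power_mult_distrib by (rule sum_distrib_left[symmetric])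

text \<open>The fraction in front is theta: this is the identity tau = theta (t^2 + 2 s) on which
  the estimator rests.\<close>

lemma Y_norm_fourth:
  "expectation (\<lambda>\<omega>. (\<Sum>c<p. (Y c \<omega>)\<^sup>2)\<^sup>2) =
    expectation (\<lambda>\<omega>. \<xi> \<omega> ^ 4) / (real p * (real p + 2)) * ((gram_trace p a)\<^sup>2 + 2 * gram_trace2 p a)"
proof -
  have int: "integrable (gauss p) (\<lambda>x. (\<Sum>c<p. (\<Sum>j<p. a c j * direction p x j)\<^sup>2)\<^sup>2)"
  proof -
    have sq: "(\<Sum>c<p. (\<Sum>j<p. a c j * direction p x j)\<^sup>2)\<^sup>2 =
      (\<Sum>c<p. \<Sum>d<p. (\<Sum>j<p. a c j * direction p x j)\<^sup>2 * (\<Sum>j<p. a d j * direction p x j)\<^sup>2)" for x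
      by (subst power2_eq_square) (simp only: sum_product)
    show ?thesis
      unfolding sq by (intro Bochner_Integration.integrable_sum integrable_direction_square_square)
  qed
  have eq: "(\<Sum>c<p. (Y c \<omega>)\<^sup>2)\<^sup>2 = \<xi> \<omega> ^ 4 * (\<Sum>c<p. (\<Sum>j<p. a c j * U \<omega> $ j)\<^sup>2)\<^sup>2" for \<omega>
    unfolding Y_norm_square by (simp add: power_mult_distrib)
  show ?thesis
    unfolding eq using xi_U_expectation(2)[of 4 "\<lambda>v. (\<Sum>c<p. (\<Sum>j<p. a c j * v $ j)\<^sup>2)\<^sup>2"] int
      direction_quadratic_square[OF p, of a]
    by simp
qed

lemma Y_norm_eighth:
  "integrable N (\<lambda>\<omega>. (\<Sum>c<p. (Y c \<omega>)\<^sup>2) ^ 4)"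
  "expectation (\<lambda>\<omega>. (\<Sum>c<p. (Y c \<omega>)\<^sup>2) ^ 4) \<le> 105 * expectation (\<lambda>\<omega>. \<xi> \<omega> ^ 8) / real p ^ 4 * gram_trace p a ^ 4"
proof -
  have eq: "(\<Sum>c<p. (Y c \<omega>)\<^sup>2) ^ 4 = \<xi> \<omega> ^ 8 * (\<Sum>c<p. (\<Sum>j<p. a c j * U \<omega> $ j)\<^sup>2) ^ 4" for \<omega>
    unfolding Y_norm_square by (simp add: power_mult_distrib)
  note X = xi_U_expectation[of 8 "\<lambda>v. (\<Sum>c<p. (\<Sum>j<p. a c j * v $ j)\<^sup>2) ^ 4"]
  note I = integrable_direction_quadratic_power4[OF p row_pos]
  show "integrable N (\<lambda>\<omega>. (\<Sum>c<p. (Y c \<omega>)\<^sup>2) ^ 4)"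
    unfolding eq using X(1) I by simp
  have "expectation (\<lambda>\<omega>. (\<Sum>c<p. (Y c \<omega>)\<^sup>2) ^ 4) = expectation (\<lambda>\<omega>. \<xi> \<omega> ^ 8) *
      (\<integral>x. (\<Sum>c<p. (\<Sum>j<p. a c j * direction p x j)\<^sup>2) ^ 4 \<partial>gauss p)"
    unfolding eq using X(2) I by simp
  also have "\<dots> \<le> expectation (\<lambda>\<omega>. \<xi> \<omega> ^ 8) * (105 * gram_trace p a ^ 4 / real p ^ 4)"
    by (intro mult_left_mono direction_quadratic_power4[OF p row_pos] integral_nonneg) auto
  finally show "expectation (\<lambda>\<omega>. (\<Sum>c<p. (Y c \<omega>)\<^sup>2) ^ 4) \<le> 105 * expectation (\<lambda>\<omega>. \<xi> \<omega> ^ 8) / real p ^ 4 * gram_trace p a ^ 4"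
    by (simp add: mult_ac)
qed

end

section \<open>Sums over quadruples\<close>

text \<open>In the expanded square only pairs related by \<open>R\<close> contribute, and each is at
  most \<open>K\<close> by the arithmetic-geometric mean inequality.\<close>

lemma (in prob_space) sum_second_moment_le:
  fixes h :: "'q \<Rightarrow> 'a \<Rightarrow> real"
  assumes Q: "finite Q"
    and meas: "\<And>q. q \<in> Q \<Longrightarrow> h q \<in> borel_measurable M"
    and int: "\<And>q. q \<in> Q \<Longrightarrow> integrable M (\<lambda>\<omega>. (h q \<omega>)\<^sup>2)"
    and bound: "\<And>q. q \<in> Q \<Longrightarrow> expectation (\<lambda>\<omega>. (h q \<omega>)\<^sup>2) \<le> K"
    and uncorr: "\<And>q r. q \<in> Q \<Longrightarrow> r \<in> Q \<Longrightarrow> \<not> R q r \<Longrightarrow> expectation (\<lambda>\<omega>. h q \<omega> * h r \<omega>) = 0"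
    and overlap: "\<And>q. q \<in> Q \<Longrightarrow> real (card {r \<in> Q. R q r}) \<le> m"
    and K: "K \<ge> 0"
  shows "integrable M (\<lambda>\<omega>. (\<Sum>q\<in>Q. h q \<omega>)\<^sup>2)"
    and "expectation (\<lambda>\<omega>. (\<Sum>q\<in>Q. h q \<omega>)\<^sup>2) \<le> K * m * card Q"
proof -
  have prod_le: "\<bar>x * y\<bar> \<le> (x\<^sup>2 + y\<^sup>2) / 2" for x y :: real
    using sum_squares_bound[of "\<bar>x\<bar>" "\<bar>y\<bar>"] by (simp add: abs_mult)
  have prod_int: "integrable M (\<lambda>\<omega>. h q \<omega> * h r \<omega>)" if "q \<in> Q" "r \<in> Q" for q r
  proof (rule Bochner_Integration.integrable_bound)
    show "integrable M (\<lambda>\<omega>. ((h q \<omega>)\<^sup>2 + (h r \<omega>)\<^sup>2) / 2)" using int that by simp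
    show "AE \<omega> in M. norm (h q \<omega> * h r \<omega>) \<le> norm (((h q \<omega>)\<^sup>2 + (h r \<omega>)\<^sup>2) / 2)"
      using prod_le by simp
  qed (use meas that in measurable)
  have prod_E: "expectation (\<lambda>\<omega>. h q \<omega> * h r \<omega>) \<le> (if R q r then K else 0)" if "q \<in> Q" "r \<in> Q" for q r
  proof (cases "R q r")
    case True
    have "expectation (\<lambda>\<omega>. h q \<omega> * h r \<omega>) \<le> expectation (\<lambda>\<omega>. ((h q \<omega>)\<^sup>2 + (h r \<omega>)\<^sup>2) / 2)"
      using int that order_trans[OF abs_ge_self prod_le] by (intro integral_mono prod_int) auto
    also have "\<dots> = (expectation (\<lambda>\<omega>. (h q \<omega>)\<^sup>2) + expectation (\<lambda>\<omega>. (h r \<omega>)\<^sup>2)) / 2"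
      using int that by simp
    also have "\<dots> \<le> K" using bound[OF that(1)] bound[OF that(2)] by simp
    finally show ?thesis using True by simp
  qed (use uncorr that in simp)
  have sq: "(\<Sum>q\<in>Q. h q \<omega>)\<^sup>2 = (\<Sum>q\<in>Q. \<Sum>r\<in>Q. h q \<omega> * h r \<omega>)" for \<omega>
    by (simp add: power2_eq_square sum_product)
  show "integrable M (\<lambda>\<omega>. (\<Sum>q\<in>Q. h q \<omega>)\<^sup>2)"
    unfolding sq by (intro Bochner_Integration.integrable_sum prod_int)
  have "expectation (\<lambda>\<omega>. (\<Sum>q\<in>Q. h q \<omega>)\<^sup>2) = (\<Sum>q\<in>Q. expectation (\<lambda>\<omega>. \<Sum>r\<in>Q. h q \<omega> * h r \<omega>))"
    unfolding sq by (intro Bochner_Integration.integral_sum Bochner_Integration.integrable_sum prod_int)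
  also have "\<dots> = (\<Sum>q\<in>Q. \<Sum>r\<in>Q. expectation (\<lambda>\<omega>. h q \<omega> * h r \<omega>))"
    by (intro sum.cong refl Bochner_Integration.integral_sum prod_int)
  also have "\<dots> \<le> (\<Sum>q\<in>Q. \<Sum>r\<in>Q. if R q r then K else 0)"
    by (intro sum_mono prod_E)
  also have "\<dots> = (\<Sum>q\<in>Q. K * card {r \<in> Q. R q r})"
    using Q by (simp add: sum.If_cases Int_def mult.commute)
  also have "\<dots> \<le> (\<Sum>q\<in>Q. K * m)"
    using K overlap by (intro sum_mono mult_left_mono) auto
  finally show "expectation (\<lambda>\<omega>. (\<Sum>q\<in>Q. h q \<omega>)\<^sup>2) \<le> K * m * card Q"
    by (simp add: mult_ac)
qed

lemma (in prob_space) second_moment_tail: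
  fixes S :: "'a \<Rightarrow> real"
  assumes [measurable]: "S \<in> borel_measurable M" and int: "integrable M (\<lambda>\<omega>. (S \<omega>)\<^sup>2)" and "\<delta> > 0"
  shows "prob {\<omega> \<in> space M. \<delta> \<le> \<bar>S \<omega>\<bar>} \<le> expectation (\<lambda>\<omega>. (S \<omega>)\<^sup>2) / \<delta>\<^sup>2"
proof -
  have "{\<omega> \<in> space M. \<delta> \<le> \<bar>S \<omega>\<bar>} = {\<omega> \<in> space M. \<delta>\<^sup>2 \<le> (S \<omega>)\<^sup>2}"
    using assms(3) by (auto simp: abs_le_square_iff[symmetric])
  then show ?thesis
    using integral_Markov_inequality_measure[OF int sets.empty_sets, where c="\<delta>\<^sup>2"] assms(3) by simp
qed

fun indices :: "nat \<times> nat \<times> nat \<times> nat \<Rightarrow> nat set" where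
  "indices (i, j, k, l) = {i, j, k, l}"

lemma finite_quadruples: "finite (quadruples n)"
  by (rule finite_subset[of _ "{1..n} \<times> {1..n} \<times> {1..n} \<times> {1..n}"]) (auto simp: quadruples_def)

text \<open>A shared index has at most 4 values and 4 positions, and the other three entries are
  free: 16 = 4 * 4.\<close>

lemma card_overlapping_quadruples:
  assumes "q \<in> quadruples n"
  shows "real (card {r \<in> quadruples n. indices q \<inter> indices r \<noteq> {}}) \<le> 16 * real n ^ 3"
proof -
  let ?I = "{1..n}"
  define B where "B x = {x} \<times> ?I \<times> ?I \<times> ?I \<union> (?I \<times> {x} \<times> ?I \<times> ?I \<union> (?I \<times> ?I \<times> {x} \<times> ?I \<union> ?I \<times> ?I \<times> ?I \<times> {x}))" for x
  have fin: "finite (B x)" for x by (simp add: B_def)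
  have cardB: "card (B x) \<le> 4 * n ^ 3" for x
  proof -
    have "card (B x) \<le> n ^ 3 + (n ^ 3 + (n ^ 3 + n ^ 3))"
      unfolding B_def
      by (intro order_trans[OF card_Un_le] add_mono) (simp_all add: card_cartesian_product power3_eq_cube)
    then show ?thesis by simp
  qed
  have "{r \<in> quadruples n. indices q \<inter> indices r \<noteq> {}} \<subseteq> (\<Union>x\<in>indices q. B x)"
    by (auto simp: quadruples_def B_def)
  moreover have ind: "finite (indices q)" "card (indices q) \<le> 4"
    using assms by (cases q, auto simp: quadruples_def card_insert_if)+
  ultimately have "card {r \<in> quadruples n. indices q \<inter> indices r \<noteq> {}} \<le> card (\<Union>x\<in>indices q. B x)"
    using fin by (intro card_mono) auto
  also have "\<dots> \<le> (\<Sum>x\<in>indices q. card (B x))" by (rule card_UN_le[OF ind(1)])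
  also have "\<dots> \<le> (\<Sum>x\<in>indices q. 4 * n ^ 3)" by (intro sum_mono cardB)
  also have "\<dots> \<le> 4 * (4 * n ^ 3)" using ind(2) by simp
  finally have "card {r \<in> quadruples n. indices q \<inter> indices r \<noteq> {}} \<le> 16 * n ^ 3" by simp
  then have "real (card {r \<in> quadruples n. indices q \<inter> indices r \<noteq> {}}) \<le> real (16 * n ^ 3)"
    by (rule of_nat_mono)
  then show ?thesis by simp
qed

lemma card_quadruples:
  assumes "n \<ge> 4"
  shows "real (card (quadruples n)) = real n * (real n - 1) * (real n - 2) * (real n - 3)"
proof -
  have "bij_betw (\<lambda>(i, j, k, l). [i, j, k, l]) (quadruples n)
      {xs. length xs = 4 \<and> distinct xs \<and> set xs \<subseteq> {1..n}}"
  proof (rule bij_betwI[where g="\<lambda>xs. (xs ! 0, xs ! 1, xs ! 2, xs ! 3)"])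
    show "(\<lambda>xs. (xs ! 0, xs ! 1, xs ! 2, xs ! 3)) \<in> {xs. length xs = 4 \<and> distinct xs \<and> set xs \<subseteq> {1..n}} \<rightarrow> quadruples n"
      by (auto simp: quadruples_def length_Suc_conv eval_nat_numeral)
  qed (auto simp: quadruples_def length_Suc_conv eval_nat_numeral)
  then have "card (quadruples n) = card {xs. length xs = 4 \<and> distinct xs \<and> set xs \<subseteq> {1..n}}"
    by (rule bij_betw_same_card)
  also have "\<dots> = \<Prod>{n - 4 + 1..n}"
    using card_lists_distinct_length_eq[of "{1..n}" 4] assms by simp
  finally have c: "card (quadruples n) = \<Prod>{n - 4 + 1..n}" .
  \<comment> \<open>The shift by 4 removes the truncated subtraction from the interval.\<close>
  obtain m where m: "n = m + 4" using assms by (metis add.commute le_Suc_ex)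
  have "{n - 4 + 1..n} = {m + 1, m + 2, m + 3, m + 4}"
    using m by auto
  then have "\<Prod>{n - 4 + 1..n} = (m + 1) * ((m + 2) * ((m + 3) * (m + 4)))"
    by simp
  then show ?thesis
    unfolding c by (simp add: m algebra_simps)
qed

section \<open>The kernels of the estimator\<close>

lemma sum_power4_le:
  fixes x y :: real
  shows "(x + y) ^ 4 \<le> 8 * (x ^ 4 + y ^ 4)"
proof -
  have sq: "(u + v)\<^sup>2 \<le> 2 * (u\<^sup>2 + v\<^sup>2)" for u v :: real
    using zero_le_power2[of "u - v"] by (simp add: power2_eq_square algebra_simps)
  have "(x + y) ^ 4 = ((x + y)\<^sup>2)\<^sup>2" by simp
  also have "\<dots> \<le> (2 * (x\<^sup>2 + y\<^sup>2))\<^sup>2" by (intro power_mono sq) simp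
  also have "\<dots> = 4 * (x\<^sup>2 + y\<^sup>2)\<^sup>2" unfolding power_mult_distrib by simp
  also have "\<dots> \<le> 4 * (2 * ((x\<^sup>2)\<^sup>2 + (y\<^sup>2)\<^sup>2))" by (intro mult_left_mono sq) simp
  finally show ?thesis by simp
qed

text \<open>\<open>blk A\<close> stands for the sub-sigma-algebra generated by the observations with index in \<open>A\<close>.\<close>

locale centred_sample = prob_space M for M :: "'a measure" +
  fixes n p :: nat and Z :: "nat \<Rightarrow> nat \<Rightarrow> 'a \<Rightarrow> real" and blk :: "nat set \<Rightarrow> 'a measure"
    and G :: "nat \<Rightarrow> nat \<Rightarrow> real" and \<tau> K :: real
  assumes blk_measurable: "\<And>A f. f \<in> borel_measurable (blk A) \<Longrightarrow> A \<subseteq> {1..n} \<Longrightarrow> (f :: 'a \<Rightarrow> real) \<in> borel_measurable M"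
    and Z_measurable: "\<And>A i c. i \<in> A \<Longrightarrow> A \<subseteq> {1..n} \<Longrightarrow> c < p \<Longrightarrow> Z i c \<in> borel_measurable (blk A)"
    and blk_indep: "\<And>A B f g. A \<subseteq> {1..n} \<Longrightarrow> B \<subseteq> {1..n} \<Longrightarrow> A \<inter> B = {} \<Longrightarrow>
      f \<in> borel_measurable (blk A) \<Longrightarrow> g \<in> borel_measurable (blk B) \<Longrightarrow> integrable M f \<Longrightarrow> integrable M g \<Longrightarrow>
      integrable M (\<lambda>\<omega>. f \<omega> * g \<omega> :: real) \<and> expectation (\<lambda>\<omega>. f \<omega> * g \<omega>) = expectation f * expectation g"
    and Z_int: "\<And>i c. i \<in> {1..n} \<Longrightarrow> c < p \<Longrightarrow> integrable M (Z i c)"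
    and Z_mean: "\<And>i c. i \<in> {1..n} \<Longrightarrow> c < p \<Longrightarrow> expectation (Z i c) = 0"
    and ZZ_int: "\<And>i c d. i \<in> {1..n} \<Longrightarrow> c < p \<Longrightarrow> d < p \<Longrightarrow> integrable M (\<lambda>\<omega>. Z i c \<omega> * Z i d \<omega>)"
    and ZZ_mean: "\<And>i c d. i \<in> {1..n} \<Longrightarrow> c < p \<Longrightarrow> d < p \<Longrightarrow> expectation (\<lambda>\<omega>. Z i c \<omega> * Z i d \<omega>) = G c d"
    and fourth: "\<And>i. i \<in> {1..n} \<Longrightarrow> expectation (\<lambda>\<omega>. (\<Sum>c<p. (Z i c \<omega>)\<^sup>2)\<^sup>2) = \<tau>"
    and eighth_int: "\<And>i. i \<in> {1..n} \<Longrightarrow> integrable M (\<lambda>\<omega>. (\<Sum>c<p. (Z i c \<omega>)\<^sup>2) ^ 4)"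
    and eighth: "\<And>i. i \<in> {1..n} \<Longrightarrow> expectation (\<lambda>\<omega>. (\<Sum>c<p. (Z i c \<omega>)\<^sup>2) ^ 4) \<le> K"
begin

section \<open>Moments of squared distances and inner products\<close>

definition t where "t = (\<Sum>c<p. G c c)"
definition s where "s = (\<Sum>c<p. \<Sum>d<p. (G c d)\<^sup>2)"

definition R :: "nat \<Rightarrow> 'a \<Rightarrow> real" where
  "R i \<omega> = (\<Sum>c<p. (Z i c \<omega>)\<^sup>2)"

text \<open>The mean vector cancels in differences, so \<open>D\<close> and \<open>P\<close> are the
  squared distances and inner products of the observations themselves.\<close>

definition D :: "nat \<Rightarrow> nat \<Rightarrow> 'a \<Rightarrow> real" where
  "D i j \<omega> = (\<Sum>c<p. (Z i c \<omega> - Z j c \<omega>)\<^sup>2)"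

definition P :: "nat \<Rightarrow> nat \<Rightarrow> nat \<Rightarrow> nat \<Rightarrow> 'a \<Rightarrow> real" where
  "P i j k l \<omega> = (\<Sum>c<p. (Z i c \<omega> - Z j c \<omega>) * (Z k c \<omega> - Z l c \<omega>))"

lemma R_nonneg: "0 \<le> R i \<omega>" and D_nonneg: "0 \<le> D i j \<omega>"
  by (simp_all add: R_def D_def sum_nonneg)

lemma R_measurable: "i \<in> A \<Longrightarrow> A \<subseteq> {1..n} \<Longrightarrow> R i \<in> borel_measurable (blk A)"
  unfolding R_def[abs_def] using Z_measurable by (intro borel_measurable_sum borel_measurable_power) auto

lemma D_measurable: "{i, j} \<subseteq> A \<Longrightarrow> A \<subseteq> {1..n} \<Longrightarrow> D i j \<in> borel_measurable (blk A)"
  unfolding D_def[abs_def] using Z_measurable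
  by (intro borel_measurable_sum borel_measurable_power borel_measurable_diff) auto

lemma P_measurable: "{i, j, k, l} \<subseteq> A \<Longrightarrow> A \<subseteq> {1..n} \<Longrightarrow> P i j k l \<in> borel_measurable (blk A)"
  unfolding P_def[abs_def] using Z_measurable
  by (intro borel_measurable_sum borel_measurable_times borel_measurable_diff) auto

lemma R_moment1:
  assumes i: "i \<in> {1..n}"
  shows "integrable M (R i)" "expectation (R i) = t"
proof -
  have eq: "R i = (\<lambda>\<omega>. \<Sum>c<p. Z i c \<omega> * Z i c \<omega>)"
    by (simp add: R_def[abs_def] power2_eq_square)
  show "integrable M (R i)"
    unfolding eq using ZZ_int[OF i] by (intro Bochner_Integration.integrable_sum) auto
  show "expectation (R i) = t"
    unfolding eq t_def using ZZ_int[OF i] ZZ_mean[OF i] by (subst Bochner_Integration.integral_sum) auto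
qed

lemma R_square_integrable:
  assumes i: "i \<in> {1..n}"
  shows "integrable M (\<lambda>\<omega>. (R i \<omega>)\<^sup>2)"
proof (rule Bochner_Integration.integrable_bound)
  show "integrable M (\<lambda>\<omega>. 1 + R i \<omega> ^ 4)" using eighth_int[OF i] by (simp add: R_def)
  show "(\<lambda>\<omega>. (R i \<omega>)\<^sup>2) \<in> borel_measurable M"
    using R_moment1(1)[OF i] by auto
  have "y\<^sup>2 \<le> 1 + y ^ 4" for y :: real
    using zero_le_power2[of "y\<^sup>2 - 1/2"] by (simp add: power2_diff power_divide)
  then show "AE \<omega> in M. norm ((R i \<omega>)\<^sup>2) \<le> norm (1 + R i \<omega> ^ 4)" by simp
qed

text \<open>This third-order product is dominated by moments already available, because a coordinate
  is at most 1 plus its square and hence at most \<open>1 + R i \<omega>\<close>.\<close>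

lemma RZ_integrable:
  assumes i: "i \<in> {1..n}" and c: "c < p"
  shows "integrable M (\<lambda>\<omega>. R i \<omega> * Z i c \<omega>)"
proof (rule Bochner_Integration.integrable_bound)
  show "integrable M (\<lambda>\<omega>. R i \<omega> + (R i \<omega>)\<^sup>2)"
    using R_moment1(1)[OF i] R_square_integrable[OF i] by simp
  show "(\<lambda>\<omega>. R i \<omega> * Z i c \<omega>) \<in> borel_measurable M"
    using R_moment1(1)[OF i] Z_int[OF i c] by auto
  have Z: "\<bar>Z i c \<omega>\<bar> \<le> 1 + R i \<omega>" for \<omega>
  proof -
    have "\<bar>y\<bar> \<le> 1 + y\<^sup>2" for y :: real
      using zero_le_power2[of "\<bar>y\<bar> - 1/2"] by (simp add: power2_diff power_divide)
    moreover have "(Z i c \<omega>)\<^sup>2 \<le> R i \<omega>"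
      unfolding R_def using c by (intro member_le_sum) auto
    ultimately show ?thesis by (meson add_left_mono order_trans)
  qed
  have "norm (R i \<omega> * Z i c \<omega>) \<le> norm (R i \<omega> + (R i \<omega>)\<^sup>2)" for \<omega>
    using mult_left_mono[OF Z R_nonneg[of i \<omega>]] R_nonneg[of i \<omega>]
    by (simp add: abs_mult algebra_simps power2_eq_square)
  then show "AE \<omega> in M. norm (R i \<omega> * Z i c \<omega>) \<le> norm (R i \<omega> + (R i \<omega>)\<^sup>2)" by simp
qed

lemma pair_indep:
  assumes "i \<in> {1..n}" "j \<in> {1..n}" "i \<noteq> j"
    and "f \<in> borel_measurable (blk {i})" "g \<in> borel_measurable (blk {j})" "integrable M f" "integrable M g"
  shows "integrable M (\<lambda>\<omega>. f \<omega> * g \<omega> :: real)" "expectation (\<lambda>\<omega>. f \<omega> * g \<omega>) = expectation f * expectation g"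
  using blk_indep[of "{i}" "{j}" f g] assms by auto

lemma Z_cross:
  assumes "i \<in> {1..n}" "j \<in> {1..n}" "i \<noteq> j" "c < p" "d < p"
  shows "integrable M (\<lambda>\<omega>. Z i c \<omega> * Z j d \<omega>)" "expectation (\<lambda>\<omega>. Z i c \<omega> * Z j d \<omega>) = 0"
  using pair_indep[OF assms(1-3), of "Z i c" "Z j d"] assms Z_int Z_mean Z_measurable by auto

lemma diff_cross:
  assumes ij: "i \<in> {1..n}" "j \<in> {1..n}" "i \<noteq> j" and cd: "c < p" "d < p"
  shows "integrable M (\<lambda>\<omega>. (Z i c \<omega> - Z j c \<omega>) * (Z i d \<omega> - Z j d \<omega>))"
    and "expectation (\<lambda>\<omega>. (Z i c \<omega> - Z j c \<omega>) * (Z i d \<omega> - Z j d \<omega>)) = 2 * G c d"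
proof -
  have eq: "(Z i c \<omega> - Z j c \<omega>) * (Z i d \<omega> - Z j d \<omega>) =
    (Z i c \<omega> * Z i d \<omega> + Z j c \<omega> * Z j d \<omega>) - (Z i c \<omega> * Z j d \<omega> + Z j c \<omega> * Z i d \<omega>)" for \<omega>
    by (simp add: algebra_simps)
  note I = ZZ_int[OF ij(1) cd] ZZ_int[OF ij(2) cd] Z_cross[OF ij cd] Z_cross[OF ij(2,1) ij(3)[symmetric] cd]
  show "integrable M (\<lambda>\<omega>. (Z i c \<omega> - Z j c \<omega>) * (Z i d \<omega> - Z j d \<omega>))"
    unfolding eq using I by simp
  show "expectation (\<lambda>\<omega>. (Z i c \<omega> - Z j c \<omega>) * (Z i d \<omega> - Z j d \<omega>)) = 2 * G c d"
    unfolding eq using I ZZ_mean[OF ij(1) cd] ZZ_mean[OF ij(2) cd] by simp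
qed

lemma D_moment1:
  assumes ij: "i \<in> {1..n}" "j \<in> {1..n}" "i \<noteq> j"
  shows "integrable M (D i j)" "expectation (D i j) = 2 * t"
proof -
  have eq: "D i j = (\<lambda>\<omega>. \<Sum>c<p. (Z i c \<omega> - Z j c \<omega>) * (Z i c \<omega> - Z j c \<omega>))"
    by (simp add: D_def[abs_def] power2_eq_square)
  show "integrable M (D i j)"
    unfolding eq using diff_cross[OF ij] by (intro Bochner_Integration.integrable_sum) auto
  show "expectation (D i j) = 2 * t"
    unfolding eq t_def using diff_cross[OF ij]
    by (subst Bochner_Integration.integral_sum) (auto simp: sum_distrib_left)
qed

lemma inner_square:
  assumes ij: "i \<in> {1..n}" "j \<in> {1..n}" "i \<noteq> j"
  shows "integrable M (\<lambda>\<omega>. (\<Sum>c<p. Z i c \<omega> * Z j c \<omega>)\<^sup>2)"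
    and "expectation (\<lambda>\<omega>. (\<Sum>c<p. Z i c \<omega> * Z j c \<omega>)\<^sup>2) = s"
proof -
  \<comment> \<open>The terms are regrouped by observation, so that each factor depends on one index
    only and independence applies.\<close>
  have eq: "(\<Sum>c<p. Z i c \<omega> * Z j c \<omega>)\<^sup>2 = (\<Sum>c<p. \<Sum>d<p. (Z i c \<omega> * Z i d \<omega>) * (Z j c \<omega> * Z j d \<omega>))" for \<omega>
    unfolding power2_eq_square sum_product by (intro sum.cong refl) (simp add: mult_ac)
  have I: "integrable M (\<lambda>\<omega>. (Z i c \<omega> * Z i d \<omega>) * (Z j c \<omega> * Z j d \<omega>))"
    "expectation (\<lambda>\<omega>. (Z i c \<omega> * Z i d \<omega>) * (Z j c \<omega> * Z j d \<omega>)) = (G c d)\<^sup>2" if "c < p" "d < p" for c d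
  proof -
    have "(\<lambda>\<omega>. Z i c \<omega> * Z i d \<omega>) \<in> borel_measurable (blk {i})" "(\<lambda>\<omega>. Z j c \<omega> * Z j d \<omega>) \<in> borel_measurable (blk {j})"
      using ij that by (auto intro!: borel_measurable_times Z_measurable)
    note pair_indep[OF ij this ZZ_int[OF ij(1) that] ZZ_int[OF ij(2) that]]
    then show "integrable M (\<lambda>\<omega>. (Z i c \<omega> * Z i d \<omega>) * (Z j c \<omega> * Z j d \<omega>))"
      "expectation (\<lambda>\<omega>. (Z i c \<omega> * Z i d \<omega>) * (Z j c \<omega> * Z j d \<omega>)) = (G c d)\<^sup>2"
      using ZZ_mean[OF ij(1) that] ZZ_mean[OF ij(2) that] by (simp_all add: power2_eq_square)
  qed
  show "integrable M (\<lambda>\<omega>. (\<Sum>c<p. Z i c \<omega> * Z j c \<omega>)\<^sup>2)"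
    unfolding eq using I by (intro Bochner_Integration.integrable_sum) auto
  have "expectation (\<lambda>\<omega>. (\<Sum>c<p. Z i c \<omega> * Z j c \<omega>)\<^sup>2) =
    (\<Sum>c<p. expectation (\<lambda>\<omega>. \<Sum>d<p. (Z i c \<omega> * Z i d \<omega>) * (Z j c \<omega> * Z j d \<omega>)))"
    unfolding eq using I by (intro Bochner_Integration.integral_sum Bochner_Integration.integrable_sum) auto
  also have "\<dots> = (\<Sum>c<p. \<Sum>d<p. expectation (\<lambda>\<omega>. (Z i c \<omega> * Z i d \<omega>) * (Z j c \<omega> * Z j d \<omega>)))"
    using I by (intro sum.cong refl Bochner_Integration.integral_sum) auto
  finally show "expectation (\<lambda>\<omega>. (\<Sum>c<p. Z i c \<omega> * Z j c \<omega>)\<^sup>2) = s"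
    using I by (simp add: s_def)
qed

text \<open>The product is linear in observation \<open>j\<close>, whose mean is zero.\<close>

lemma R_inner:
  assumes ij: "i \<in> {1..n}" "j \<in> {1..n}" "i \<noteq> j"
  shows "integrable M (\<lambda>\<omega>. R i \<omega> * (\<Sum>c<p. Z i c \<omega> * Z j c \<omega>))"
    and "expectation (\<lambda>\<omega>. R i \<omega> * (\<Sum>c<p. Z i c \<omega> * Z j c \<omega>)) = 0"
proof -
  have eq: "R i \<omega> * (\<Sum>c<p. Z i c \<omega> * Z j c \<omega>) = (\<Sum>c<p. (R i \<omega> * Z i c \<omega>) * Z j c \<omega>)" for \<omega>
    by (simp add: sum_distrib_left mult.assoc)
  have I: "integrable M (\<lambda>\<omega>. (R i \<omega> * Z i c \<omega>) * Z j c \<omega>)"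
    "expectation (\<lambda>\<omega>. (R i \<omega> * Z i c \<omega>) * Z j c \<omega>) = 0" if "c < p" for c
  proof -
    have "(\<lambda>\<omega>. R i \<omega> * Z i c \<omega>) \<in> borel_measurable (blk {i})" "Z j c \<in> borel_measurable (blk {j})"
      using ij that by (auto intro!: borel_measurable_times Z_measurable R_measurable)
    note pair_indep[OF ij this RZ_integrable[OF ij(1) that] Z_int[OF ij(2) that]]
    then show "integrable M (\<lambda>\<omega>. (R i \<omega> * Z i c \<omega>) * Z j c \<omega>)"
      "expectation (\<lambda>\<omega>. (R i \<omega> * Z i c \<omega>) * Z j c \<omega>) = 0"
      using Z_mean[OF ij(2) that] by simp_all
  qed
  show "integrable M (\<lambda>\<omega>. R i \<omega> * (\<Sum>c<p. Z i c \<omega> * Z j c \<omega>))"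
    unfolding eq using I by (intro Bochner_Integration.integrable_sum) auto
  show "expectation (\<lambda>\<omega>. R i \<omega> * (\<Sum>c<p. Z i c \<omega> * Z j c \<omega>)) = 0"
    unfolding eq using I by (simp add: Bochner_Integration.integral_sum)
qed

text \<open>In the expanded square the two squared norms give tau each, their product gives 2 t^2,
  the squared inner product gives 4 s, and the terms of odd degree in one observation vanish by
  \<open>R_inner\<close>.\<close>

lemma D_square:
  assumes ij: "i \<in> {1..n}" "j \<in> {1..n}" "i \<noteq> j"
  shows "integrable M (\<lambda>\<omega>. (D i j \<omega>)\<^sup>2)" "expectation (\<lambda>\<omega>. (D i j \<omega>)\<^sup>2) = 2 * \<tau> + 2 * t\<^sup>2 + 4 * s"
proof -
  define I where "I \<omega> = (\<Sum>c<p. Z i c \<omega> * Z j c \<omega>)" for \<omega>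
  have Dexp: "D i j \<omega> = R i \<omega> + R j \<omega> - 2 * I \<omega>" for \<omega>
    by (simp add: D_def R_def I_def power2_diff sum.distrib sum_subtractf sum_distrib_left mult_ac)
  have eq: "(D i j \<omega>)\<^sup>2 = (R i \<omega>)\<^sup>2 + (R j \<omega>)\<^sup>2 + 2 * (R i \<omega> * R j \<omega>) + 4 * (I \<omega>)\<^sup>2
     - 4 * (R i \<omega> * I \<omega>) - 4 * (R j \<omega> * I \<omega>)" for \<omega>
    unfolding Dexp by (simp add: power2_eq_square algebra_simps)
  have a: "integrable M (\<lambda>\<omega>. (R i \<omega>)\<^sup>2)" "integrable M (\<lambda>\<omega>. (R j \<omega>)\<^sup>2)"
    "expectation (\<lambda>\<omega>. (R i \<omega>)\<^sup>2) = \<tau>" "expectation (\<lambda>\<omega>. (R j \<omega>)\<^sup>2) = \<tau>"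
    using ij R_square_integrable fourth by (simp_all add: R_def)
  have b: "integrable M (\<lambda>\<omega>. R i \<omega> * R j \<omega>)" "expectation (\<lambda>\<omega>. R i \<omega> * R j \<omega>) = t * t"
    using pair_indep[OF ij, of "R i" "R j"] ij R_moment1 R_measurable by auto
  have c: "integrable M (\<lambda>\<omega>. (I \<omega>)\<^sup>2)" "expectation (\<lambda>\<omega>. (I \<omega>)\<^sup>2) = s"
    unfolding I_def using inner_square[OF ij] by auto
  have d: "integrable M (\<lambda>\<omega>. R i \<omega> * I \<omega>)" "expectation (\<lambda>\<omega>. R i \<omega> * I \<omega>) = 0"
    unfolding I_def using R_inner[OF ij] by auto
  have e: "integrable M (\<lambda>\<omega>. R j \<omega> * I \<omega>)" "expectation (\<lambda>\<omega>. R j \<omega> * I \<omega>) = 0"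
    unfolding I_def using R_inner[OF ij(2,1) ij(3)[symmetric]] by (auto simp: mult.commute[of "Z i _ _"])
  show "integrable M (\<lambda>\<omega>. (D i j \<omega>)\<^sup>2)" unfolding eq using a b c d e by simp
  show "expectation (\<lambda>\<omega>. (D i j \<omega>)\<^sup>2) = 2 * \<tau> + 2 * t\<^sup>2 + 4 * s"
    unfolding eq using a b c d e by (simp add: power2_eq_square)
qed

lemma D_product:
  assumes q: "(i, j, k, l) \<in> quadruples n"
  shows "integrable M (\<lambda>\<omega>. D i j \<omega> * D k l \<omega>)" "expectation (\<lambda>\<omega>. D i j \<omega> * D k l \<omega>) = 4 * t\<^sup>2"
proof -
  have "integrable M (\<lambda>\<omega>. D i j \<omega> * D k l \<omega>) \<and> expectation (\<lambda>\<omega>. D i j \<omega> * D k l \<omega>) = expectation (D i j) * expectation (D k l)"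
    using q by (intro blk_indep[of "{i, j}" "{k, l}"] D_measurable D_moment1) (auto simp: quadruples_def)
  then show "integrable M (\<lambda>\<omega>. D i j \<omega> * D k l \<omega>)" "expectation (\<lambda>\<omega>. D i j \<omega> * D k l \<omega>) = 4 * t\<^sup>2"
    using q D_moment1(2) by (auto simp: quadruples_def power2_eq_square)
qed

lemma P_square:
  assumes q: "(i, j, k, l) \<in> quadruples n"
  shows "integrable M (\<lambda>\<omega>. (P i j k l \<omega>)\<^sup>2)" "expectation (\<lambda>\<omega>. (P i j k l \<omega>)\<^sup>2) = 4 * s"
proof -
  have ij: "i \<in> {1..n}" "j \<in> {1..n}" "i \<noteq> j" and kl: "k \<in> {1..n}" "l \<in> {1..n}" "k \<noteq> l"
    and disj: "{i, j} \<inter> {k, l} = {}"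
    using q by (auto simp: quadruples_def)
  define V where "V c d i j \<omega> = (Z i c \<omega> - Z j c \<omega>) * (Z i d \<omega> - Z j d \<omega>)" for c d i j \<omega>
  \<comment> \<open>Regrouping by pairs of observations: the two factors depend on disjoint pairs,
    and each has mean \<open>2 * G c d\<close>.\<close>
  have eq: "(P i j k l \<omega>)\<^sup>2 = (\<Sum>c<p. \<Sum>d<p. V c d i j \<omega> * V c d k l \<omega>)" for \<omega>
    unfolding P_def power2_eq_square sum_product V_def by (intro sum.cong refl) (simp add: mult_ac)
  have I: "integrable M (\<lambda>\<omega>. V c d i j \<omega> * V c d k l \<omega>)"
    "expectation (\<lambda>\<omega>. V c d i j \<omega> * V c d k l \<omega>) = 4 * (G c d)\<^sup>2" if "c < p" "d < p" for c d
  proof -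
    have "integrable M (\<lambda>\<omega>. V c d i j \<omega> * V c d k l \<omega>) \<and>
      expectation (\<lambda>\<omega>. V c d i j \<omega> * V c d k l \<omega>) = expectation (V c d i j) * expectation (V c d k l)"
    proof (rule blk_indep[of "{i, j}" "{k, l}"])
      show "V c d i j \<in> borel_measurable (blk {i, j})" "V c d k l \<in> borel_measurable (blk {k, l})"
        unfolding V_def[abs_def] using that ij kl
        by (auto intro!: borel_measurable_times borel_measurable_diff Z_measurable)
      show "integrable M (V c d i j)" "integrable M (V c d k l)"
        unfolding V_def[abs_def] using diff_cross(1) ij kl that by auto
    qed (use ij kl disj in auto)
    moreover have "expectation (V c d i j) = 2 * G c d" "expectation (V c d k l) = 2 * G c d"
      unfolding V_def[abs_def] using diff_cross(2) ij kl that by auto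
    ultimately show "integrable M (\<lambda>\<omega>. V c d i j \<omega> * V c d k l \<omega>)"
      "expectation (\<lambda>\<omega>. V c d i j \<omega> * V c d k l \<omega>) = 4 * (G c d)\<^sup>2"
      by (auto simp: power2_eq_square)
  qed
  show "integrable M (\<lambda>\<omega>. (P i j k l \<omega>)\<^sup>2)"
    unfolding eq using I by (intro Bochner_Integration.integrable_sum) auto
  have "expectation (\<lambda>\<omega>. (P i j k l \<omega>)\<^sup>2) = (\<Sum>c<p. expectation (\<lambda>\<omega>. \<Sum>d<p. V c d i j \<omega> * V c d k l \<omega>))"
    unfolding eq using I by (intro Bochner_Integration.integral_sum Bochner_Integration.integrable_sum) auto
  also have "\<dots> = (\<Sum>c<p. \<Sum>d<p. expectation (\<lambda>\<omega>. V c d i j \<omega> * V c d k l \<omega>))"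
    using I by (intro sum.cong refl Bochner_Integration.integral_sum) auto
  finally show "expectation (\<lambda>\<omega>. (P i j k l \<omega>)\<^sup>2) = 4 * s"
    using I by (simp add: s_def sum_distrib_left)
qed

text \<open>The kernels are those of \<open>4 (T2 + 2 T3)\<close> and \<open>4 (T1 + T2 - 2 T3)\<close>: the common factor of
  \<open>T1\<close>, \<open>T2\<close>, \<open>T3\<close> cancels in the ratio.\<close>

fun kernel_den :: "nat \<times> nat \<times> nat \<times> nat \<Rightarrow> 'a \<Rightarrow> real" where
  "kernel_den (i, j, k, l) \<omega> = D i j \<omega> * D k l \<omega> + 2 * (P i j k l \<omega>)\<^sup>2"

fun kernel_num :: "nat \<times> nat \<times> nat \<times> nat \<Rightarrow> 'a \<Rightarrow> real" where
  "kernel_num (i, j, k, l) \<omega> = (D i j \<omega> - D k l \<omega>)\<^sup>2 + D i j \<omega> * D k l \<omega> - 2 * (P i j k l \<omega>)\<^sup>2"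

text \<open>A common dominating variable for both kernels; being a sum of squared norms, its fourth
  moment is governed by the eighth moment of the observations.\<close>

fun spread :: "nat \<times> nat \<times> nat \<times> nat \<Rightarrow> 'a \<Rightarrow> real" where
  "spread (i, j, k, l) \<omega> = (R i \<omega> + R j \<omega>) + (R k \<omega> + R l \<omega>)"

lemma kernel_den_moment:
  assumes "q \<in> quadruples n"
  shows "integrable M (kernel_den q)" "expectation (kernel_den q) = 4 * (t\<^sup>2 + 2 * s)"
proof -
  obtain i j k l where q: "q = (i, j, k, l)" by (cases q)
  have k: "kernel_den q = (\<lambda>\<omega>. D i j \<omega> * D k l \<omega> + 2 * (P i j k l \<omega>)\<^sup>2)"
    by (simp add: q fun_eq_iff)
  show "integrable M (kernel_den q)" "expectation (kernel_den q) = 4 * (t\<^sup>2 + 2 * s)"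
    unfolding k using D_product P_square assms q by simp_all
qed

text \<open>The two squares contribute 4 tau + 4 t^2 + 8 s in all, the product of distances takes
  away 4 t^2 and the inner product 8 s, so tau alone survives.\<close>

lemma kernel_num_moment:
  assumes "q \<in> quadruples n"
  shows "integrable M (kernel_num q)" "expectation (kernel_num q) = 4 * \<tau>"
proof -
  obtain i j k l where q: "q = (i, j, k, l)" by (cases q)
  have ij: "i \<in> {1..n}" "j \<in> {1..n}" "i \<noteq> j" and kl: "k \<in> {1..n}" "l \<in> {1..n}" "k \<noteq> l"
    using assms q by (auto simp: quadruples_def)
  have k: "kernel_num q = (\<lambda>\<omega>. (D i j \<omega>)\<^sup>2 + (D k l \<omega>)\<^sup>2 - D i j \<omega> * D k l \<omega> - 2 * (P i j k l \<omega>)\<^sup>2)"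
    by (simp add: q fun_eq_iff power2_eq_square algebra_simps)
  show "integrable M (kernel_num q)" "expectation (kernel_num q) = 4 * \<tau>"
    unfolding k using D_product P_square D_square[OF ij] D_square[OF kl] assms q by simp_all
qed

lemma kernel_measurable:
  assumes "q \<in> quadruples n"
  shows "kernel_den q \<in> borel_measurable (blk (indices q))" "kernel_num q \<in> borel_measurable (blk (indices q))"
proof -
  obtain i j k l where q: "q = (i, j, k, l)" by (cases q)
  have A: "{i, j, k, l} \<subseteq> {1..n}" using assms q by (auto simp: quadruples_def)
  have D [measurable]: "D i j \<in> borel_measurable (blk {i, j, k, l})" "D k l \<in> borel_measurable (blk {i, j, k, l})"
    "P i j k l \<in> borel_measurable (blk {i, j, k, l})"
    using A by (intro D_measurable P_measurable; simp)+
  show "kernel_den q \<in> borel_measurable (blk (indices q))" "kernel_num q \<in> borel_measurable (blk (indices q))"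
    unfolding q indices.simps kernel_den.simps[abs_def] kernel_num.simps[abs_def] by measurable
qed

section \<open>Domination of the kernels and tail bounds\<close>

lemma D_le: "D i j \<omega> \<le> 2 * (R i \<omega> + R j \<omega>)"
proof -
  have "D i j \<omega> \<le> (\<Sum>c<p. 2 * ((Z i c \<omega>)\<^sup>2 + (Z j c \<omega>)\<^sup>2))"
    unfolding D_def
  proof (rule sum_mono)
    fix c
    show "(Z i c \<omega> - Z j c \<omega>)\<^sup>2 \<le> 2 * ((Z i c \<omega>)\<^sup>2 + (Z j c \<omega>)\<^sup>2)"
      using zero_le_power2[of "Z i c \<omega> + Z j c \<omega>"] by (simp add: power2_eq_square algebra_simps)
  qed
  then show ?thesis by (simp add: R_def sum.distrib sum_distrib_left)
qed

lemma P_square_le: "(P i j k l \<omega>)\<^sup>2 \<le> D i j \<omega> * D k l \<omega>"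
  unfolding P_def D_def by (rule Cauchy_Schwarz_ineq_sum)

text \<open>With x and y the two squared distances and z the squared inner product, Cauchy-Schwarz
  gives 0 \<le> z \<le> x y, and this places both kernels between -(x + y)^2 and (x + y)^2; finally
  x + y is at most twice the spread.\<close>

lemma kernel_bound:
  "\<bar>kernel_den q \<omega>\<bar> \<le> 4 * (spread q \<omega>)\<^sup>2" "\<bar>kernel_num q \<omega>\<bar> \<le> 4 * (spread q \<omega>)\<^sup>2"
proof -
  obtain i j k l where q: "q = (i, j, k, l)" by (cases q)
  define x y z where "x = D i j \<omega>" "y = D k l \<omega>" "z = (P i j k l \<omega>)\<^sup>2"
  have xy: "0 \<le> x" "0 \<le> y" "0 \<le> z" "z \<le> x * y"
    by (auto simp: x_y_z_def D_nonneg P_square_le)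
  have "x + y \<le> 2 * spread q \<omega>"
    using D_le[of i j \<omega>] D_le[of k l \<omega>] by (simp add: x_y_z_def q)
  then have "(x + y)\<^sup>2 \<le> (2 * spread q \<omega>)\<^sup>2" using xy by (intro power_mono) auto
  then have S: "(x + y)\<^sup>2 \<le> 4 * (spread q \<omega>)\<^sup>2" by (simp add: power_mult_distrib)
  have am: "4 * (x * y) \<le> (x + y)\<^sup>2" and sq: "(x + y)\<^sup>2 = (x - y)\<^sup>2 + 4 * (x * y)"
    using zero_le_power2[of "x - y"] by (simp_all add: power2_eq_square algebra_simps)
  show "\<bar>kernel_den q \<omega>\<bar> \<le> 4 * (spread q \<omega>)\<^sup>2"
  proof -
    have "kernel_den q \<omega> = x * y + 2 * z" by (simp add: q x_y_z_def)
    then show ?thesis using xy S am by (auto simp: abs_le_iff)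
  qed
  show "\<bar>kernel_num q \<omega>\<bar> \<le> 4 * (spread q \<omega>)\<^sup>2"
  proof -
    have "kernel_num q \<omega> = (x - y)\<^sup>2 + x * y - 2 * z" by (simp add: q x_y_z_def)
    moreover have "0 \<le> (x - y)\<^sup>2" by simp
    ultimately show ?thesis using xy S am sq unfolding abs_le_iff by linarith
  qed
qed

text \<open>Splitting the four summands into halves twice costs 8 * 8 = 64, and each of the four
  terms is at most \<open>K\<close>.\<close>

lemma spread_power4:
  assumes "q \<in> quadruples n"
  shows "integrable M (\<lambda>\<omega>. spread q \<omega> ^ 4)" "expectation (\<lambda>\<omega>. spread q \<omega> ^ 4) \<le> 256 * K"
proof -
  obtain i j k l where q: "q = (i, j, k, l)" by (cases q)
  have ix: "i \<in> {1..n}" "j \<in> {1..n}" "k \<in> {1..n}" "l \<in> {1..n}"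
    using assms q by (auto simp: quadruples_def)
  have le: "spread q \<omega> ^ 4 \<le> 64 * (R i \<omega> ^ 4 + R j \<omega> ^ 4 + R k \<omega> ^ 4 + R l \<omega> ^ 4)" for \<omega>
    using sum_power4_le[of "R i \<omega> + R j \<omega>" "R k \<omega> + R l \<omega>"] sum_power4_le[of "R i \<omega>" "R j \<omega>"]
      sum_power4_le[of "R k \<omega>" "R l \<omega>"] by (simp add: q)
  have I: "integrable M (\<lambda>\<omega>. R i \<omega> ^ 4)" "expectation (\<lambda>\<omega>. R i \<omega> ^ 4) \<le> K" if "i \<in> {1..n}" for i
    using eighth_int[OF that] eighth[OF that] by (simp_all add: R_def)
  have meas: "(\<lambda>\<omega>. spread q \<omega> ^ 4) \<in> borel_measurable M"
    using R_moment1(1) ix unfolding q spread.simps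
    by (intro borel_measurable_power borel_measurable_add) auto
  have "norm (spread q \<omega> ^ 4) \<le> norm (64 * (R i \<omega> ^ 4 + R j \<omega> ^ 4 + R k \<omega> ^ 4 + R l \<omega> ^ 4))" for \<omega>
    using le[of \<omega>] by simp
  then show int: "integrable M (\<lambda>\<omega>. spread q \<omega> ^ 4)"
    using I ix by (intro Bochner_Integration.integrable_bound[OF _ meas,
          of "\<lambda>\<omega>. 64 * (R i \<omega> ^ 4 + R j \<omega> ^ 4 + R k \<omega> ^ 4 + R l \<omega> ^ 4)"]) auto
  have "expectation (\<lambda>\<omega>. spread q \<omega> ^ 4) \<le> expectation (\<lambda>\<omega>. 64 * (R i \<omega> ^ 4 + R j \<omega> ^ 4 + R k \<omega> ^ 4 + R l \<omega> ^ 4))"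
    using int le I ix by (intro integral_mono) auto
  also have "\<dots> = 64 * (expectation (\<lambda>\<omega>. R i \<omega> ^ 4) + expectation (\<lambda>\<omega>. R j \<omega> ^ 4) + expectation (\<lambda>\<omega>. R k \<omega> ^ 4) + expectation (\<lambda>\<omega>. R l \<omega> ^ 4))"
    using I ix by simp
  also have "\<dots> \<le> 64 * (K + K + K + K)"
    using ix by (intro mult_left_mono add_mono I(2)) auto
  finally show "expectation (\<lambda>\<omega>. spread q \<omega> ^ 4) \<le> 256 * K" by simp
qed

text \<open>Stated for a general \<open>f\<close> so that it covers both the denominator kernel and
  the numerator kernel minus theta times it. The constant is 4096 = 256 * 16, from the fourth moment
  of the spread and the count of overlapping quadruples.\<close>

lemma kernel_sum_tail:
  fixes f :: "nat \<times> nat \<times> nat \<times> nat \<Rightarrow> 'a \<Rightarrow> real"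
  assumes meas: "\<And>q. q \<in> quadruples n \<Longrightarrow> f q \<in> borel_measurable (blk (indices q))"
    and bound: "\<And>q \<omega>. \<bar>f q \<omega>\<bar> \<le> B * (spread q \<omega>)\<^sup>2"
    and int: "\<And>q. q \<in> quadruples n \<Longrightarrow> integrable M (f q)"
    and mean: "\<And>q. q \<in> quadruples n \<Longrightarrow> expectation (f q) = m"
    and K: "K \<ge> 0" and \<delta>: "\<delta> > 0"
  shows "prob {\<omega> \<in> space M. \<delta> \<le> \<bar>(\<Sum>q\<in>quadruples n. f q \<omega>) - m * card (quadruples n)\<bar>}
    \<le> 4096 * B\<^sup>2 * K * real n ^ 3 * card (quadruples n) / \<delta>\<^sup>2"
proof -
  define h where "h q \<omega> = f q \<omega> - m" for q \<omega>
  have ind: "indices q \<subseteq> {1..n}" if "q \<in> quadruples n" for q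
    using that by (cases q) (auto simp: quadruples_def)
  have fM: "f q \<in> borel_measurable M" if "q \<in> quadruples n" for q
    using int[OF that] by auto
  have sq_le: "(f q \<omega>)\<^sup>2 \<le> B\<^sup>2 * spread q \<omega> ^ 4" for q \<omega>
  proof -
    have "(f q \<omega>)\<^sup>2 \<le> (B * (spread q \<omega>)\<^sup>2)\<^sup>2"
      using bound[of q \<omega>] by (metis abs_ge_zero power2_abs power_mono)
    then show ?thesis by (simp add: power_mult_distrib)
  qed
  have f2: "integrable M (\<lambda>\<omega>. (f q \<omega>)\<^sup>2)" if q: "q \<in> quadruples n" for q
  proof (rule Bochner_Integration.integrable_bound)
    show "integrable M (\<lambda>\<omega>. B\<^sup>2 * spread q \<omega> ^ 4)" using spread_power4[OF q] by simp
    show "(\<lambda>\<omega>. (f q \<omega>)\<^sup>2) \<in> borel_measurable M" using fM[OF q] by simp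
    show "AE \<omega> in M. norm ((f q \<omega>)\<^sup>2) \<le> norm (B\<^sup>2 * spread q \<omega> ^ 4)" using sq_le by simp
  qed
  have f2E: "expectation (\<lambda>\<omega>. (f q \<omega>)\<^sup>2) \<le> B\<^sup>2 * (256 * K)" if q: "q \<in> quadruples n" for q
  proof -
    have "expectation (\<lambda>\<omega>. (f q \<omega>)\<^sup>2) \<le> expectation (\<lambda>\<omega>. B\<^sup>2 * spread q \<omega> ^ 4)"
      using f2[OF q] spread_power4(1)[OF q] sq_le by (intro integral_mono) auto
    also have "\<dots> \<le> B\<^sup>2 * (256 * K)"
      using spread_power4(2)[OF q] by (simp add: mult_left_mono)
    finally show ?thesis .
  qed
  have h2: "integrable M (\<lambda>\<omega>. (h q \<omega>)\<^sup>2)" "expectation (\<lambda>\<omega>. (h q \<omega>)\<^sup>2) = expectation (\<lambda>\<omega>. (f q \<omega>)\<^sup>2) - m\<^sup>2"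
    if q: "q \<in> quadruples n" for q
  proof -
    have eq: "(h q \<omega>)\<^sup>2 = (f q \<omega>)\<^sup>2 - 2 * m * f q \<omega> + m\<^sup>2" for \<omega>
      by (simp add: h_def power2_eq_square algebra_simps)
    show "integrable M (\<lambda>\<omega>. (h q \<omega>)\<^sup>2)"
      unfolding eq using f2[OF q] int[OF q] by simp
    show "expectation (\<lambda>\<omega>. (h q \<omega>)\<^sup>2) = expectation (\<lambda>\<omega>. (f q \<omega>)\<^sup>2) - m\<^sup>2"
      unfolding eq using f2[OF q] int[OF q] mean[OF q] by (simp add: prob_space power2_eq_square)
  qed
  have uncorr: "expectation (\<lambda>\<omega>. h q \<omega> * h r \<omega>) = 0"
    if q: "q \<in> quadruples n" and r: "r \<in> quadruples n" and d: "\<not> indices q \<inter> indices r \<noteq> {}" for q r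
  proof -
    have "expectation (\<lambda>\<omega>. h q \<omega> * h r \<omega>) = expectation (h q) * expectation (h r)"
      using blk_indep[OF ind[OF q] ind[OF r], of "h q" "h r"] d meas[OF q] meas[OF r] int[OF q] int[OF r]
      unfolding h_def[abs_def] by simp
    moreover have "expectation (h q) = 0"
      unfolding h_def[abs_def] using int[OF q] mean[OF q] by (simp add: prob_space)
    ultimately show ?thesis by simp
  qed
  define S where "S \<omega> = (\<Sum>q\<in>quadruples n. h q \<omega>)" for \<omega>
  have hE: "expectation (\<lambda>\<omega>. (h q \<omega>)\<^sup>2) \<le> B\<^sup>2 * (256 * K)" if "q \<in> quadruples n" for q
    using h2(2)[OF that] f2E[OF that] zero_le_power2[of m] by linarith
  have hM: "h q \<in> borel_measurable M" if "q \<in> quadruples n" for q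
    unfolding h_def[abs_def] using fM[OF that] by simp
  have "0 \<le> B\<^sup>2 * (256 * K)" using K by simp
  note V = sum_second_moment_le[where Q="quadruples n" and h=h and R="\<lambda>q r. indices q \<inter> indices r \<noteq> {}",
      OF finite_quadruples hM h2(1) hE uncorr card_overlapping_quadruples this, folded S_def]
  have "S \<in> borel_measurable M"
    unfolding S_def[abs_def] h_def using fM by (intro borel_measurable_sum) simp
  then have "prob {\<omega> \<in> space M. \<delta> \<le> \<bar>S \<omega>\<bar>} \<le> expectation (\<lambda>\<omega>. (S \<omega>)\<^sup>2) / \<delta>\<^sup>2"
    by (rule second_moment_tail[OF _ V(1) \<delta>])
  also have "\<dots> \<le> (B\<^sup>2 * (256 * K)) * (16 * real n ^ 3) * card (quadruples n) / \<delta>\<^sup>2"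
    using V(2) by (intro divide_right_mono) simp_all
  also have "\<dots> = 4096 * B\<^sup>2 * K * real n ^ 3 * card (quadruples n) / \<delta>\<^sup>2" by simp
  also have "S = (\<lambda>\<omega>. (\<Sum>q\<in>quadruples n. f q \<omega>) - m * card (quadruples n))"
    by (simp add: S_def[abs_def] h_def sum_subtractf mult.commute)
  finally show ?thesis .
qed

text \<open>The denominator has mean 4 b Q. Unless it misses this by at least half, it exceeds 2 b
  Q, and then an error above epsilon in the ratio makes the numerator minus theta times the
  denominator at least 2 epsilon b Q in modulus. Both events have small probability.\<close>

lemma ratio_tail:
  assumes n: "n \<ge> 4" and b: "t\<^sup>2 + 2 * s > 0" and \<tau>: "\<tau> = \<theta> * (t\<^sup>2 + 2 * s)" and \<epsilon>: "\<epsilon> > 0" and K: "K \<ge> 0"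
  shows "prob {\<omega> \<in> space M. \<epsilon> < \<bar>(\<Sum>q\<in>quadruples n. kernel_num q \<omega>) / (\<Sum>q\<in>quadruples n. kernel_den q \<omega>) - \<theta>\<bar>}
    \<le> 16384 * (1 + (1 + \<bar>\<theta>\<bar>)\<^sup>2 / \<epsilon>\<^sup>2) * (K / (t\<^sup>2 + 2 * s)\<^sup>2) * (real n ^ 3 / card (quadruples n))"
proof -
  define b where "b = t\<^sup>2 + 2 * s"
  define Q where "Q = real (card (quadruples n))"
  define Den where "Den \<omega> = (\<Sum>q\<in>quadruples n. kernel_den q \<omega>)" for \<omega>
  define Num where "Num \<omega> = (\<Sum>q\<in>quadruples n. kernel_num q \<omega>)" for \<omega>
  define w where "w q \<omega> = kernel_num q \<omega> - \<theta> * kernel_den q \<omega>" for q \<omega>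
  have bpos: "b > 0" using b by (simp add: b_def)
  have Qpos: "Q > 0" unfolding Q_def card_quadruples[OF n] using n by simp
  have sumw: "(\<Sum>q\<in>quadruples n. w q \<omega>) = Num \<omega> - \<theta> * Den \<omega>" for \<omega>
    by (simp add: w_def Num_def Den_def sum_subtractf sum_distrib_left)
  have Den_tail: "prob {\<omega> \<in> space M. 2 * b * Q \<le> \<bar>Den \<omega> - 4 * b * Q\<bar>} \<le> 4096 * 4\<^sup>2 * K * real n ^ 3 * Q / (2 * b * Q)\<^sup>2"
    unfolding Den_def Q_def b_def
    by (rule kernel_sum_tail) (use kernel_measurable kernel_bound kernel_den_moment K bpos Qpos in \<open>auto simp: b_def Q_def\<close>)
  have w_bound: "\<bar>w q \<omega>\<bar> \<le> (4 * (1 + \<bar>\<theta>\<bar>)) * (spread q \<omega>)\<^sup>2" for q \<omega>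
  proof -
    have "\<bar>w q \<omega>\<bar> \<le> \<bar>kernel_num q \<omega>\<bar> + \<bar>\<theta>\<bar> * \<bar>kernel_den q \<omega>\<bar>"
      unfolding w_def by (metis abs_mult abs_triangle_ineq4)
    also have "\<dots> \<le> 4 * (spread q \<omega>)\<^sup>2 + \<bar>\<theta>\<bar> * (4 * (spread q \<omega>)\<^sup>2)"
      by (intro add_mono mult_left_mono kernel_bound) simp
    finally show ?thesis by (simp add: algebra_simps)
  qed
  \<comment> \<open>The kernel \<open>w\<close> has mean 0 by the assumed relation between tau and
    theta.\<close>
  have "prob {\<omega> \<in> space M. 2 * \<epsilon> * b * Q \<le> \<bar>(\<Sum>q\<in>quadruples n. w q \<omega>) - 0 * real (card (quadruples n))\<bar>}
     \<le> 4096 * (4 * (1 + \<bar>\<theta>\<bar>))\<^sup>2 * K * real n ^ 3 * card (quadruples n) / (2 * \<epsilon> * b * Q)\<^sup>2"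
  proof (rule kernel_sum_tail[OF _ w_bound])
    fix q assume q: "q \<in> quadruples n"
    show "w q \<in> borel_measurable (blk (indices q))"
      unfolding w_def[abs_def] using kernel_measurable[OF q] by simp
    show "integrable M (w q)"
      unfolding w_def[abs_def] using kernel_den_moment[OF q] kernel_num_moment[OF q] by simp
    show "expectation (w q) = 0"
      unfolding w_def[abs_def] using kernel_den_moment[OF q] kernel_num_moment[OF q] by (simp add: \<tau>)
  qed (use K \<epsilon> bpos Qpos in auto)
  then have W_tail: "prob {\<omega> \<in> space M. 2 * \<epsilon> * b * Q \<le> \<bar>Num \<omega> - \<theta> * Den \<omega>\<bar>}
     \<le> 4096 * (4 * (1 + \<bar>\<theta>\<bar>))\<^sup>2 * K * real n ^ 3 * Q / (2 * \<epsilon> * b * Q)\<^sup>2"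
    by (simp add: sumw Q_def)
  have kM: "kernel_den q \<in> borel_measurable M" "kernel_num q \<in> borel_measurable M" if "q \<in> quadruples n" for q
    using kernel_den_moment(1)[OF that] kernel_num_moment(1)[OF that] by auto
  have [measurable]: "Den \<in> borel_measurable M" "Num \<in> borel_measurable M"
    unfolding Den_def[abs_def] Num_def[abs_def] using kM by (auto intro!: borel_measurable_sum)
  have sub: "{\<omega> \<in> space M. \<epsilon> < \<bar>Num \<omega> / Den \<omega> - \<theta>\<bar>} \<subseteq>
    {\<omega> \<in> space M. 2 * b * Q \<le> \<bar>Den \<omega> - 4 * b * Q\<bar>} \<union> {\<omega> \<in> space M. 2 * \<epsilon> * b * Q \<le> \<bar>Num \<omega> - \<theta> * Den \<omega>\<bar>}"
  proof
    fix \<omega> assume \<omega>: "\<omega> \<in> {\<omega> \<in> space M. \<epsilon> < \<bar>Num \<omega> / Den \<omega> - \<theta>\<bar>}"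
    show "\<omega> \<in> {\<omega> \<in> space M. 2 * b * Q \<le> \<bar>Den \<omega> - 4 * b * Q\<bar>} \<union> {\<omega> \<in> space M. 2 * \<epsilon> * b * Q \<le> \<bar>Num \<omega> - \<theta> * Den \<omega>\<bar>}"
    proof (cases "2 * b * Q \<le> \<bar>Den \<omega> - 4 * b * Q\<bar>")
      case False
      then have D: "Den \<omega> > 2 * b * Q" by linarith
      then have Dpos: "Den \<omega> > 0" using bpos Qpos by (smt (verit) mult_pos_pos)
      have "\<bar>Num \<omega> - \<theta> * Den \<omega>\<bar> = \<bar>(Num \<omega> / Den \<omega> - \<theta>) * Den \<omega>\<bar>"
        using Dpos by (simp add: left_diff_distrib)
      also have "\<dots> = \<bar>Num \<omega> / Den \<omega> - \<theta>\<bar> * Den \<omega>" using Dpos by (simp add: abs_mult)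
      also have "\<dots> \<ge> \<epsilon> * (2 * b * Q)"
        using \<omega> D \<epsilon> bpos Qpos by (intro mult_mono) auto
      finally show ?thesis using \<omega> by (simp add: mult_ac)
    qed (use \<omega> in auto)
  qed
  have "prob {\<omega> \<in> space M. \<epsilon> < \<bar>Num \<omega> / Den \<omega> - \<theta>\<bar>} \<le>
    prob ({\<omega> \<in> space M. 2 * b * Q \<le> \<bar>Den \<omega> - 4 * b * Q\<bar>} \<union> {\<omega> \<in> space M. 2 * \<epsilon> * b * Q \<le> \<bar>Num \<omega> - \<theta> * Den \<omega>\<bar>})"
    by (rule finite_measure_mono[OF sub]) measurable
  also have "\<dots> \<le> prob {\<omega> \<in> space M. 2 * b * Q \<le> \<bar>Den \<omega> - 4 * b * Q\<bar>} + prob {\<omega> \<in> space M. 2 * \<epsilon> * b * Q \<le> \<bar>Num \<omega> - \<theta> * Den \<omega>\<bar>}"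
    by (rule measure_Un_le) measurable
  also have "\<dots> \<le> 4096 * 4\<^sup>2 * K * real n ^ 3 * Q / (2 * b * Q)\<^sup>2 + 4096 * (4 * (1 + \<bar>\<theta>\<bar>))\<^sup>2 * K * real n ^ 3 * Q / (2 * \<epsilon> * b * Q)\<^sup>2"
    by (intro add_mono Den_tail W_tail)
  also have "\<dots> = 16384 * (1 + (1 + \<bar>\<theta>\<bar>)\<^sup>2 / \<epsilon>\<^sup>2) * (K / b\<^sup>2) * (real n ^ 3 / Q)"
  proof -
    have "4096 * 4\<^sup>2 * K * real n ^ 3 * Q / (2 * b * Q)\<^sup>2 = 16384 * (K / b\<^sup>2) * (real n ^ 3 / Q)"
      using bpos Qpos by (simp add: power2_eq_square field_simps)
    moreover have "4096 * (4 * (1 + \<bar>\<theta>\<bar>))\<^sup>2 * K * real n ^ 3 * Q / (2 * \<epsilon> * b * Q)\<^sup>2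
        = 16384 * ((1 + \<bar>\<theta>\<bar>)\<^sup>2 / \<epsilon>\<^sup>2) * (K / b\<^sup>2) * (real n ^ 3 / Q)"
    proof -
      define u where "u = (1 + \<bar>\<theta>\<bar>)"
      show ?thesis
        unfolding u_def[symmetric] using bpos Qpos \<epsilon> by (simp add: power2_eq_square field_simps)
    qed
    ultimately show ?thesis by (simp add: algebra_simps)
  qed
  finally show ?thesis unfolding Num_def Den_def b_def Q_def .
qed

end

section \<open>Consistency of the estimator\<close>

text \<open>The instance chosen for \<open>blk\<close>. The joint map of the block is pulled back,
  since independence of disjoint blocks is a statement about these restricted families.\<close>

definition block_algebra :: "nat \<Rightarrow> 'a measure \<Rightarrow> (nat \<Rightarrow> 'a \<Rightarrow> real vec) \<Rightarrow> nat set \<Rightarrow> 'a measure" where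
  "block_algebra p M X A = vimage_algebra (space M) (\<lambda>\<omega>. \<lambda>i\<in>A. X i \<omega>) (\<Pi>\<^sub>M i\<in>A. borel_vec p)"

lemma block_map_measurable:
  assumes "\<And>i. i \<in> A \<Longrightarrow> X i \<in> measurable M (borel_vec p)"
  shows "(\<lambda>\<omega>. \<lambda>i\<in>A. X i \<omega>) \<in> measurable M (\<Pi>\<^sub>M i\<in>A. borel_vec p)"
  using assms by (intro measurable_restrict)

lemma sets_block_algebra:
  assumes "\<And>i. i \<in> A \<Longrightarrow> X i \<in> measurable M (borel_vec p)"
  shows "sets (block_algebra p M X A) =
    {(\<lambda>\<omega>. \<lambda>i\<in>A. X i \<omega>) -` B \<inter> space M | B. B \<in> sets (\<Pi>\<^sub>M i\<in>A. borel_vec p)}"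
  unfolding block_algebra_def
  using measurable_space[OF block_map_measurable[of A X M p, OF assms]]
  by (subst sets_vimage_algebra2) auto

lemma space_block_algebra: "space (block_algebra p M X A) = space M"
  by (simp add: block_algebra_def)

lemma block_algebra_measurable:
  assumes X: "\<And>i. i \<in> A \<Longrightarrow> X i \<in> measurable M (borel_vec p)"
    and f: "f \<in> borel_measurable (block_algebra p M X A)"
  shows "(f :: 'a \<Rightarrow> real) \<in> borel_measurable M"
proof -
  have "sets (block_algebra p M X A) \<subseteq> sets M"
    using sets_block_algebra[OF X] measurable_sets[OF block_map_measurable[OF X]] by auto
  then have "subalgebra M (block_algebra p M X A)"
    by (simp add: subalgebra_def space_block_algebra)
  then show ?thesis using f by (rule measurable_from_subalg)
qed

lemma block_algebra_coordinate:
  assumes X: "\<And>i. i \<in> A \<Longrightarrow> X i \<in> measurable M (borel_vec p)" and i: "i \<in> A" and c: "c < p"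
  shows "(\<lambda>\<omega>. X i \<omega> $ c) \<in> borel_measurable (block_algebra p M X A)"
proof -
  have "(\<lambda>\<omega>. \<lambda>i\<in>A. X i \<omega>) \<in> measurable (block_algebra p M X A) (\<Pi>\<^sub>M i\<in>A. borel_vec p)"
    unfolding block_algebra_def
    using measurable_space[OF block_map_measurable[of A X M p, OF X]]
    by (intro measurable_vimage_algebra1) auto
  from measurable_compose[OF measurable_compose[OF this measurable_component_singleton[OF i]] measurable_vec_index[OF c]]
  show ?thesis using i by simp
qed

lemma (in prob_space) block_algebra_indep:
  fixes f g :: "'a \<Rightarrow> real"
  assumes ind: "indep_vars (\<lambda>i. borel_vec p) X I"
    and AB: "A \<subseteq> I" "B \<subseteq> I" "A \<inter> B = {}"
    and f: "f \<in> borel_measurable (block_algebra p M X A)" and g: "g \<in> borel_measurable (block_algebra p M X B)"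
    and int: "integrable M f" "integrable M g"
  shows "integrable M (\<lambda>\<omega>. f \<omega> * g \<omega>) \<and> expectation (\<lambda>\<omega>. f \<omega> * g \<omega>) = expectation f * expectation g"
proof -
  have X: "X i \<in> measurable M (borel_vec p)" if "i \<in> I" for i
    using ind that by (auto simp: indep_vars_def)
  have XA: "\<And>i. i \<in> A \<Longrightarrow> X i \<in> measurable M (borel_vec p)" and XB: "\<And>i. i \<in> B \<Longrightarrow> X i \<in> measurable M (borel_vec p)"
    using X AB by auto
  define P where "P C = sigma_sets (space M) {(\<lambda>\<omega>. \<lambda>i\<in>C. X i \<omega>) -` B \<inter> space M | B. B \<in> sets (\<Pi>\<^sub>M i\<in>C. borel_vec p)}" for C
  have PQ: "indep_set (P A) (P B)"
    using indep_var_restrict[OF ind AB(3,1,2)] unfolding indep_var_eq P_def by simp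
  have "sets (block_algebra p M X A) \<subseteq> P A" "sets (block_algebra p M X B) \<subseteq> P B"
    using sets_block_algebra[of A X M p, OF XA] sets_block_algebra[of B X M p, OF XB]
    by (auto simp: P_def)
  then have fP: "f -` C \<inter> space M \<in> P A" and gP: "g -` C \<inter> space M \<in> P B" if "C \<in> sets borel" for C
    using measurable_sets[OF f that] measurable_sets[OF g that] by (auto simp: space_block_algebra)
  show ?thesis
    using indep_set_expectation[OF PQ fP gP int] by blast
qed

context elliptical
begin

text \<open>The observations and the generic copy live on different spaces and share only their law,
  so each moment is carried over by equality of distributions; \<open>W\<close> is the generic copy,
  and \<open>Y\<close> gives its centred coordinates.\<close>

lemma sample_is_centred_sample:
  fixes M :: "'c measure" and X :: "nat \<Rightarrow> 'c \<Rightarrow> real vec"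
  assumes M: "prob_space M"
    and A: "A \<in> carrier_mat p p" and a: "\<And>c j. a c j = A $$ (c, j)" and mu: "\<mu> \<in> carrier_vec p"
    and ind: "prob_space.indep_vars M (\<lambda>i. borel_vec p) X {1..n}"
    and copies: "\<And>i. i \<in> {1..n} \<Longrightarrow> distr M (borel_vec p) (X i) =
      distr N (borel_vec p) (\<lambda>\<omega>. \<mu> + \<xi> \<omega> \<cdot>\<^sub>v (A *\<^sub>v U \<omega>))"
  shows "centred_sample M n p (\<lambda>i c \<omega>. X i \<omega> $ c - \<mu> $ c) (block_algebra p M X) (gram p a)
    (expectation (\<lambda>\<omega>. \<xi> \<omega> ^ 4) / (real p * (real p + 2)) * ((gram_trace p a)\<^sup>2 + 2 * gram_trace2 p a))
    (105 * expectation (\<lambda>\<omega>. \<xi> \<omega> ^ 8) / real p ^ 4 * gram_trace p a ^ 4)"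
proof -
  interpret M: prob_space M by fact
  have X: "X i \<in> measurable M (borel_vec p)" if "i \<in> {1..n}" for i
    using ind that by (auto simp: M.indep_vars_def)
  define W where "W \<omega> = \<mu> + \<xi> \<omega> \<cdot>\<^sub>v (A *\<^sub>v U \<omega>)" for \<omega>
  have U: "U \<omega> \<in> carrier_vec p" if "\<omega> \<in> space N" for \<omega>
    using measurable_space[OF measurable_U that] by (simp add: space_borel_vec)
  have Wc: "W \<omega> $ c - \<mu> $ c = Y c \<omega>" if "\<omega> \<in> space N" "c < p" for \<omega> c
    using U[OF that(1)] that(2) A mu
    by (simp add: W_def Y_def a scalar_prod_def atLeast0LessThan)
  have W: "W \<in> measurable N (borel_vec p)"
  proof (rule measurable_borel_vecI)
    show "W \<omega> \<in> carrier_vec p" if "\<omega> \<in> space N" for \<omega>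
      using U[OF that] A mu by (simp add: W_def)
    fix c assume c: "c < p"
    have "(\<lambda>\<omega>. Y c \<omega> + \<mu> $ c) \<in> borel_measurable N"
      using Y_mean(1)[of c] by auto
    then show "(\<lambda>\<omega>. W \<omega> $ c) \<in> borel_measurable N"
      by (rule measurable_cong[THEN iffD1, rotated]) (use Wc c in \<open>auto simp: algebra_simps\<close>)
  qed
  have tr: "integrable M (\<lambda>\<omega>. g (X i \<omega>)) \<longleftrightarrow> integrable N (\<lambda>\<omega>. g (W \<omega>))"
    "M.expectation (\<lambda>\<omega>. g (X i \<omega>)) = expectation (\<lambda>\<omega>. g (W \<omega>))"
    if i: "i \<in> {1..n}" and g: "g \<in> borel_measurable (borel_vec p)" for i and g :: "real vec \<Rightarrow> real"
  proof -
    have law: "distr M (borel_vec p) (X i) = distr N (borel_vec p) W"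
      using copies[OF i] by (simp add: W_def[abs_def])
    show "integrable M (\<lambda>\<omega>. g (X i \<omega>)) \<longleftrightarrow> integrable N (\<lambda>\<omega>. g (W \<omega>))"
      using arg_cong[OF law, of "\<lambda>M. integrable M g"] integrable_distr_eq[OF X[OF i] g] integrable_distr_eq[OF W g] by simp
    show "M.expectation (\<lambda>\<omega>. g (X i \<omega>)) = expectation (\<lambda>\<omega>. g (W \<omega>))"
      using arg_cong[OF law, of "\<lambda>M. integral\<^sup>L M g"] integral_distr[OF X[OF i] g] integral_distr[OF W g] by simp
  qed
  \<comment> \<open>Vector entries from index \<open>p\<close> on are unspecified and need not agree
    with \<open>Y\<close>; \<open>loc\<close> confines \<open>g\<close> to the entries below
    \<open>p\<close>.\<close>
  have transfer: "integrable M (\<lambda>\<omega>. g (\<lambda>c. X i \<omega> $ c - \<mu> $ c)) \<longleftrightarrow> integrable N (\<lambda>\<omega>. g (\<lambda>c. Y c \<omega>))"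
    "M.expectation (\<lambda>\<omega>. g (\<lambda>c. X i \<omega> $ c - \<mu> $ c)) = expectation (\<lambda>\<omega>. g (\<lambda>c. Y c \<omega>))"
    if i: "i \<in> {1..n}" and g: "(\<lambda>v. g (\<lambda>c. v $ c - \<mu> $ c)) \<in> borel_measurable (borel_vec p)"
      and loc: "\<And>y z. (\<And>c. c < p \<Longrightarrow> y c = z c) \<Longrightarrow> g y = g z" for i and g :: "(nat \<Rightarrow> real) \<Rightarrow> real"
  proof -
    have eq: "g (\<lambda>c. W \<omega> $ c - \<mu> $ c) = g (\<lambda>c. Y c \<omega>)" if "\<omega> \<in> space N" for \<omega>
      using Wc[OF that] by (intro loc) auto
    show "integrable M (\<lambda>\<omega>. g (\<lambda>c. X i \<omega> $ c - \<mu> $ c)) \<longleftrightarrow> integrable N (\<lambda>\<omega>. g (\<lambda>c. Y c \<omega>))"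
      unfolding tr(1)[OF i g] by (rule Bochner_Integration.integrable_cong) (auto simp: eq)
    show "M.expectation (\<lambda>\<omega>. g (\<lambda>c. X i \<omega> $ c - \<mu> $ c)) = expectation (\<lambda>\<omega>. g (\<lambda>c. Y c \<omega>))"
      unfolding tr(2)[OF i g] by (rule Bochner_Integration.integral_cong) (auto simp: eq)
  qed
  show ?thesis
  proof
    fix B and f :: "'c \<Rightarrow> real"
    assume f: "f \<in> borel_measurable (block_algebra p M X B)" and B: "B \<subseteq> {1..n}"
    show "f \<in> borel_measurable M"
      by (rule block_algebra_measurable[OF _ f]) (use X B in auto)
  next
    fix B :: "nat set" and i c assume i: "i \<in> B" and B: "B \<subseteq> {1..n}" and c: "c < p"
    have "(\<lambda>\<omega>. X i \<omega> $ c) \<in> borel_measurable (block_algebra p M X B)"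
      by (rule block_algebra_coordinate[OF _ i c]) (use X B in auto)
    then show "(\<lambda>\<omega>. X i \<omega> $ c - \<mu> $ c) \<in> borel_measurable (block_algebra p M X B)"
      by simp
  next
    fix B C and f g :: "'c \<Rightarrow> real"
    assume "B \<subseteq> {1..n}" "C \<subseteq> {1..n}" "B \<inter> C = {}" "f \<in> borel_measurable (block_algebra p M X B)"
      "g \<in> borel_measurable (block_algebra p M X C)" "integrable M f" "integrable M g"
    then show "integrable M (\<lambda>\<omega>. f \<omega> * g \<omega>) \<and> M.expectation (\<lambda>\<omega>. f \<omega> * g \<omega>) = M.expectation f * M.expectation g"
      by (rule M.block_algebra_indep[OF ind])
  next
    fix i c assume i: "i \<in> {1..n}" and c: "c < p"
    show "integrable M (\<lambda>\<omega>. X i \<omega> $ c - \<mu> $ c)" "M.expectation (\<lambda>\<omega>. X i \<omega> $ c - \<mu> $ c) = 0"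
      using transfer[OF i, of "\<lambda>y. y c"] Y_mean[of c] c by auto
  next
    fix i c d assume i: "i \<in> {1..n}" and c: "c < p" "d < p"
    show "integrable M (\<lambda>\<omega>. (X i \<omega> $ c - \<mu> $ c) * (X i \<omega> $ d - \<mu> $ d))"
      "M.expectation (\<lambda>\<omega>. (X i \<omega> $ c - \<mu> $ c) * (X i \<omega> $ d - \<mu> $ d)) = gram p a c d"
      using transfer[OF i, of "\<lambda>y. y c * y d"] Y_cross[of c d] c by auto
  next
    fix i assume i: "i \<in> {1..n}"
    have m: "(\<lambda>v. (\<Sum>c<p. (v $ c - \<mu> $ c)\<^sup>2) ^ k) \<in> borel_measurable (borel_vec p)" for k
      by measurable
    note T = transfer[OF i m]
    show "M.expectation (\<lambda>\<omega>. (\<Sum>c<p. (X i \<omega> $ c - \<mu> $ c)\<^sup>2)\<^sup>2) =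
      expectation (\<lambda>\<omega>. \<xi> \<omega> ^ 4) / (real p * (real p + 2)) * ((gram_trace p a)\<^sup>2 + 2 * gram_trace2 p a)"
      by (subst T(2)) (auto simp: Y_norm_fourth)
    show "integrable M (\<lambda>\<omega>. (\<Sum>c<p. (X i \<omega> $ c - \<mu> $ c)\<^sup>2) ^ 4)"
      by (subst T(1)) (auto simp: Y_norm_eighth)
    show "M.expectation (\<lambda>\<omega>. (\<Sum>c<p. (X i \<omega> $ c - \<mu> $ c)\<^sup>2) ^ 4) \<le> 105 * expectation (\<lambda>\<omega>. \<xi> \<omega> ^ 8) / real p ^ 4 * gram_trace p a ^ 4"
      by (subst T(2)) (use Y_norm_eighth(2) in auto)
  qed
qed

text \<open>This keeps theta bounded in n. The inequality y \<le> 1 + y^2 is used at y = xi^4 / p^2,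
  whose square is the normalised eighth power.\<close>

lemma fourth_moment_le:
  "expectation (\<lambda>\<omega>. \<xi> \<omega> ^ 4) / (real p * (real p + 2)) \<le> 1 + expectation (\<lambda>\<omega>. \<xi> \<omega> ^ 8) / real p ^ 4"
proof -
  have y: "y \<le> 1 + y\<^sup>2" for y :: real
    using zero_le_power2[of "y - 1/2"] by (simp add: power2_diff power_divide)
  have nn: "0 \<le> expectation (\<lambda>\<omega>. \<xi> \<omega> ^ 4)" by (rule Bochner_Integration.integral_nonneg) simp
  have "expectation (\<lambda>\<omega>. \<xi> \<omega> ^ 4) / (real p * (real p + 2)) \<le> expectation (\<lambda>\<omega>. \<xi> \<omega> ^ 4) / (real p)\<^sup>2"
    using p nn by (intro divide_left_mono) (auto simp: power2_eq_square intro!: mult_left_mono)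
  also have "\<dots> = expectation (\<lambda>\<omega>. \<xi> \<omega> ^ 4 / (real p)\<^sup>2)" by simp
  also have "\<dots> \<le> expectation (\<lambda>\<omega>. 1 + \<xi> \<omega> ^ 8 / real p ^ 4)"
  proof (rule integral_mono)
    show "\<xi> \<omega> ^ 4 / (real p)\<^sup>2 \<le> 1 + \<xi> \<omega> ^ 8 / real p ^ 4" for \<omega>
      using y[of "\<xi> \<omega> ^ 4 / (real p)\<^sup>2"] by (simp add: power_divide)
  qed (use xi_eighth xi_power_integrable[of 4] in auto)
  also have "\<dots> = 1 + expectation (\<lambda>\<omega>. \<xi> \<omega> ^ 8) / real p ^ 4"
    using xi_eighth by (simp add: prob_space)
  finally show ?thesis .
qed

lemma gram_trace_pos: "gram_trace p a > 0"
  unfolding gram_trace_def using p row_pos by (intro sum_pos) (auto simp: lessThan_empty_iff)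

end

section \<open>The estimator as a ratio of kernel sums\<close>

lemma eucl_norm_diff_square:
  assumes "x \<in> carrier_vec p" "y \<in> carrier_vec p"
  shows "(eucl_norm (x - y))\<^sup>2 = (\<Sum>c<p. (x $ c - y $ c)\<^sup>2)"
proof -
  have "(eucl_norm (x - y))\<^sup>2 = (\<Sum>c<p. ((x - y) $ c)\<^sup>2)"
    using assms by (subst eucl_norm_L2_set[of _ p]) (auto simp: L2_set_def sum_nonneg)
  also have "\<dots> = (\<Sum>c<p. (x $ c - y $ c)\<^sup>2)"
    using assms by (intro sum.cong) auto
  finally show ?thesis .
qed

text \<open>For \<open>n \<ge> 4\<close> the common normalisation is nonzero and cancels. The
  identity holds for a vanishing denominator as well, since both quotients are then 0.\<close>

lemma theta_hat_eq_ratio: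
  assumes n: "n \<ge> 4"
  defines "d \<equiv> (\<lambda>x i j. (eucl_norm (x i - x j))\<^sup>2)"
  defines "e \<equiv> (\<lambda>x i j k l. ((x i - x j) \<bullet> (x k - x l))\<^sup>2)"
  shows "theta_hat n x =
    (\<Sum>(i, j, k, l)\<in>quadruples n. (d x i j - d x k l)\<^sup>2 + d x i j * d x k l - 2 * e x i j k l) /
    (\<Sum>(i, j, k, l)\<in>quadruples n. d x i j * d x k l + 2 * e x i j k l)"
proof -
  define c where "c = 1 / (4 * real n * (real n - 1) * (real n - 2) * (real n - 3))"
  have c: "c \<noteq> 0" using n by (simp add: c_def)
  have "T1 n x + T2 n x - 2 * T3 n x =
    c * (\<Sum>(i, j, k, l)\<in>quadruples n. (d x i j - d x k l)\<^sup>2 + d x i j * d x k l - 2 * e x i j k l)"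
    unfolding T1_def T2_def T3_def c_def[symmetric] d_def e_def
    by (simp add: case_prod_unfold sum.distrib sum_subtractf sum_distrib_left algebra_simps)
  moreover have "T2 n x + 2 * T3 n x = c * (\<Sum>(i, j, k, l)\<in>quadruples n. d x i j * d x k l + 2 * e x i j k l)"
    unfolding T1_def T2_def T3_def c_def[symmetric] d_def e_def
    by (simp add: case_prod_unfold sum.distrib sum_subtractf sum_distrib_left algebra_simps)
  ultimately show ?thesis using c by (simp add: theta_hat_def)
qed

lemma (in centred_sample) theta_hat_eq_kernel_ratio:
  assumes n: "n \<ge> 4" and Z: "Z = (\<lambda>i c \<omega>. X i \<omega> $ c - \<mu> $ c)"
    and X: "\<And>i. i \<in> {1..n} \<Longrightarrow> X i \<omega> \<in> carrier_vec p"
  shows "theta_hat n (\<lambda>i. X i \<omega>) =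
    (\<Sum>q\<in>quadruples n. kernel_num q \<omega>) / (\<Sum>q\<in>quadruples n. kernel_den q \<omega>)"
proof -
  have D: "(eucl_norm (X i \<omega> - X j \<omega>))\<^sup>2 = D i j \<omega>" if "i \<in> {1..n}" "j \<in> {1..n}" for i j
    unfolding eucl_norm_diff_square[OF X[OF that(1)] X[OF that(2)]] unfolding D_def by (simp add: Z)
  have P: "(X i \<omega> - X j \<omega>) \<bullet> (X k \<omega> - X l \<omega>) = P i j k l \<omega>"
    if "i \<in> {1..n}" "j \<in> {1..n}" "k \<in> {1..n}" "l \<in> {1..n}" for i j k l
    unfolding P_def using X[OF that(1)] X[OF that(2)] X[OF that(3)] X[OF that(4)]
    by (auto simp: Z scalar_prod_def atLeast0LessThan intro!: sum.cong)
  have "(\<Sum>q\<in>quadruples n. kernel_num q \<omega>) = (\<Sum>(i, j, k, l)\<in>quadruples n. ((eucl_norm (X i \<omega> - X j \<omega>))\<^sup>2 - (eucl_norm (X k \<omega> - X l \<omega>))\<^sup>2)\<^sup>2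
      + (eucl_norm (X i \<omega> - X j \<omega>))\<^sup>2 * (eucl_norm (X k \<omega> - X l \<omega>))\<^sup>2 - 2 * ((X i \<omega> - X j \<omega>) \<bullet> (X k \<omega> - X l \<omega>))\<^sup>2)"
    by (intro sum.cong refl) (auto simp: quadruples_def D P)
  moreover have "(\<Sum>q\<in>quadruples n. kernel_den q \<omega>) = (\<Sum>(i, j, k, l)\<in>quadruples n.
      (eucl_norm (X i \<omega> - X j \<omega>))\<^sup>2 * (eucl_norm (X k \<omega> - X l \<omega>))\<^sup>2 + 2 * ((X i \<omega> - X j \<omega>) \<bullet> (X k \<omega> - X l \<omega>))\<^sup>2)"
    by (intro sum.cong refl) (auto simp: quadruples_def D P)
  ultimately show ?thesis by (simp add: theta_hat_eq_ratio[OF n])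
qed

text \<open>From \<open>n = 6\<close> on each of n - 1, n - 2 and n - 3 is at least n / 2, whence
  the factor 8 = 2^3.\<close>

lemma overlap_ratio_le:
  assumes n: "n \<ge> 6"
  shows "real n ^ 3 / card (quadruples n) \<le> 8 / real n"
proof -
  have "real n * (real n / 2) * (real n / 2) * (real n / 2) \<le> real n * (real n - 1) * (real n - 2) * (real n - 3)"
    using n by (intro mult_mono) auto
  moreover have "real (card (quadruples n)) = real n * (real n - 1) * (real n - 2) * (real n - 3)"
    using n by (intro card_quadruples) simp
  ultimately have "real n * real n ^ 3 \<le> 8 * real (card (quadruples n))"
    by (simp add: power3_eq_cube)
  moreover have "real (card (quadruples n)) > 0"
    using n by (subst card_quadruples) auto
  ultimately show ?thesis using n by (simp add: field_simps)
qed

lemma pos_def_diag_pos: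
  assumes "pos_def p A" "c < p"
  shows "A $$ (c, c) > 0"
proof -
  have A: "A \<in> carrier_mat p p" using assms by (simp add: pos_def_def)
  have "unit_vec p c \<bullet> (A *\<^sub>v unit_vec p c) > 0"
    using assms by (simp add: pos_def_def)
  then show ?thesis using A assms(2) by simp
qed

text \<open>A bound at a single n, uniform over the model: the dimension, the mean, the scatter
  matrix and the law of xi enter only through \<open>C\<close>, since the eighth-moment bound and
  the squared mean of the denominator both scale as the fourth power of the trace.\<close>

lemma theta_hat_tail:
  fixes N :: "'b measure" and M :: "'a measure"
  assumes p: "p \<ge> 1" and N: "prob_space N" and mu: "\<mu> \<in> carrier_vec p"
    and A: "pos_def p A"
    and indep: "prob_space.indep_rv N borel \<xi> (borel_vec p) U"
    and U: "distr N (borel_vec p) U = sphere_uniform p"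
    and xi2: "(\<integral>\<omega>. \<xi> \<omega> ^ 2 \<partial>N) = real p"
    and xi8: "integrable N (\<lambda>\<omega>. \<xi> \<omega> ^ 8)"
    and C: "(\<integral>\<omega>. \<xi> \<omega> ^ 8 \<partial>N) \<le> C * real p ^ 4"
    and M: "prob_space M" and ind: "prob_space.indep_vars M (\<lambda>i. borel_vec p) X {1..n}"
    and copies: "\<And>i. i \<in> {1..n} \<Longrightarrow> distr M (borel_vec p) (X i) =
      distr N (borel_vec p) (\<lambda>\<omega>. \<mu> + \<xi> \<omega> \<cdot>\<^sub>v (A *\<^sub>v U \<omega>))"
    and theta: "\<theta> = (\<integral>\<omega>. \<xi> \<omega> ^ 4 \<partial>N) / (real p * (real p + 2))"
    and n: "n \<ge> 6" and \<epsilon>: "\<epsilon> > 0"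
  shows "measure M {\<omega> \<in> space M. \<epsilon> < \<bar>theta_hat n (\<lambda>i. X i \<omega>) - \<theta>\<bar>} \<le>
    16384 * (1 + (2 + C)\<^sup>2 / \<epsilon>\<^sup>2) * (105 * C) * (8 / real n)"
proof -
  define a where "a = (\<lambda>c j. A $$ (c, j))"
  have Ac: "A \<in> carrier_mat p p" using A by (simp add: pos_def_def)
  interpret E: elliptical N p \<xi> U a
  proof (intro elliptical.intro elliptical_axioms.intro N p indep U xi2 xi8)
    fix c assume c: "c < p"
    \<comment> \<open>The diagonal entry of a positive definite matrix is positive, and its square
      is one summand of the row's Gram entry.\<close>
    have "0 < (a c c)\<^sup>2" using pos_def_diag_pos[OF A c] by (simp add: a_def)
    also have "\<dots> \<le> (\<Sum>j<p. (a c j)\<^sup>2)" using c by (intro member_le_sum) auto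
    finally show "gram p a c c > 0" by (simp add: gram_diag)
  qed
  define K where "K = 105 * E.expectation (\<lambda>\<omega>. \<xi> \<omega> ^ 8) / real p ^ 4 * gram_trace p a ^ 4"
  interpret S: centred_sample M n p "\<lambda>i c \<omega>. X i \<omega> $ c - \<mu> $ c" "block_algebra p M X" "gram p a"
    "\<theta> * ((gram_trace p a)\<^sup>2 + 2 * gram_trace2 p a)" K
    unfolding theta K_def
    by (rule E.sample_is_centred_sample[OF M Ac _ mu ind copies]) (simp_all add: a_def)
  have t: "S.t = gram_trace p a" and s: "S.s = gram_trace2 p a"
    by (simp_all add: S.t_def S.s_def gram_trace_def gram_trace2_def)
  have X: "X i \<omega> \<in> carrier_vec p" if "i \<in> {1..n}" "\<omega> \<in> space M" for i \<omega>
  proof -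
    have "X i \<in> measurable M (borel_vec p)"
      using ind that by (auto simp: S.indep_vars_def)
    from measurable_space[OF this that(2)] show ?thesis by (simp add: space_borel_vec)
  qed
  define b where "b = S.t\<^sup>2 + 2 * S.s"
  have s_nonneg: "0 \<le> S.s" by (simp add: S.s_def sum_nonneg)
  have bt: "b \<ge> S.t\<^sup>2" using s_nonneg by (simp add: b_def)
  have t2: "S.t\<^sup>2 > 0" using E.gram_trace_pos by (simp add: t)
  have b: "b > 0" using bt t2 by linarith
  define m8 where "m8 = E.expectation (\<lambda>\<omega>. \<xi> \<omega> ^ 8) / real p ^ 4"
  have m8: "0 \<le> m8" "m8 \<le> C"
    using C p by (auto simp: m8_def divide_le_eq intro!: divide_nonneg_nonneg Bochner_Integration.integral_nonneg)
  have K: "K = 105 * m8 * (S.t\<^sup>2)\<^sup>2" by (simp add: K_def m8_def t)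
  have K_nonneg: "K \<ge> 0" using m8 by (simp add: K)
  \<comment> \<open>Here \<open>b\<close> is at least the squared trace because \<open>S.s\<close>
    is a sum of squares, so the relative second moment of the kernels is at most a multiple of
    \<open>C\<close>.\<close>
  have "K \<le> 105 * C * b\<^sup>2"
    unfolding K using m8 bt by (intro mult_mono power_mono) auto
  then have Kb: "K / b\<^sup>2 \<le> 105 * C" using b by (simp add: divide_le_eq)
  have th0: "0 \<le> \<theta>" unfolding theta by (intro divide_nonneg_nonneg Bochner_Integration.integral_nonneg) auto
  have th1: "\<theta> \<le> 1 + C" using E.fourth_moment_le m8 by (simp add: theta m8_def)
  have "{\<omega> \<in> space M. \<epsilon> < \<bar>theta_hat n (\<lambda>i. X i \<omega>) - \<theta>\<bar>} =
    {\<omega> \<in> space M. \<epsilon> < \<bar>(\<Sum>q\<in>quadruples n. S.kernel_num q \<omega>) / (\<Sum>q\<in>quadruples n. S.kernel_den q \<omega>) - \<theta>\<bar>}"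
    using n X by (intro Collect_cong conj_cong refl) (subst S.theta_hat_eq_kernel_ratio, auto)
  then have "measure M {\<omega> \<in> space M. \<epsilon> < \<bar>theta_hat n (\<lambda>i. X i \<omega>) - \<theta>\<bar>}
    \<le> 16384 * (1 + (1 + \<bar>\<theta>\<bar>)\<^sup>2 / \<epsilon>\<^sup>2) * (K / b\<^sup>2) * (real n ^ 3 / card (quadruples n))"
    using S.ratio_tail[of \<theta> \<epsilon>] n b \<epsilon> K_nonneg by (simp add: b_def t s)
  also have "\<dots> \<le> 16384 * (1 + (2 + C)\<^sup>2 / \<epsilon>\<^sup>2) * (105 * C) * (8 / real n)"
  proof (intro mult_mono overlap_ratio_le[OF n] Kb order_refl)
    show "1 + (1 + \<bar>\<theta>\<bar>)\<^sup>2 / \<epsilon>\<^sup>2 \<le> 1 + (2 + C)\<^sup>2 / \<epsilon>\<^sup>2"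
      using th0 th1 by (intro add_left_mono divide_right_mono power_mono) auto
  qed (use m8 K_nonneg in auto)
  finally show ?thesis .
qed

theorem theorem2p1:
  fixes p :: "nat \<Rightarrow> nat"
    and N :: "nat \<Rightarrow> 'b measure" and \<xi> :: "nat \<Rightarrow> 'b \<Rightarrow> real" and U :: "nat \<Rightarrow> 'b \<Rightarrow> real vec"
    and \<mu> :: "nat \<Rightarrow> real vec" and \<Sigma> \<Sigma>half :: "nat \<Rightarrow> real mat"
    and M :: "nat \<Rightarrow> 'a measure" and X :: "nat \<Rightarrow> nat \<Rightarrow> 'a \<Rightarrow> real vec"
    and \<theta> :: "nat \<Rightarrow> real"
  assumes p_pos: "\<And>n. p n \<ge> 1"
    and N: "\<And>n. prob_space (N n)"
    and mu: "\<And>n. \<mu> n \<in> carrier_vec (p n)"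
    and Sigma: "\<And>n. pos_def (p n) (\<Sigma> n)"
    and Sigma_half: "\<And>n. is_sqrt_mat (p n) (\<Sigma>half n) (\<Sigma> n)"
    and xi_nonneg: "\<And>n \<omega>. \<omega> \<in> space (N n) \<Longrightarrow> \<xi> n \<omega> \<ge> 0"
    and indep_xi_U: "\<And>n. prob_space.indep_rv (N n) borel (\<xi> n) (borel_vec (p n)) (U n)"
    and U: "\<And>n. distr (N n) (borel_vec (p n)) (U n) = sphere_uniform (p n)"
    and xi_second_moment: "\<And>n. (\<integral>\<omega>. \<xi> n \<omega> ^ 2 \<partial>N n) = real (p n)"
    and M: "\<And>n. prob_space (M n)"
    and X_indep: "\<And>n. prob_space.indep_vars (M n) (\<lambda>i. borel_vec (p n)) (X n) {1..n}"
    and X_copies: "\<And>n i. i \<in> {1..n} \<Longrightarrow>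
      distr (M n) (borel_vec (p n)) (X n i) =
      distr (N n) (borel_vec (p n)) (\<lambda>\<omega>. \<mu> n + \<xi> n \<omega> \<cdot>\<^sub>v (\<Sigma>half n *\<^sub>v U n \<omega>))"
    and theta: "\<And>n. \<theta> n = (\<integral>\<omega>. \<xi> n \<omega> ^ 4 \<partial>N n) / (real (p n) * (real (p n) + 2))"
    and p_lim: "filterlim p at_top sequentially"
    and tr4_lim: "filterlim (\<lambda>n. mat_trace (\<Sigma> n ^\<^sub>m 4)) at_top sequentially"
    and tr_ratio: "(\<lambda>n. mat_trace (\<Sigma> n ^\<^sub>m 4) / (mat_trace (\<Sigma> n ^\<^sub>m 2))\<^sup>2) \<longlonglongrightarrow> 0"
    and xi8_finite: "\<forall>\<^sub>F n in sequentially. integrable (N n) (\<lambda>\<omega>. \<xi> n \<omega> ^ 8)"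
    and xi8_bigo: "(\<lambda>n. \<integral>\<omega>. \<xi> n \<omega> ^ 8 \<partial>N n) \<in> O(\<lambda>n. real (p n) ^ 4)"
  shows "tendsto_in_prob M (\<lambda>n \<omega>. theta_hat n (\<lambda>i. X n i \<omega>) - \<theta> n) 0"
proof -
  obtain C where C: "\<forall>\<^sub>F n in sequentially. norm (\<integral>\<omega>. \<xi> n \<omega> ^ 8 \<partial>N n) \<le> C * norm (real (p n) ^ 4)"
    using xi8_bigo by (elim landau_o.bigE)
  show ?thesis
    unfolding tendsto_in_prob_def
  proof (intro allI impI)
    fix \<epsilon> :: real assume \<epsilon>: "\<epsilon> > 0"
    \<comment> \<open>The bound is eventual for three reasons: the big-O estimate, the integrability
      of the eighth power, and \<open>n \<ge> 6\<close>. Integrability is a separate ingredient,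
      since a Bochner integral that does not exist has value 0 and would satisfy the estimate
      trivially.\<close>
    have bound: "\<forall>\<^sub>F n in sequentially.
      measure (M n) {\<omega> \<in> space (M n). \<epsilon> < \<bar>theta_hat n (\<lambda>i. X n i \<omega>) - \<theta> n - 0\<bar>} \<le>
        16384 * (1 + (2 + C)\<^sup>2 / \<epsilon>\<^sup>2) * (105 * C) * (8 / real n)"
      using C xi8_finite eventually_ge_at_top[of 6]
    proof eventually_elim
      case (elim n)
      have "pos_def (p n) (\<Sigma>half n)" using Sigma_half[of n] by (simp add: is_sqrt_mat_def)
      then show ?case
        using theta_hat_tail[where p="p n" and N="N n" and \<mu>="\<mu> n" and A="\<Sigma>half n" and \<xi>="\<xi> n" and U="U n"
            and M="M n" and X="X n" and n=n and \<theta>="\<theta> n" and C=C and \<epsilon>=\<epsilon>, OF p_pos N mu _ indep_xi_U U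
            xi_second_moment _ _ M X_indep X_copies theta] elim \<epsilon>
        by simp
    qed
    have "(\<lambda>n. 16384 * (1 + (2 + C)\<^sup>2 / \<epsilon>\<^sup>2) * (105 * C) * (8 / real n)) \<longlonglongrightarrow>
        16384 * (1 + (2 + C)\<^sup>2 / \<epsilon>\<^sup>2) * (105 * C) * 0"
      by (intro tendsto_mult_left tendsto_divide_0[OF tendsto_const] filterlim_at_top_imp_at_infinity filterlim_real_sequentially)
    then have lim: "(\<lambda>n. 16384 * (1 + (2 + C)\<^sup>2 / \<epsilon>\<^sup>2) * (105 * C) * (8 / real n)) \<longlonglongrightarrow> 0" by simp
    show "(\<lambda>n. measure (M n) {\<omega> \<in> space (M n). \<epsilon> < \<bar>theta_hat n (\<lambda>i. X n i \<omega>) - \<theta> n - 0\<bar>}) \<longlonglongrightarrow> 0"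
      by (rule tendsto_sandwich[OF _ bound tendsto_const lim]) simp
  qed
qed

end
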